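(* Let $\mathcal{D}$ be a category. The construction $E$ defines a functor $$\mathcal{D}\text{-}\mathbf{2Cat}^{\bullet\to\bullet}_{\mathrm{lax},\mathrm{str}}\longrightarrow\mathrm{Span}(\mathcal{D}\text{-}\mathbf{2Cat})$$ given on objects by sending a $\mathcal{D}$-lax map $i:X\to Z$ to the span of strict $\mathcal{D}$-maps $$X\xleftarrow{\ \omega\ }Ei\xrightarrow{\ \nu\ }Z.$$
   Context: $\mathbf{2Cat}$ is the category of (strict) 2-categories and strict 2-functors. $\mathcal{D}\text{-}\mathbf{2Cat}$ is the category of functors $\mathcal{D}\to\mathbf{2Cat}$ ("$\mathcal{D}$-2-categories") and natural transformations ("strict $\mathcal{D}$-maps"); write $\phi_*=X(\phi)$. A $\mathcal{D}$-lax map $h:X\to Y$ consists of 2-functors $h_m:X(m)\to Y(m)$ and 2-natural transformations $h_\phi:\phi_*h_m\Rightarrow h_n\phi_*$ for each $\phi:m\to n$, such that $h_{\mathrm{id}_m}$ is the identity and $h_{\psi\phi}$ is the pasting of $h_\phi$ and $h_\psi$. Composition: $(jh)_m=j_mh_m$, with $(jh)_\phi$ the pasting of $j_\phi$ and $h_\phi$. Strict maps are the lax maps with all $h_\phi$ identities. $\mathcal{D}\text{-}\mathbf{2Cat}^{\bullet\to\bullet}_{\mathrm{lax},\mathrm{str}}$ is the category whose objects are $\mathcal{D}$-lax maps $i:X\to Z$ and whose morphisms $(i:X\to Z)\to(j:Y\to W)$ are pairs of strict $\mathcal{D}$-maps $h:X\to Y$, $k:Z\to W$ with $ki=jh$ as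 $\mathcal{D}$-lax maps. $\mathrm{Span}(\mathcal{E})$ is the category whose objects are diagrams $X\leftarrow A\to Y$ in $\mathcal{E}$ and whose morphisms are triples of maps making the two evident squares commute. For a $\mathcal{D}$-lax map $k:X\to Z$, the $\mathcal{D}$-2-category $Ek$ is: $Ek(m)$ has objects $(x,f,a)$ with $x\in X(m)$, $a\in Z(m)$ and $f:a\to k_m(x)$ a 1-cell in $Z(m)$; 1-cells $(x,f,a)\to(y,g,b)$ are pairs $(s,r)$ of 1-cells $s:x\to y$, $r:a\to b$ with $g\,r=k_m(s)\,f$; 2-cells $(s,r)\Rightarrow(s',r')$ are pairs $(\beta:s\Rightarrow s',\alpha:r\Rightarrow r')$ with $g*\alpha=k_m(\beta)*f$; compositions are componentwise. For $\phi:m\to n$, $\phi_*(x,f,a)=(\phi_*x,\;k_\phi(x)\circ\phi_*(f),\;\phi_*a)$ and $\phi_*$ acts componentwise on 1- and 2-cells. The strict map $\omega:Ek\to X$ is the projection to $X$ ($(x,f,a)\mapsto x$) and the strict map $\nu:Ek\to Z$ is the projection $(x,f,a)\mapsto a$, each acting correspondingly on cells. On a morphism $(h,k):i\to j$ of the arrow category, $E$ gives the strict map $Ei\to Ej$, $(x,f,a)\mapsto(h(x),k(f),k(a))$ (similarly on cells), together with $h$ and $k$. *)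

theory Defs
  imports "HOL-Library.FuncSet"
begin

section \<open>Categories, functors, natural transformations\<close>

record ('o, 'a) cat =
  Obj :: "'o set"
  Arr :: "'a set"
  Dom :: "'a \<Rightarrow> 'o"
  Cod :: "'a \<Rightarrow> 'o"
  Id :: "'o \<Rightarrow> 'a"
  Comp :: "'a \<Rightarrow> 'a \<Rightarrow> 'a"  \<comment> \<open>\<open>Comp C g f\<close> is \<open>g\<close> after \<open>f\<close>\<close>

definition in_hom :: "('o, 'a) cat \<Rightarrow> 'a \<Rightarrow> 'o \<Rightarrow> 'o \<Rightarrow> bool" where
  "in_hom C f x y \<longleftrightarrow> f \<in> Arr C \<and> Dom C f = x \<and> Cod C f = y"

locale category =
  fixes C :: "('o, 'a) cat"
  assumes Dom_Obj: "f \<in> Arr C \<Longrightarrow> Dom C f \<in> Obj C"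
    and Cod_Obj: "f \<in> Arr C \<Longrightarrow> Cod C f \<in> Obj C"
    and Id_hom: "x \<in> Obj C \<Longrightarrow> in_hom C (Id C x) x x"
    and Comp_hom: "in_hom C f x y \<Longrightarrow> in_hom C g y z \<Longrightarrow> in_hom C (Comp C g f) x z"
    and Id_left: "in_hom C f x y \<Longrightarrow> Comp C (Id C y) f = f"
    and Id_right: "in_hom C f x y \<Longrightarrow> Comp C f (Id C x) = f"
    and Comp_assoc: "in_hom C f w x \<Longrightarrow> in_hom C g x y \<Longrightarrow> in_hom C h y z \<Longrightarrow>
      Comp C h (Comp C g f) = Comp C (Comp C h g) f"

text \<open>
  Everywhere below, maps are required to be extensional (\<open>undefined\<close> off their domain), so that
  HOL equality of functors, transformations, 2-categories etc. is equality of the mathematical data.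
\<close>

record ('o1, 'a1, 'o2, 'a2) ftr =
  fobj :: "'o1 \<Rightarrow> 'o2"
  farr :: "'a1 \<Rightarrow> 'a2"

locale cat_functor = C: category C + D: category D
  for C :: "('o1, 'a1) cat" and D :: "('o2, 'a2) cat" +
  fixes F :: "('o1, 'a1, 'o2, 'a2) ftr"
  assumes fobj_in: "fobj F \<in> Obj C \<rightarrow>\<^sub>E Obj D"
    and farr_in: "farr F \<in> Arr C \<rightarrow>\<^sub>E Arr D"
    and farr_hom: "in_hom C f x y \<Longrightarrow> in_hom D (farr F f) (fobj F x) (fobj F y)"
    and farr_Id: "x \<in> Obj C \<Longrightarrow> farr F (Id C x) = Id D (fobj F x)"
    and farr_Comp: "in_hom C f x y \<Longrightarrow> in_hom C g y z \<Longrightarrow>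
      farr F (Comp C g f) = Comp D (farr F g) (farr F f)"

record ('o1, 'a1, 'o2, 'a2) ntrans =
  nt_src :: "('o1, 'a1, 'o2, 'a2) ftr"
  nt_trg :: "('o1, 'a1, 'o2, 'a2) ftr"
  nt_comp :: "'o1 \<Rightarrow> 'a2"

locale natural_transformation = S: cat_functor C D "nt_src \<eta>" + T: cat_functor C D "nt_trg \<eta>"
  for C :: "('o1, 'a1) cat" and D :: "('o2, 'a2) cat" and \<eta> :: "('o1, 'a1, 'o2, 'a2) ntrans" +
  assumes nt_ext: "nt_comp \<eta> \<in> extensional (Obj C)"
    and nt_hom: "x \<in> Obj C \<Longrightarrow>
      in_hom D (nt_comp \<eta> x) (fobj (nt_src \<eta>) x) (fobj (nt_trg \<eta>) x)"
    and nt_natural: "in_hom C f x y \<Longrightarrow>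
      Comp D (farr (nt_trg \<eta>) f) (nt_comp \<eta> x) = Comp D (nt_comp \<eta> y) (farr (nt_src \<eta>) f)"

definition functor_cat :: "('o1, 'a1) cat \<Rightarrow> ('o2, 'a2) cat \<Rightarrow>
    (('o1, 'a1, 'o2, 'a2) ftr, ('o1, 'a1, 'o2, 'a2) ntrans) cat" where
  "functor_cat C D = \<lparr>
     Obj = {F. cat_functor C D F},
     Arr = {\<eta>. natural_transformation C D \<eta>},
     Dom = nt_src,
     Cod = nt_trg,
     Id = (\<lambda>F. \<lparr>nt_src = F, nt_trg = F, nt_comp = (\<lambda>x\<in>Obj C. Id D (fobj F x))\<rparr>),
     Comp = (\<lambda>\<theta> \<eta>. \<lparr>nt_src = nt_src \<eta>, nt_trg = nt_trg \<theta>,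
                nt_comp = (\<lambda>x\<in>Obj C. Comp D (nt_comp \<theta> x) (nt_comp \<eta> x))\<rparr>)\<rparr>"


section \<open>Spans\<close>

record ('o, 'a) span =
  lobj :: 'o
  apex :: 'o
  robj :: 'o
  lleg :: 'a
  rleg :: 'a

record ('o, 'a) span_map =
  sm_src :: "('o, 'a) span"
  sm_trg :: "('o, 'a) span"
  lmap :: 'a
  amap :: 'a
  rmap :: 'a

definition is_span :: "('o, 'a) cat \<Rightarrow> ('o, 'a) span \<Rightarrow> bool" where
  "is_span E S \<longleftrightarrow> lobj S \<in> Obj E \<and> apex S \<in> Obj E \<and> robj S \<in> Obj E
     \<and> in_hom E (lleg S) (apex S) (lobj S) \<and> in_hom E (rleg S) (apex S) (robj S)"

definition is_span_map :: "('o, 'a) cat \<Rightarrow> ('o, 'a) span_map \<Rightarrow> bool" where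
  "is_span_map E t \<longleftrightarrow> (let S = sm_src t; T = sm_trg t in
     is_span E S \<and> is_span E T
     \<and> in_hom E (lmap t) (lobj S) (lobj T)
     \<and> in_hom E (amap t) (apex S) (apex T)
     \<and> in_hom E (rmap t) (robj S) (robj T)
     \<and> Comp E (lmap t) (lleg S) = Comp E (lleg T) (amap t)
     \<and> Comp E (rmap t) (rleg S) = Comp E (rleg T) (amap t))"

definition span_cat :: "('o, 'a) cat \<Rightarrow> (('o, 'a) span, ('o, 'a) span_map) cat" where
  "span_cat E = \<lparr>
     Obj = {S. is_span E S},
     Arr = {t. is_span_map E t},
     Dom = sm_src,
     Cod = sm_trg,
     Id = (\<lambda>S. \<lparr>sm_src = S, sm_trg = S,
              lmap = Id E (lobj S), amap = Id E (apex S), rmap = Id E (robj S)\<rparr>),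
     Comp = (\<lambda>u t. \<lparr>sm_src = sm_src t, sm_trg = sm_trg u,
                lmap = Comp E (lmap u) (lmap t),
                amap = Comp E (amap u) (amap t),
                rmap = Comp E (rmap u) (rmap t)\<rparr>)\<rparr>"


section \<open>Strict 2-categories, 2-functors, 2-natural transformations\<close>

text \<open>
  All cells of a 2-category are drawn from one type \<open>'u\<close>. The fields \<open>src1\<close>, \<open>trg1\<close> give the
  boundary objects of a 1-cell, \<open>src2\<close>, \<open>trg2\<close> the boundary 1-cells of a 2-cell.
\<close>

record 'u two_cat =
  cells0 :: "'u set"
  cells1 :: "'u set"
  cells2 :: "'u set"
  src1 :: "'u \<Rightarrow> 'u"
  trg1 :: "'u \<Rightarrow> 'u"
  src2 :: "'u \<Rightarrow> 'u"
  trg2 :: "'u \<Rightarrow> 'u"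
  id1 :: "'u \<Rightarrow> 'u"
  id2 :: "'u \<Rightarrow> 'u"
  comp1 :: "'u \<Rightarrow> 'u \<Rightarrow> 'u"
  vcomp :: "'u \<Rightarrow> 'u \<Rightarrow> 'u"
  hcomp :: "'u \<Rightarrow> 'u \<Rightarrow> 'u"

text \<open>Objects with 1-cells; 1-cells with 2-cells (vertical); objects with 2-cells (horizontal).\<close>

definition cat1 :: "'u two_cat \<Rightarrow> ('u, 'u) cat" where
  "cat1 A = \<lparr>Obj = cells0 A, Arr = cells1 A, Dom = src1 A, Cod = trg1 A,
     Id = id1 A, Comp = comp1 A\<rparr>"

definition catv :: "'u two_cat \<Rightarrow> ('u, 'u) cat" where
  "catv A = \<lparr>Obj = cells1 A, Arr = cells2 A, Dom = src2 A, Cod = trg2 A,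
     Id = id2 A, Comp = vcomp A\<rparr>"

definition cath :: "'u two_cat \<Rightarrow> ('u, 'u) cat" where
  "cath A = \<lparr>Obj = cells0 A, Arr = cells2 A,
     Dom = (\<lambda>\<sigma>. src1 A (src2 A \<sigma>)), Cod = (\<lambda>\<sigma>. trg1 A (trg2 A \<sigma>)),
     Id = (\<lambda>x. id2 A (id1 A x)), Comp = hcomp A\<rparr>"

locale two_category =
  cat1: category "cat1 A" + catv: category "catv A" + cath: category "cath A"
  for A :: "'u two_cat" +
  assumes globular: "\<sigma> \<in> cells2 A \<Longrightarrow> src1 A (src2 A \<sigma>) = src1 A (trg2 A \<sigma>)"
      "\<sigma> \<in> cells2 A \<Longrightarrow> trg1 A (src2 A \<sigma>) = trg1 A (trg2 A \<sigma>)"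
    and hcomp_boundary:
      "in_hom (cath A) \<sigma> x y \<Longrightarrow> in_hom (cath A) \<tau> y z \<Longrightarrow>
        src2 A (hcomp A \<tau> \<sigma>) = comp1 A (src2 A \<tau>) (src2 A \<sigma>)"
      "in_hom (cath A) \<sigma> x y \<Longrightarrow> in_hom (cath A) \<tau> y z \<Longrightarrow>
        trg2 A (hcomp A \<tau> \<sigma>) = comp1 A (trg2 A \<tau>) (trg2 A \<sigma>)"
    and hcomp_id2: "in_hom (cat1 A) f x y \<Longrightarrow> in_hom (cat1 A) g y z \<Longrightarrow>
      hcomp A (id2 A g) (id2 A f) = id2 A (comp1 A g f)"
    and interchange: "in_hom (cath A) \<sigma> x y \<Longrightarrow> in_hom (cath A) \<tau> y z \<Longrightarrow>
      in_hom (catv A) \<sigma> f f' \<Longrightarrow> in_hom (catv A) \<sigma>' f' f'' \<Longrightarrow>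
      in_hom (catv A) \<tau> g g' \<Longrightarrow> in_hom (catv A) \<tau>' g' g'' \<Longrightarrow>
      hcomp A (vcomp A \<tau>' \<tau>) (vcomp A \<sigma>' \<sigma>) = vcomp A (hcomp A \<tau>' \<sigma>') (hcomp A \<tau> \<sigma>)"
    and ext_maps: "src1 A \<in> extensional (cells1 A)" "trg1 A \<in> extensional (cells1 A)"
      "src2 A \<in> extensional (cells2 A)" "trg2 A \<in> extensional (cells2 A)"
      "id1 A \<in> extensional (cells0 A)" "id2 A \<in> extensional (cells1 A)"
    and ext_comps:
      "\<not> (f \<in> cells1 A \<and> g \<in> cells1 A \<and> trg1 A f = src1 A g) \<Longrightarrow> comp1 A g f = undefined"
      "\<not> (\<sigma> \<in> cells2 A \<and> \<tau> \<in> cells2 A \<and> trg2 A \<sigma> = src2 A \<tau>) \<Longrightarrow> vcomp A \<tau> \<sigma> = undefined"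
      "\<not> (\<sigma> \<in> cells2 A \<and> \<tau> \<in> cells2 A \<and> trg1 A (trg2 A \<sigma>) = src1 A (src2 A \<tau>)) \<Longrightarrow>
        hcomp A \<tau> \<sigma> = undefined"

definition lwhisker :: "'u two_cat \<Rightarrow> 'u \<Rightarrow> 'u \<Rightarrow> 'u" where
  "lwhisker A g \<sigma> = hcomp A (id2 A g) \<sigma>"

definition rwhisker :: "'u two_cat \<Rightarrow> 'u \<Rightarrow> 'u \<Rightarrow> 'u" where
  "rwhisker A \<sigma> f = hcomp A \<sigma> (id2 A f)"

record 'u two_fun =
  Src :: "'u two_cat"
  Trg :: "'u two_cat"
  map0 :: "'u \<Rightarrow> 'u"
  map1 :: "'u \<Rightarrow> 'u"
  map2 :: "'u \<Rightarrow> 'u"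

locale two_functor =
  src: two_category "Src F" + trg: two_category "Trg F" +
  fun1: cat_functor "cat1 (Src F)" "cat1 (Trg F)" "\<lparr>fobj = map0 F, farr = map1 F\<rparr>" +
  funv: cat_functor "catv (Src F)" "catv (Trg F)" "\<lparr>fobj = map1 F, farr = map2 F\<rparr>" +
  funh: cat_functor "cath (Src F)" "cath (Trg F)" "\<lparr>fobj = map0 F, farr = map2 F\<rparr>"
  for F :: "'u two_fun"

definition id_two_fun :: "'u two_cat \<Rightarrow> 'u two_fun" where
  "id_two_fun A = \<lparr>Src = A, Trg = A,
     map0 = (\<lambda>x\<in>cells0 A. x), map1 = (\<lambda>f\<in>cells1 A. f), map2 = (\<lambda>\<sigma>\<in>cells2 A. \<sigma>)\<rparr>"

definition comp_two_fun :: "'u two_fun \<Rightarrow> 'u two_fun \<Rightarrow> 'u two_fun" where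
  "comp_two_fun G F = \<lparr>Src = Src F, Trg = Trg G,
     map0 = compose (cells0 (Src F)) (map0 G) (map0 F),
     map1 = compose (cells1 (Src F)) (map1 G) (map1 F),
     map2 = compose (cells2 (Src F)) (map2 G) (map2 F)\<rparr>"

definition TwoCat :: "('u two_cat, 'u two_fun) cat" where
  "TwoCat = \<lparr>Obj = {A. two_category A}, Arr = {F. two_functor F}, Dom = Src, Cod = Trg,
     Id = id_two_fun, Comp = comp_two_fun\<rparr>"

record 'u two_nat =
  tn_src :: "'u two_fun"
  tn_trg :: "'u two_fun"
  tn_comp :: "'u \<Rightarrow> 'u"

locale two_natural = S: two_functor "tn_src \<alpha>" + T: two_functor "tn_trg \<alpha>"
  for \<alpha> :: "'u two_nat" +
  assumes parallel: "Src (tn_trg \<alpha>) = Src (tn_src \<alpha>)" "Trg (tn_trg \<alpha>) = Trg (tn_src \<alpha>)"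
    and tn_ext: "tn_comp \<alpha> \<in> extensional (cells0 (Src (tn_src \<alpha>)))"
    and tn_hom: "x \<in> cells0 (Src (tn_src \<alpha>)) \<Longrightarrow>
      in_hom (cat1 (Trg (tn_src \<alpha>))) (tn_comp \<alpha> x) (map0 (tn_src \<alpha>) x) (map0 (tn_trg \<alpha>) x)"
    and tn_natural1: "in_hom (cat1 (Src (tn_src \<alpha>))) f x y \<Longrightarrow>
      comp1 (Trg (tn_src \<alpha>)) (map1 (tn_trg \<alpha>) f) (tn_comp \<alpha> x)
        = comp1 (Trg (tn_src \<alpha>)) (tn_comp \<alpha> y) (map1 (tn_src \<alpha>) f)"
    and tn_natural2: "in_hom (cath (Src (tn_src \<alpha>))) \<sigma> x y \<Longrightarrow>
      rwhisker (Trg (tn_src \<alpha>)) (map2 (tn_trg \<alpha>) \<sigma>) (tn_comp \<alpha> x)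
        = lwhisker (Trg (tn_src \<alpha>)) (tn_comp \<alpha> y) (map2 (tn_src \<alpha>) \<sigma>)"

definition id_two_nat :: "'u two_fun \<Rightarrow> 'u two_nat" where
  "id_two_nat F = \<lparr>tn_src = F, tn_trg = F,
     tn_comp = (\<lambda>x\<in>cells0 (Src F). id1 (Trg F) (map0 F x))\<rparr>"

definition vcomp_two_nat :: "'u two_nat \<Rightarrow> 'u two_nat \<Rightarrow> 'u two_nat" where
  "vcomp_two_nat \<beta> \<alpha> = \<lparr>tn_src = tn_src \<alpha>, tn_trg = tn_trg \<beta>,
     tn_comp = (\<lambda>x\<in>cells0 (Src (tn_src \<alpha>)).
       comp1 (Trg (tn_src \<alpha>)) (tn_comp \<beta> x) (tn_comp \<alpha> x))\<rparr>"

definition fun_nat :: "'u two_fun \<Rightarrow> 'u two_nat \<Rightarrow> 'u two_nat" where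
  "fun_nat G \<alpha> = \<lparr>tn_src = comp_two_fun G (tn_src \<alpha>), tn_trg = comp_two_fun G (tn_trg \<alpha>),
     tn_comp = (\<lambda>x\<in>cells0 (Src (tn_src \<alpha>)). map1 G (tn_comp \<alpha> x))\<rparr>"

definition nat_fun :: "'u two_nat \<Rightarrow> 'u two_fun \<Rightarrow> 'u two_nat" where
  "nat_fun \<alpha> F = \<lparr>tn_src = comp_two_fun (tn_src \<alpha>) F, tn_trg = comp_two_fun (tn_trg \<alpha>) F,
     tn_comp = (\<lambda>x\<in>cells0 (Src F). tn_comp \<alpha> (map0 F x))\<rparr>"


section \<open>Diagrams of 2-categories and lax maps\<close>

type_synonym ('d, 'e, 'u) d2cat = "('d, 'e, 'u two_cat, 'u two_fun) ftr"
type_synonym ('d, 'e, 'u) strict_map = "('d, 'e, 'u two_cat, 'u two_fun) ntrans"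

definition D2Cat :: "('d, 'e) cat \<Rightarrow> (('d, 'e, 'u) d2cat, ('d, 'e, 'u) strict_map) cat" where
  "D2Cat D = functor_cat D TwoCat"

record ('d, 'e, 'u) lax_map =
  lsrc :: "('d, 'e, 'u) d2cat"
  ltrg :: "('d, 'e, 'u) d2cat"
  lfun :: "'d \<Rightarrow> 'u two_fun"
  lnat :: "'e \<Rightarrow> 'u two_nat"

locale D_lax_map =
  X: cat_functor D TwoCat "lsrc h" + Y: cat_functor D TwoCat "ltrg h"
  for D :: "('d, 'e) cat" and h :: "('d, 'e, 'u) lax_map" +
  assumes lfun_ext: "lfun h \<in> extensional (Obj D)"
    and lnat_ext: "lnat h \<in> extensional (Arr D)"
    and lfun_hom: "m \<in> Obj D \<Longrightarrow> in_hom TwoCat (lfun h m) (fobj (lsrc h) m) (fobj (ltrg h) m)"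
    and lnat_natural: "\<phi> \<in> Arr D \<Longrightarrow> two_natural (lnat h \<phi>)"
    and lnat_boundary: "in_hom D \<phi> m n \<Longrightarrow>
        tn_src (lnat h \<phi>) = comp_two_fun (farr (ltrg h) \<phi>) (lfun h m)"
      "in_hom D \<phi> m n \<Longrightarrow>
        tn_trg (lnat h \<phi>) = comp_two_fun (lfun h n) (farr (lsrc h) \<phi>)"
    and lnat_Id: "m \<in> Obj D \<Longrightarrow> lnat h (Id D m) = id_two_nat (lfun h m)"
    and lnat_Comp: "in_hom D \<phi> m n \<Longrightarrow> in_hom D \<psi> n p \<Longrightarrow>
      lnat h (Comp D \<psi> \<phi>)
        = vcomp_two_nat (nat_fun (lnat h \<psi>) (farr (lsrc h) \<phi>))
                        (fun_nat (farr (ltrg h) \<psi>) (lnat h \<phi>))"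

definition comp_lax ::
    "('d, 'e) cat \<Rightarrow> ('d, 'e, 'u) lax_map \<Rightarrow> ('d, 'e, 'u) lax_map \<Rightarrow> ('d, 'e, 'u) lax_map" where
  "comp_lax D j h = \<lparr>lsrc = lsrc h, ltrg = ltrg j,
     lfun = (\<lambda>m\<in>Obj D. comp_two_fun (lfun j m) (lfun h m)),
     lnat = (\<lambda>\<phi>\<in>Arr D. vcomp_two_nat (fun_nat (lfun j (Cod D \<phi>)) (lnat h \<phi>))
                                      (nat_fun (lnat j \<phi>) (lfun h (Dom D \<phi>))))\<rparr>"

definition lax_of_strict ::
    "('d, 'e) cat \<Rightarrow> ('d, 'e, 'u) strict_map \<Rightarrow> ('d, 'e, 'u) lax_map" where
  "lax_of_strict D h = \<lparr>lsrc = nt_src h, ltrg = nt_trg h,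
     lfun = nt_comp h,
     lnat = (\<lambda>\<phi>\<in>Arr D. id_two_nat (comp_two_fun (nt_comp h (Cod D \<phi>)) (farr (nt_src h) \<phi>)))\<rparr>"

record ('d, 'e, 'u) lax_square =
  sq_src :: "('d, 'e, 'u) lax_map"
  sq_trg :: "('d, 'e, 'u) lax_map"
  sq_h :: "('d, 'e, 'u) strict_map"
  sq_k :: "('d, 'e, 'u) strict_map"

definition is_lax_square :: "('d, 'e) cat \<Rightarrow> ('d, 'e, 'u) lax_square \<Rightarrow> bool" where
  "is_lax_square D q \<longleftrightarrow> (let i = sq_src q; j = sq_trg q; h = sq_h q; k = sq_k q in
     D_lax_map D i \<and> D_lax_map D j
     \<and> in_hom (D2Cat D) h (lsrc i) (lsrc j)
     \<and> in_hom (D2Cat D) k (ltrg i) (ltrg j)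
     \<and> comp_lax D (lax_of_strict D k) i = comp_lax D j (lax_of_strict D h))"

definition lax_arrow_cat ::
    "('d, 'e) cat \<Rightarrow> (('d, 'e, 'u) lax_map, ('d, 'e, 'u) lax_square) cat" where
  "lax_arrow_cat D = \<lparr>
     Obj = {i. D_lax_map D i},
     Arr = {q. is_lax_square D q},
     Dom = sq_src,
     Cod = sq_trg,
     Id = (\<lambda>i. \<lparr>sq_src = i, sq_trg = i,
              sq_h = Id (D2Cat D) (lsrc i), sq_k = Id (D2Cat D) (ltrg i)\<rparr>),
     Comp = (\<lambda>p q. \<lparr>sq_src = sq_src q, sq_trg = sq_trg p,
                sq_h = Comp (D2Cat D) (sq_h p) (sq_h q),
                sq_k = Comp (D2Cat D) (sq_k p) (sq_k q)\<rparr>)\<rparr>"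


section \<open>The construction E\<close>

text \<open>
  The cells of \<open>Ek\<close> are tuples of cells of \<open>X\<close> and \<open>Z\<close>. For \<open>Ek\<close>, \<open>X\<close> and \<open>Z\<close> to be objects of
  the same category of 2-categories, their cells must lie in one type closed under tuples.
  The parameter \<open>'a\<close> is arbitrary, and \<open>Atom\<close> embeds 2-categories with cells in \<open>'a\<close>.
\<close>

datatype 'a cell = Atom 'a | Tuple "'a cell list"

fun coord :: "'a cell \<Rightarrow> nat \<Rightarrow> 'a cell" where
  "coord (Tuple cs) i = cs ! i"
| "coord (Atom a) i = undefined"

text \<open>
  \<open>Ek(m)\<close> depends only on the 2-functor \<open>F = k_m\<close>. A pair \<open>(s,r)\<close> does not determine the objects
  \<open>(x,f,a)\<close>, \<open>(y,g,b)\<close> it is a 1-cell between, so a 1-cell is encoded together with its source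
  and target as \<open>Tuple [P, s, r, Q]\<close>; likewise a 2-cell \<open>(\<beta>,\<alpha>)\<close> as \<open>Tuple [S, \<beta>, \<alpha>, T]\<close>.
\<close>

definition E0 :: "'a cell two_fun \<Rightarrow> 'a cell set" where
  "E0 F = {Tuple [x, f, a] | x f a.
     x \<in> cells0 (Src F) \<and> a \<in> cells0 (Trg F) \<and> in_hom (cat1 (Trg F)) f a (map0 F x)}"

definition E1 :: "'a cell two_fun \<Rightarrow> 'a cell set" where
  "E1 F = {Tuple [Tuple [x, f, a], s, r, Tuple [y, g, b]] | x f a s r y g b.
     Tuple [x, f, a] \<in> E0 F \<and> Tuple [y, g, b] \<in> E0 F
     \<and> in_hom (cat1 (Src F)) s x y \<and> in_hom (cat1 (Trg F)) r a b
     \<and> comp1 (Trg F) g r = comp1 (Trg F) (map1 F s) f}"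

definition E2 :: "'a cell two_fun \<Rightarrow> 'a cell set" where
  "E2 F = {Tuple [Tuple [Tuple [x, f, a], s, r, Tuple [y, g, b]], \<beta>, \<alpha>,
                  Tuple [Tuple [x, f, a], s', r', Tuple [y, g, b]]] | x f a s r y g b \<beta> \<alpha> s' r'.
     Tuple [Tuple [x, f, a], s, r, Tuple [y, g, b]] \<in> E1 F
     \<and> Tuple [Tuple [x, f, a], s', r', Tuple [y, g, b]] \<in> E1 F
     \<and> in_hom (catv (Src F)) \<beta> s s' \<and> in_hom (catv (Trg F)) \<alpha> r r'
     \<and> lwhisker (Trg F) g \<alpha> = rwhisker (Trg F) (map2 F \<beta>) f}"

definition E_comp1 :: "'a cell two_fun \<Rightarrow> 'a cell \<Rightarrow> 'a cell \<Rightarrow> 'a cell" where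
  "E_comp1 F T S = (if S \<in> E1 F \<and> T \<in> E1 F \<and> coord S 3 = coord T 0
     then Tuple [coord S 0, comp1 (Src F) (coord T 1) (coord S 1),
                 comp1 (Trg F) (coord T 2) (coord S 2), coord T 3]
     else undefined)"

definition E_two_cat :: "'a cell two_fun \<Rightarrow> 'a cell two_cat" where
  "E_two_cat F = \<lparr>
     cells0 = E0 F, cells1 = E1 F, cells2 = E2 F,
     src1 = (\<lambda>S\<in>E1 F. coord S 0), trg1 = (\<lambda>S\<in>E1 F. coord S 3),
     src2 = (\<lambda>\<sigma>\<in>E2 F. coord \<sigma> 0), trg2 = (\<lambda>\<sigma>\<in>E2 F. coord \<sigma> 3),
     id1 = (\<lambda>P\<in>E0 F. Tuple [P, id1 (Src F) (coord P 0), id1 (Trg F) (coord P 2), P]),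
     id2 = (\<lambda>S\<in>E1 F. Tuple [S, id2 (Src F) (coord S 1), id2 (Trg F) (coord S 2), S]),
     comp1 = E_comp1 F,
     vcomp = (\<lambda>\<tau> \<sigma>. if \<sigma> \<in> E2 F \<and> \<tau> \<in> E2 F \<and> coord \<sigma> 3 = coord \<tau> 0
       then Tuple [coord \<sigma> 0, vcomp (Src F) (coord \<tau> 1) (coord \<sigma> 1),
                   vcomp (Trg F) (coord \<tau> 2) (coord \<sigma> 2), coord \<tau> 3]
       else undefined),
     hcomp = (\<lambda>\<tau> \<sigma>. if \<sigma> \<in> E2 F \<and> \<tau> \<in> E2 F \<and> coord (coord \<sigma> 3) 3 = coord (coord \<tau> 0) 0
       then Tuple [E_comp1 F (coord \<tau> 0) (coord \<sigma> 0),
                   hcomp (Src F) (coord \<tau> 1) (coord \<sigma> 1),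
                   hcomp (Trg F) (coord \<tau> 2) (coord \<sigma> 2),
                   E_comp1 F (coord \<tau> 3) (coord \<sigma> 3)]
       else undefined)\<rparr>"

text \<open>
  The 2-functor \<open>E_two_cat F \<rightarrow> E_two_cat G\<close> acting by \<open>u\<close> on objects and componentwise by
  \<open>H\<close>, \<open>K\<close> on 1- and 2-cells.
\<close>

definition E_two_fun ::
    "'a cell two_fun \<Rightarrow> 'a cell two_fun \<Rightarrow> ('a cell \<Rightarrow> 'a cell) \<Rightarrow>
     'a cell two_fun \<Rightarrow> 'a cell two_fun \<Rightarrow> 'a cell two_fun" where
  "E_two_fun F G u H K =
    (let v = (\<lambda>S. Tuple [u (coord S 0), map1 H (coord S 1), map1 K (coord S 2), u (coord S 3)])
     in \<lparr>Src = E_two_cat F, Trg = E_two_cat G,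
         map0 = (\<lambda>P\<in>E0 F. u P),
         map1 = (\<lambda>S\<in>E1 F. v S),
         map2 = (\<lambda>\<sigma>\<in>E2 F. Tuple [v (coord \<sigma> 0), map2 H (coord \<sigma> 1),
                                  map2 K (coord \<sigma> 2), v (coord \<sigma> 3)])\<rparr>)"

definition E_push :: "('d, 'e) cat \<Rightarrow> ('d, 'e, 'a cell) lax_map \<Rightarrow> 'e \<Rightarrow> 'a cell two_fun" where
  "E_push D k \<phi> = (let X\<phi> = farr (lsrc k) \<phi>; Z\<phi> = farr (ltrg k) \<phi> in
     E_two_fun (lfun k (Dom D \<phi>)) (lfun k (Cod D \<phi>))
       (\<lambda>P. Tuple [map0 X\<phi> (coord P 0),
                   comp1 (Trg Z\<phi>) (tn_comp (lnat k \<phi>) (coord P 0)) (map1 Z\<phi> (coord P 1)),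
                   map0 Z\<phi> (coord P 2)])
       X\<phi> Z\<phi>)"

definition E_d2cat :: "('d, 'e) cat \<Rightarrow> ('d, 'e, 'a cell) lax_map \<Rightarrow> ('d, 'e, 'a cell) d2cat" where
  "E_d2cat D k = \<lparr>fobj = (\<lambda>m\<in>Obj D. E_two_cat (lfun k m)), farr = (\<lambda>\<phi>\<in>Arr D. E_push D k \<phi>)\<rparr>"

definition E_omega ::
    "('d, 'e) cat \<Rightarrow> ('d, 'e, 'a cell) lax_map \<Rightarrow> ('d, 'e, 'a cell) strict_map" where
  "E_omega D k = \<lparr>nt_src = E_d2cat D k, nt_trg = lsrc k,
     nt_comp = (\<lambda>m\<in>Obj D. let F = lfun k m in
       \<lparr>Src = E_two_cat F, Trg = Src F,
        map0 = (\<lambda>P\<in>E0 F. coord P 0), map1 = (\<lambda>S\<in>E1 F. coord S 1), map2 = (\<lambda>\<sigma>\<in>E2 F. coord \<sigma> 1)\<rparr>)\<rparr>"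

definition E_nu ::
    "('d, 'e) cat \<Rightarrow> ('d, 'e, 'a cell) lax_map \<Rightarrow> ('d, 'e, 'a cell) strict_map" where
  "E_nu D k = \<lparr>nt_src = E_d2cat D k, nt_trg = ltrg k,
     nt_comp = (\<lambda>m\<in>Obj D. let F = lfun k m in
       \<lparr>Src = E_two_cat F, Trg = Trg F,
        map0 = (\<lambda>P\<in>E0 F. coord P 2), map1 = (\<lambda>S\<in>E1 F. coord S 2), map2 = (\<lambda>\<sigma>\<in>E2 F. coord \<sigma> 2)\<rparr>)\<rparr>"

definition E_strict ::
    "('d, 'e) cat \<Rightarrow> ('d, 'e, 'a cell) lax_square \<Rightarrow> ('d, 'e, 'a cell) strict_map" where
  "E_strict D q = \<lparr>nt_src = E_d2cat D (sq_src q), nt_trg = E_d2cat D (sq_trg q),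
     nt_comp = (\<lambda>m\<in>Obj D. let h = nt_comp (sq_h q) m; k = nt_comp (sq_k q) m in
       E_two_fun (lfun (sq_src q) m) (lfun (sq_trg q) m)
         (\<lambda>P. Tuple [map0 h (coord P 0), map1 k (coord P 1), map0 k (coord P 2)])
         h k)\<rparr>"

definition E_span ::
    "('d, 'e) cat \<Rightarrow> ('d, 'e, 'a cell) lax_map \<Rightarrow>
     (('d, 'e, 'a cell) d2cat, ('d, 'e, 'a cell) strict_map) span" where
  "E_span D i = \<lparr>lobj = lsrc i, apex = E_d2cat D i, robj = ltrg i,
     lleg = E_omega D i, rleg = E_nu D i\<rparr>"

definition E_functor :: "('d, 'e) cat \<Rightarrow>
    (('d, 'e, 'a cell) lax_map, ('d, 'e, 'a cell) lax_square,
     (('d, 'e, 'a cell) d2cat, ('d, 'e, 'a cell) strict_map) span,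
     (('d, 'e, 'a cell) d2cat, ('d, 'e, 'a cell) strict_map) span_map) ftr" where
  "E_functor D = \<lparr>
     fobj = (\<lambda>i\<in>Obj (lax_arrow_cat D). E_span D i),
     farr = (\<lambda>q\<in>Arr (lax_arrow_cat D).
       \<lparr>sm_src = E_span D (sq_src q), sm_trg = E_span D (sq_trg q),
        lmap = sq_h q, amap = E_strict D q, rmap = sq_k q\<rparr>)\<rparr>"

end

theory Submission
  imports Defs
begin

text \<open>
  Consider a square of 2-functors with vertical sides \<open>F : X \<rightarrow> Z\<close>, \<open>G : Y \<rightarrow> W\<close>, horizontal sides
  \<open>H : X \<rightarrow> Y\<close>, \<open>K : Z \<rightarrow> W\<close> and a 2-natural filler \<open>\<alpha> : K F \<Rightarrow> G H\<close>. It induces a 2-functor between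
  the 2-categories that the construction assigns to \<open>F\<close> and \<open>G\<close>: an object \<open>f : a \<rightarrow> F x\<close> goes
  to \<open>\<alpha> x \<circ> K f : K a \<rightarrow> G (H x)\<close>, and \<open>H\<close>, \<open>K\<close> act on the components of 1- and 2-cells
  (\<open>lax_cell.two_functor_E_square\<close>). Naturality of \<open>\<alpha>\<close> on 1-cells and on 2-cells is exactly what
  preserves the compatibility equations. Pasting squares side by side corresponds to composing
  the induced 2-functors (\<open>E_square_comp\<close>), identity squares give identities (\<open>E_square_id\<close>), and
  the projections to the two components commute with induced 2-functors (\<open>E_proj_natural\<close>).

  The theorem follows by instantiating these facts. For a lax map \<open>k\<close> and \<open>\<phi> : m \<rightarrow> n\<close>, the
  structure transformation \<open>k\<^sub>\<phi>\<close> fills the square on \<open>k\<^sub>m\<close>, \<open>k\<^sub>n\<close> and \<open>\<phi>\<^sub>*\<close>, and the coherence axioms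
  of a lax map say that these squares paste; hence \<open>Ek\<close> is a functor on \<open>D\<close>, with \<open>\<omega>\<close> and \<open>\<nu>\<close>
  natural. For a morphism \<open>(h, k) : i \<rightarrow> j\<close>, the equation of lax maps \<open>k i = j h\<close> splits into
  \<open>k\<^sub>m i\<^sub>m = j\<^sub>m h\<^sub>m\<close>, which gives squares with identity fillers and hence the components of the strict
  map between \<open>Ei\<close> and \<open>Ej\<close>, and \<open>k\<^sub>n (i\<^sub>\<phi> x) = j\<^sub>\<phi> (h\<^sub>m x)\<close>, which says that the two ways of pasting
  such a square with the squares of \<open>\<phi>\<close> agree and hence that the strict map is natural
  (\<open>comp_lax_eq_iff\<close>, \<open>E_strict_hom\<close>). Preservation of identities and composition is again
  pasting.

  The remaining work is to show that the categories involved are categories and that the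
  construction applied to a 2-functor is a 2-category (\<open>two_category_E\<close>); there all laws hold
  componentwise and only the closure of the compatibility equations under the compositions needs
  an argument.
\<close>

section \<open>Strict 2-categories and 2-functors\<close>

text \<open>
  Typing judgements for 1-cells, for 2-cells between 1-cells, and for 2-cells seen only through
  their boundary objects.
\<close>

abbreviation hom1 :: "'u two_cat \<Rightarrow> 'u \<Rightarrow> 'u \<Rightarrow> 'u \<Rightarrow> bool" where
  "hom1 A \<equiv> in_hom (cat1 A)"

abbreviation hom2 :: "'u two_cat \<Rightarrow> 'u \<Rightarrow> 'u \<Rightarrow> 'u \<Rightarrow> bool" where
  "hom2 A \<equiv> in_hom (catv A)"

abbreviation homh :: "'u two_cat \<Rightarrow> 'u \<Rightarrow> 'u \<Rightarrow> 'u \<Rightarrow> bool" where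
  "homh A \<equiv> in_hom (cath A)"

lemma hom1_iff: "hom1 A f x y \<longleftrightarrow> f \<in> cells1 A \<and> src1 A f = x \<and> trg1 A f = y"
  by (simp add: in_hom_def cat1_def)

lemma hom2_iff: "hom2 A \<sigma> f g \<longleftrightarrow> \<sigma> \<in> cells2 A \<and> src2 A \<sigma> = f \<and> trg2 A \<sigma> = g"
  by (simp add: in_hom_def catv_def)

lemma homh_iff:
  "homh A \<sigma> x y \<longleftrightarrow> \<sigma> \<in> cells2 A \<and> src1 A (src2 A \<sigma>) = x \<and> trg1 A (trg2 A \<sigma>) = y"
  by (simp add: in_hom_def cath_def)

context category
begin

lemma hom_objs: "in_hom C f x y \<Longrightarrow> x \<in> Obj C" "in_hom C f x y \<Longrightarrow> y \<in> Obj C"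
  using Dom_Obj Cod_Obj by (auto simp: in_hom_def)

end

context two_category
begin

lemma hom1_cells0: "hom1 A f x y \<Longrightarrow> x \<in> cells0 A" "hom1 A f x y \<Longrightarrow> y \<in> cells0 A"
  using cat1.hom_objs[of f x y] by (simp_all add: cat1_def)

lemma hom2_cells1: "hom2 A \<sigma> f g \<Longrightarrow> f \<in> cells1 A" "hom2 A \<sigma> f g \<Longrightarrow> g \<in> cells1 A"
  using catv.hom_objs[of \<sigma> f g] by (simp_all add: catv_def)

lemma id1_hom: "x \<in> cells0 A \<Longrightarrow> hom1 A (id1 A x) x x"
  using cat1.Id_hom[of x] by (simp add: cat1_def)

lemma id2_hom: "f \<in> cells1 A \<Longrightarrow> hom2 A (id2 A f) f f"
  using catv.Id_hom[of f] by (simp add: catv_def)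

lemma comp1_hom: "hom1 A f x y \<Longrightarrow> hom1 A g y z \<Longrightarrow> hom1 A (comp1 A g f) x z"
  using cat1.Comp_hom[of f x y g z] by (simp add: cat1_def)

lemma vcomp_hom: "hom2 A \<sigma> f g \<Longrightarrow> hom2 A \<tau> g h \<Longrightarrow> hom2 A (vcomp A \<tau> \<sigma>) f h"
  using catv.Comp_hom[of \<sigma> f g \<tau> h] by (simp add: catv_def)

lemma comp1_id_left: "hom1 A f x y \<Longrightarrow> comp1 A (id1 A y) f = f"
  using cat1.Id_left[of f x y] by (simp add: cat1_def)

lemma comp1_id_right: "hom1 A f x y \<Longrightarrow> comp1 A f (id1 A x) = f"
  using cat1.Id_right[of f x y] by (simp add: cat1_def)

lemma vcomp_id_left: "hom2 A \<sigma> f g \<Longrightarrow> vcomp A (id2 A g) \<sigma> = \<sigma>"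
  using catv.Id_left[of \<sigma> f g] by (simp add: catv_def)

lemma vcomp_id_right: "hom2 A \<sigma> f g \<Longrightarrow> vcomp A \<sigma> (id2 A f) = \<sigma>"
  using catv.Id_right[of \<sigma> f g] by (simp add: catv_def)

lemma hcomp_id_left: "homh A \<sigma> x y \<Longrightarrow> hcomp A (id2 A (id1 A y)) \<sigma> = \<sigma>"
  using cath.Id_left[of \<sigma> x y] by (simp add: cath_def)

lemma hcomp_id_right: "homh A \<sigma> x y \<Longrightarrow> hcomp A \<sigma> (id2 A (id1 A x)) = \<sigma>"
  using cath.Id_right[of \<sigma> x y] by (simp add: cath_def)

lemma comp1_assoc:
  "hom1 A f w x \<Longrightarrow> hom1 A g x y \<Longrightarrow> hom1 A h y z \<Longrightarrow>
    comp1 A h (comp1 A g f) = comp1 A (comp1 A h g) f"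
  using cat1.Comp_assoc[of f w x g y h z] by (simp add: cat1_def)

lemma vcomp_assoc:
  "hom2 A \<rho> f g \<Longrightarrow> hom2 A \<sigma> g h \<Longrightarrow> hom2 A \<tau> h k \<Longrightarrow>
    vcomp A \<tau> (vcomp A \<sigma> \<rho>) = vcomp A (vcomp A \<tau> \<sigma>) \<rho>"
  using catv.Comp_assoc[of \<rho> f g \<sigma> h \<tau> k] by (simp add: catv_def)

lemma hcomp_assoc:
  "homh A \<rho> w x \<Longrightarrow> homh A \<sigma> x y \<Longrightarrow> homh A \<tau> y z \<Longrightarrow>
    hcomp A \<tau> (hcomp A \<sigma> \<rho>) = hcomp A (hcomp A \<tau> \<sigma>) \<rho>"
  using cath.Comp_assoc[of \<rho> w x \<sigma> y \<tau> z] by (simp add: cath_def)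

lemma hom2_parallel: "hom2 A \<sigma> f g \<Longrightarrow> hom1 A f x y \<Longrightarrow> hom1 A g x y"
  using globular[of \<sigma>] hom2_cells1[of \<sigma> f g] by (auto simp: hom1_iff hom2_iff)

lemma hom2_homh: "hom2 A \<sigma> f g \<Longrightarrow> hom1 A f x y \<Longrightarrow> homh A \<sigma> x y"
  using globular[of \<sigma>] by (auto simp: hom1_iff hom2_iff homh_iff)

lemma hom2_boundary:
  assumes "hom2 A \<sigma> f g"
  obtains x y where "hom1 A f x y" "hom1 A g x y"
proof
  show f: "hom1 A f (src1 A f) (trg1 A f)"
    using hom2_cells1(1)[OF assms] by (simp add: hom1_iff)
  show "hom1 A g (src1 A f) (trg1 A f)"
    by (rule hom2_parallel[OF assms f])
qed

lemma homh_boundary: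
  assumes "homh A \<sigma> x y"
  obtains f g where "hom2 A \<sigma> f g" "hom1 A f x y" "hom1 A g x y"
proof -
  have s: "hom2 A \<sigma> (src2 A \<sigma>) (trg2 A \<sigma>)"
    using assms by (simp add: hom2_iff homh_iff)
  moreover have "hom1 A (src2 A \<sigma>) x y"
    using assms globular[of \<sigma>] hom2_cells1[OF s] by (simp add: hom1_iff homh_iff)
  ultimately show thesis
    using that[of "src2 A \<sigma>" "trg2 A \<sigma>"] hom2_parallel[of \<sigma> "src2 A \<sigma>" "trg2 A \<sigma>" x y] by simp
qed

lemma id2_homh: "hom1 A f x y \<Longrightarrow> homh A (id2 A f) x y"
  using hom2_homh[OF id2_hom[of f]] by (simp add: hom1_iff)

lemma hcomp_hom:
  assumes "hom2 A \<sigma> f f'" "hom1 A f x y" "hom2 A \<tau> g g'" "hom1 A g y z"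
  shows "hom2 A (hcomp A \<tau> \<sigma>) (comp1 A g f) (comp1 A g' f')"
proof -
  have h: "homh A \<sigma> x y" "homh A \<tau> y z"
    using hom2_homh[OF assms(1,2)] hom2_homh[OF assms(3,4)] by auto
  then have "hcomp A \<tau> \<sigma> \<in> cells2 A"
    using cath.Comp_hom[OF h] by (simp add: cath_def in_hom_def)
  then show ?thesis
    using hcomp_boundary[OF h] assms(1,3) by (simp add: hom2_iff)
qed

lemma hcomp_homh: "homh A \<sigma> x y \<Longrightarrow> homh A \<tau> y z \<Longrightarrow> homh A (hcomp A \<tau> \<sigma>) x z"
  using cath.Comp_hom[of \<sigma> x y \<tau> z] by (simp add: cath_def)

lemma interchange':
  assumes "hom2 A \<sigma> f f'" "hom2 A \<sigma>' f' f''" "hom2 A \<tau> g g'" "hom2 A \<tau>' g' g''"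
    and "hom1 A f x y" "hom1 A g y z"
  shows "hcomp A (vcomp A \<tau>' \<tau>) (vcomp A \<sigma>' \<sigma>) = vcomp A (hcomp A \<tau>' \<sigma>') (hcomp A \<tau> \<sigma>)"
  by (rule interchange[OF hom2_homh[OF assms(1,5)] hom2_homh[OF assms(3,6)] assms(1-4)])

lemma lwhisker_vcomp:
  assumes "hom2 A \<sigma> f f'" "hom2 A \<sigma>' f' f''" "hom1 A f x y" "hom1 A g y z"
  shows "lwhisker A g (vcomp A \<sigma>' \<sigma>) = vcomp A (lwhisker A g \<sigma>') (lwhisker A g \<sigma>)"
proof -
  have i: "hom2 A (id2 A g) g g"
    using assms(4) id2_hom by (simp add: hom1_iff)
  show ?thesis
    using interchange'[OF assms(1,2) i i assms(3,4)] vcomp_id_left[OF i]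
    by (simp add: lwhisker_def)
qed

lemma rwhisker_vcomp:
  assumes "hom2 A \<tau> g g'" "hom2 A \<tau>' g' g''" "hom1 A f x y" "hom1 A g y z"
  shows "rwhisker A (vcomp A \<tau>' \<tau>) f = vcomp A (rwhisker A \<tau>' f) (rwhisker A \<tau> f)"
proof -
  have i: "hom2 A (id2 A f) f f"
    using assms(3) id2_hom by (simp add: hom1_iff)
  show ?thesis
    using interchange'[OF i i assms(1,2) assms(3,4)] vcomp_id_left[OF i]
    by (simp add: rwhisker_def)
qed

lemma lwhisker_id2: "hom1 A f x y \<Longrightarrow> hom1 A g y z \<Longrightarrow> lwhisker A g (id2 A f) = id2 A (comp1 A g f)"
  by (simp add: lwhisker_def hcomp_id2)

lemma rwhisker_id2: "hom1 A f x y \<Longrightarrow> hom1 A g y z \<Longrightarrow> rwhisker A (id2 A g) f = id2 A (comp1 A g f)"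
  by (simp add: rwhisker_def hcomp_id2)

lemma lwhisker_hcomp:
  "homh A \<sigma> w x \<Longrightarrow> homh A \<tau> x y \<Longrightarrow> hom1 A g y z \<Longrightarrow>
    lwhisker A g (hcomp A \<tau> \<sigma>) = hcomp A (lwhisker A g \<tau>) \<sigma>"
  unfolding lwhisker_def by (rule hcomp_assoc[OF _ _ id2_homh])

lemma rwhisker_hcomp:
  "hom1 A f w x \<Longrightarrow> homh A \<sigma> x y \<Longrightarrow> homh A \<tau> y z \<Longrightarrow>
    rwhisker A (hcomp A \<tau> \<sigma>) f = hcomp A \<tau> (rwhisker A \<sigma> f)"
  unfolding rwhisker_def by (rule hcomp_assoc[symmetric, OF id2_homh])

lemma hcomp_rwhisker:
  "homh A \<sigma> w x \<Longrightarrow> hom1 A f x y \<Longrightarrow> homh A \<tau> y z \<Longrightarrow>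
    hcomp A (rwhisker A \<tau> f) \<sigma> = hcomp A \<tau> (lwhisker A f \<sigma>)"
  unfolding lwhisker_def rwhisker_def by (rule hcomp_assoc[symmetric, OF _ id2_homh])

lemma lwhisker_comp1:
  assumes "homh A \<sigma> w x" "hom1 A f x y" "hom1 A g y z"
  shows "lwhisker A (comp1 A g f) \<sigma> = lwhisker A g (lwhisker A f \<sigma>)"
  unfolding lwhisker_def hcomp_id2[OF assms(2,3), symmetric]
  by (rule hcomp_assoc[symmetric, OF assms(1) id2_homh[OF assms(2)] id2_homh[OF assms(3)]])

lemma rwhisker_comp1:
  assumes "hom1 A f w x" "hom1 A g x y" "homh A \<sigma> y z"
  shows "rwhisker A \<sigma> (comp1 A g f) = rwhisker A (rwhisker A \<sigma> g) f"
  unfolding rwhisker_def hcomp_id2[OF assms(1,2), symmetric]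
  by (rule hcomp_assoc[OF id2_homh[OF assms(1)] id2_homh[OF assms(2)] assms(3)])

lemma rwhisker_lwhisker:
  assumes "hom1 A f w x" "homh A \<sigma> x y" "hom1 A g y z"
  shows "rwhisker A (lwhisker A g \<sigma>) f = lwhisker A g (rwhisker A \<sigma> f)"
  unfolding rwhisker_def lwhisker_def
  by (rule hcomp_assoc[symmetric, OF id2_homh[OF assms(1)] assms(2) id2_homh[OF assms(3)]])

end

text \<open>
  The category of objects and 2-cells under horizontal composition is determined by the other
  two categories as far as identities and boundaries are concerned. The introduction rule asks only
  for the laws of horizontal composition itself, on 2-cells with known boundary 1-cells.
\<close>

lemma two_categoryI:
  assumes c1: "category (cat1 A)" and cv: "category (catv A)"
    and glob: "\<And>\<sigma> f g. hom2 A \<sigma> f g \<Longrightarrow> src1 A f = src1 A g \<and> trg1 A f = trg1 A g"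
    and hc: "\<And>\<sigma> \<tau> f f' g g' x y z. hom2 A \<sigma> f f' \<Longrightarrow> hom1 A f x y \<Longrightarrow> hom1 A f' x y \<Longrightarrow>
      hom2 A \<tau> g g' \<Longrightarrow> hom1 A g y z \<Longrightarrow> hom1 A g' y z \<Longrightarrow>
      hom2 A (hcomp A \<tau> \<sigma>) (comp1 A g f) (comp1 A g' f')"
    and idl: "\<And>\<sigma> f f' x y. hom2 A \<sigma> f f' \<Longrightarrow> hom1 A f x y \<Longrightarrow> hom1 A f' x y \<Longrightarrow>
      hcomp A (id2 A (id1 A y)) \<sigma> = \<sigma>"
    and idr: "\<And>\<sigma> f f' x y. hom2 A \<sigma> f f' \<Longrightarrow> hom1 A f x y \<Longrightarrow> hom1 A f' x y \<Longrightarrow>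
      hcomp A \<sigma> (id2 A (id1 A x)) = \<sigma>"
    and assoc: "\<And>\<rho> \<sigma> \<tau> f f' g g' h h' w x y z.
      hom2 A \<rho> f f' \<Longrightarrow> hom1 A f w x \<Longrightarrow> hom1 A f' w x \<Longrightarrow>
      hom2 A \<sigma> g g' \<Longrightarrow> hom1 A g x y \<Longrightarrow> hom1 A g' x y \<Longrightarrow>
      hom2 A \<tau> h h' \<Longrightarrow> hom1 A h y z \<Longrightarrow> hom1 A h' y z \<Longrightarrow>
      hcomp A \<tau> (hcomp A \<sigma> \<rho>) = hcomp A (hcomp A \<tau> \<sigma>) \<rho>"
    and hid2: "\<And>f g x y z. hom1 A f x y \<Longrightarrow> hom1 A g y z \<Longrightarrow>
      hcomp A (id2 A g) (id2 A f) = id2 A (comp1 A g f)"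
    and inter: "\<And>\<sigma> \<sigma>' \<tau> \<tau>' f f' f'' g g' g'' x y z.
      hom2 A \<sigma> f f' \<Longrightarrow> hom2 A \<sigma>' f' f'' \<Longrightarrow> hom1 A f x y \<Longrightarrow> hom1 A f' x y \<Longrightarrow> hom1 A f'' x y \<Longrightarrow>
      hom2 A \<tau> g g' \<Longrightarrow> hom2 A \<tau>' g' g'' \<Longrightarrow> hom1 A g y z \<Longrightarrow> hom1 A g' y z \<Longrightarrow> hom1 A g'' y z \<Longrightarrow>
      hcomp A (vcomp A \<tau>' \<tau>) (vcomp A \<sigma>' \<sigma>) = vcomp A (hcomp A \<tau>' \<sigma>') (hcomp A \<tau> \<sigma>)"
    and ext: "src1 A \<in> extensional (cells1 A)" "trg1 A \<in> extensional (cells1 A)"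
      "src2 A \<in> extensional (cells2 A)" "trg2 A \<in> extensional (cells2 A)"
      "id1 A \<in> extensional (cells0 A)" "id2 A \<in> extensional (cells1 A)"
    and extc:
      "\<And>f g. \<not> (f \<in> cells1 A \<and> g \<in> cells1 A \<and> trg1 A f = src1 A g) \<Longrightarrow> comp1 A g f = undefined"
      "\<And>\<sigma> \<tau>. \<not> (\<sigma> \<in> cells2 A \<and> \<tau> \<in> cells2 A \<and> trg2 A \<sigma> = src2 A \<tau>) \<Longrightarrow> vcomp A \<tau> \<sigma> = undefined"
      "\<And>\<sigma> \<tau>. \<not> (\<sigma> \<in> cells2 A \<and> \<tau> \<in> cells2 A \<and> trg1 A (trg2 A \<sigma>) = src1 A (src2 A \<tau>)) \<Longrightarrow>
        hcomp A \<tau> \<sigma> = undefined"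
  shows "two_category A"
proof -
  interpret c1: category "cat1 A" by (rule c1)
  interpret cv: category "catv A" by (rule cv)
  have glob': "src1 A (src2 A \<sigma>) = src1 A (trg2 A \<sigma>)" "trg1 A (src2 A \<sigma>) = trg1 A (trg2 A \<sigma>)"
    if "\<sigma> \<in> cells2 A" for \<sigma>
    using glob[of \<sigma> "src2 A \<sigma>" "trg2 A \<sigma>"] that by (auto simp: hom2_iff)
  have cells: "src2 A \<sigma> \<in> cells1 A" "trg2 A \<sigma> \<in> cells1 A" if "\<sigma> \<in> cells2 A" for \<sigma>
    using cv.Dom_Obj[of \<sigma>] cv.Cod_Obj[of \<sigma>] that by (auto simp: catv_def)
  have bnd: "hom2 A \<sigma> (src2 A \<sigma>) (trg2 A \<sigma>) \<and> hom1 A (src2 A \<sigma>) x y \<and> hom1 A (trg2 A \<sigma>) x y"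
    if "homh A \<sigma> x y" for \<sigma> x y
    using that glob' cells by (auto simp: hom1_iff hom2_iff homh_iff)
  have ends: "src1 A f \<in> cells0 A" "trg1 A f \<in> cells0 A" if "f \<in> cells1 A" for f
    using c1.Dom_Obj[of f] c1.Cod_Obj[of f] that by (auto simp: cat1_def)
  have hom1: "hom1 A (comp1 A g f) x z" if "hom1 A f x y" "hom1 A g y z" for f g x y z
    using c1.Comp_hom[OF that] by (simp add: cat1_def)
  have hch: "homh A (hcomp A \<tau> \<sigma>) x z" if "homh A \<sigma> x y" "homh A \<tau> y z" for \<sigma> \<tau> x y z
    using hc[of \<sigma> "src2 A \<sigma>" "trg2 A \<sigma>" x y \<tau> "src2 A \<tau>" "trg2 A \<tau>" z] bnd[OF that(1)] bnd[OF that(2)]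
      hom1[of "src2 A \<sigma>" x y "src2 A \<tau>" z] hom1[of "trg2 A \<sigma>" x y "trg2 A \<tau>" z]
    by (auto simp: hom1_iff hom2_iff homh_iff)
  have idh: "homh A (id2 A (id1 A x)) x x" if "x \<in> cells0 A" for x
    using c1.Id_hom[of x] cv.Id_hom[of "id1 A x"] that
    by (auto simp: in_hom_def cat1_def catv_def cath_def)
  show ?thesis
  proof (intro two_category.intro two_category_axioms.intro c1 cv)
    show "category (cath A)"
    proof (unfold_locales, goal_cases)
      case (1 f) then show ?case using cells ends by (simp add: cath_def)
    next
      case (2 f) then show ?case using cells ends by (simp add: cath_def)
    next
      case (3 x) then show ?case using idh[of x] by (simp add: cath_def)
    next
      case (4 f x y g z) then show ?case using hch[OF 4] by (simp add: cath_def)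
    next
      case (5 f x y)
      have "hcomp A (id2 A (id1 A y)) f = f"
        using bnd[OF 5] idl by blast
      then show ?case by (simp add: cath_def)
    next
      case (6 f x y)
      have "hcomp A f (id2 A (id1 A x)) = f"
        using bnd[OF 6] idr by blast
      then show ?case by (simp add: cath_def)
    next
      case (7 f w x g y h z)
      show ?case
        using assoc[of f "src2 A f" "trg2 A f" w x g "src2 A g" "trg2 A g" y
            h "src2 A h" "trg2 A h" z] bnd[OF 7(1)] bnd[OF 7(2)] bnd[OF 7(3)]
        by (simp add: cath_def)
    qed
    show "src2 A (hcomp A \<tau> \<sigma>) = comp1 A (src2 A \<tau>) (src2 A \<sigma>)"
         "trg2 A (hcomp A \<tau> \<sigma>) = comp1 A (trg2 A \<tau>) (trg2 A \<sigma>)"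
      if "homh A \<sigma> x y" "homh A \<tau> y z" for \<sigma> \<tau> x y z
      using hc[of \<sigma> "src2 A \<sigma>" "trg2 A \<sigma>" x y \<tau> "src2 A \<tau>" "trg2 A \<tau>" z]
        bnd[OF that(1)] bnd[OF that(2)] by (simp_all add: hom2_iff)
    show "hcomp A (vcomp A \<tau>' \<tau>) (vcomp A \<sigma>' \<sigma>) = vcomp A (hcomp A \<tau>' \<sigma>') (hcomp A \<tau> \<sigma>)"
      if h: "homh A \<sigma> x y" "homh A \<tau> y z" and v: "hom2 A \<sigma> f f'" "hom2 A \<sigma>' f' f''"
        "hom2 A \<tau> g g'" "hom2 A \<tau>' g' g''" for \<sigma> \<sigma>' \<tau> \<tau>' f f' f'' g g' g'' x y z
    proof -
      have "hom1 A f x y \<and> hom1 A f' x y \<and> hom1 A g y z \<and> hom1 A g' y z"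
        using bnd[OF h(1)] bnd[OF h(2)] v by (simp add: hom2_iff)
      moreover have "hom1 A f'' x y" "hom1 A g'' y z"
        using calculation v glob'[of \<sigma>'] glob'[of \<tau>'] cells[of \<sigma>'] cells[of \<tau>']
        by (auto simp: hom1_iff hom2_iff)
      ultimately show ?thesis
        using inter v by blast
    qed
  qed (use glob' hid2 ext extc in auto)
qed

context two_functor
begin

lemma map0_cells: "x \<in> cells0 (Src F) \<Longrightarrow> map0 F x \<in> cells0 (Trg F)"
  using fun1.fobj_in by (auto simp: cat1_def)

lemma map1_hom: "hom1 (Src F) f x y \<Longrightarrow> hom1 (Trg F) (map1 F f) (map0 F x) (map0 F y)"
  using fun1.farr_hom[of f x y] by simp

lemma map2_hom: "hom2 (Src F) \<sigma> f g \<Longrightarrow> hom2 (Trg F) (map2 F \<sigma>) (map1 F f) (map1 F g)"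
  using funv.farr_hom[of \<sigma> f g] by simp

lemma map2_homh: "homh (Src F) \<sigma> x y \<Longrightarrow> homh (Trg F) (map2 F \<sigma>) (map0 F x) (map0 F y)"
  using funh.farr_hom[of \<sigma> x y] by simp

lemma map1_cells: "f \<in> cells1 (Src F) \<Longrightarrow> map1 F f \<in> cells1 (Trg F)"
  using fun1.farr_in by (auto simp: cat1_def)

lemma map2_cells: "\<sigma> \<in> cells2 (Src F) \<Longrightarrow> map2 F \<sigma> \<in> cells2 (Trg F)"
  using funv.farr_in by (auto simp: catv_def)

lemma map_ext: "map0 F \<in> extensional (cells0 (Src F))" "map1 F \<in> extensional (cells1 (Src F))"
  "map2 F \<in> extensional (cells2 (Src F))"
  using fun1.fobj_in fun1.farr_in funv.farr_in by (auto simp: cat1_def catv_def PiE_def)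

lemma map1_id1: "x \<in> cells0 (Src F) \<Longrightarrow> map1 F (id1 (Src F) x) = id1 (Trg F) (map0 F x)"
  using fun1.farr_Id[of x] by (simp add: cat1_def)

lemma map2_id2: "f \<in> cells1 (Src F) \<Longrightarrow> map2 F (id2 (Src F) f) = id2 (Trg F) (map1 F f)"
  using funv.farr_Id[of f] by (simp add: catv_def)

lemma map1_comp1: "hom1 (Src F) f x y \<Longrightarrow> hom1 (Src F) g y z \<Longrightarrow>
    map1 F (comp1 (Src F) g f) = comp1 (Trg F) (map1 F g) (map1 F f)"
  using fun1.farr_Comp[of f x y g z] by (simp add: cat1_def)

lemma map2_vcomp: "hom2 (Src F) \<sigma> f g \<Longrightarrow> hom2 (Src F) \<tau> g h \<Longrightarrow>
    map2 F (vcomp (Src F) \<tau> \<sigma>) = vcomp (Trg F) (map2 F \<tau>) (map2 F \<sigma>)"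
  using funv.farr_Comp[of \<sigma> f g \<tau> h] by (simp add: catv_def)

lemma map2_hcomp: "homh (Src F) \<sigma> x y \<Longrightarrow> homh (Src F) \<tau> y z \<Longrightarrow>
    map2 F (hcomp (Src F) \<tau> \<sigma>) = hcomp (Trg F) (map2 F \<tau>) (map2 F \<sigma>)"
  using funh.farr_Comp[of \<sigma> x y \<tau> z] by (simp add: cath_def)

lemma map2_lwhisker: "homh (Src F) \<sigma> x y \<Longrightarrow> hom1 (Src F) g y z \<Longrightarrow>
    map2 F (lwhisker (Src F) g \<sigma>) = lwhisker (Trg F) (map1 F g) (map2 F \<sigma>)"
  using map2_hcomp[of \<sigma> x y "id2 (Src F) g" z] src.id2_homh[of g y z] map2_id2[of g]
  by (simp add: lwhisker_def hom1_iff)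

lemma map2_rwhisker: "hom1 (Src F) f x y \<Longrightarrow> homh (Src F) \<sigma> y z \<Longrightarrow>
    map2 F (rwhisker (Src F) \<sigma> f) = rwhisker (Trg F) (map2 F \<sigma>) (map1 F f)"
  using map2_hcomp[of "id2 (Src F) f" x y \<sigma> z] src.id2_homh[of f x y] map2_id2[of f]
  by (simp add: rwhisker_def hom1_iff)

end

text \<open>Likewise, a 2-functor is given by conditions on 1-cells and on 2-cells with known boundary.\<close>

lemma two_functorI:
  assumes A: "two_category (Src F)" and B: "two_category (Trg F)"
    and ext: "map0 F \<in> extensional (cells0 (Src F))" "map1 F \<in> extensional (cells1 (Src F))"
      "map2 F \<in> extensional (cells2 (Src F))"
    and m0: "\<And>x. x \<in> cells0 (Src F) \<Longrightarrow> map0 F x \<in> cells0 (Trg F)"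
    and m1: "\<And>f x y. hom1 (Src F) f x y \<Longrightarrow> hom1 (Trg F) (map1 F f) (map0 F x) (map0 F y)"
    and m2: "\<And>\<sigma> f g x y. hom2 (Src F) \<sigma> f g \<Longrightarrow> hom1 (Src F) f x y \<Longrightarrow> hom1 (Src F) g x y \<Longrightarrow>
      hom2 (Trg F) (map2 F \<sigma>) (map1 F f) (map1 F g)"
    and i1: "\<And>x. x \<in> cells0 (Src F) \<Longrightarrow> map1 F (id1 (Src F) x) = id1 (Trg F) (map0 F x)"
    and i2: "\<And>f. f \<in> cells1 (Src F) \<Longrightarrow> map2 F (id2 (Src F) f) = id2 (Trg F) (map1 F f)"
    and c1: "\<And>f g x y z. hom1 (Src F) f x y \<Longrightarrow> hom1 (Src F) g y z \<Longrightarrow>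
      map1 F (comp1 (Src F) g f) = comp1 (Trg F) (map1 F g) (map1 F f)"
    and cv: "\<And>\<sigma> \<tau> f g h. hom2 (Src F) \<sigma> f g \<Longrightarrow> hom2 (Src F) \<tau> g h \<Longrightarrow>
      map2 F (vcomp (Src F) \<tau> \<sigma>) = vcomp (Trg F) (map2 F \<tau>) (map2 F \<sigma>)"
    and ch: "\<And>\<sigma> \<tau> f f' g g' x y z. hom2 (Src F) \<sigma> f f' \<Longrightarrow> hom1 (Src F) f x y \<Longrightarrow>
      hom1 (Src F) f' x y \<Longrightarrow> hom2 (Src F) \<tau> g g' \<Longrightarrow> hom1 (Src F) g y z \<Longrightarrow> hom1 (Src F) g' y z \<Longrightarrow>
      map2 F (hcomp (Src F) \<tau> \<sigma>) = hcomp (Trg F) (map2 F \<tau>) (map2 F \<sigma>)"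
  shows "two_functor F"
proof -
  interpret A: two_category "Src F" by (rule A)
  interpret B: two_category "Trg F" by (rule B)
  have m1c: "map1 F f \<in> cells1 (Trg F)" if "f \<in> cells1 (Src F)" for f
    using m1[of f] that by (auto simp: hom1_iff)
  have m2': "hom2 (Trg F) (map2 F \<sigma>) (map1 F f) (map1 F g)" if "hom2 (Src F) \<sigma> f g" for \<sigma> f g
    using m2[OF that] A.hom2_boundary[OF that] by metis
  have m2c: "map2 F \<sigma> \<in> cells2 (Trg F)" if "\<sigma> \<in> cells2 (Src F)" for \<sigma>
    using m2'[of \<sigma>] that by (auto simp: hom2_iff)
  have m2h: "homh (Trg F) (map2 F \<sigma>) (map0 F x) (map0 F y)" if "homh (Src F) \<sigma> x y" for \<sigma> x y
    using A.homh_boundary[OF that] m2' m1 B.hom2_homh by metis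
  have ch': "map2 F (hcomp (Src F) \<tau> \<sigma>) = hcomp (Trg F) (map2 F \<tau>) (map2 F \<sigma>)"
    if "homh (Src F) \<sigma> x y" "homh (Src F) \<tau> y z" for \<sigma> \<tau> x y z
    using A.homh_boundary[OF that(1)] A.homh_boundary[OF that(2)] ch by metis
  have i12: "map2 F (id2 (Src F) (id1 (Src F) x)) = id2 (Trg F) (id1 (Trg F) (map0 F x))"
    if "x \<in> cells0 (Src F)" for x
    using that i1 i2 A.id1_hom by (simp add: hom1_iff)
  have "cat_functor (cat1 (Src F)) (cat1 (Trg F)) \<lparr>fobj = map0 F, farr = map1 F\<rparr>"
  proof (intro cat_functor.intro cat_functor_axioms.intro, goal_cases)
    case 3 then show ?case using ext m0 by (simp add: cat1_def PiE_def)
  next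
    case 4 then show ?case using ext m1c by (simp add: cat1_def PiE_def)
  next
    case (5 f x y) then show ?case using m1[of f x y] by simp
  next
    case (6 x) then show ?case using i1[of x] by (simp add: cat1_def)
  next
    case (7 f x y g z) then show ?case using c1[of f x y g z] by (simp add: cat1_def)
  qed unfold_locales
  moreover have "cat_functor (catv (Src F)) (catv (Trg F)) \<lparr>fobj = map1 F, farr = map2 F\<rparr>"
  proof (intro cat_functor.intro cat_functor_axioms.intro, goal_cases)
    case 3 then show ?case using ext m1c by (simp add: catv_def PiE_def)
  next
    case 4 then show ?case using ext m2c by (simp add: catv_def PiE_def)
  next
    case (5 f x y) then show ?case using m2'[of f x y] by simp
  next
    case (6 x) then show ?case using i2[of x] by (simp add: catv_def)
  next
    case (7 f x y g z) then show ?case using cv[of f x y g z] by (simp add: catv_def)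
  qed unfold_locales
  moreover have "cat_functor (cath (Src F)) (cath (Trg F)) \<lparr>fobj = map0 F, farr = map2 F\<rparr>"
  proof (intro cat_functor.intro cat_functor_axioms.intro, goal_cases)
    case 3 then show ?case using ext m0 by (simp add: cath_def PiE_def)
  next
    case 4 then show ?case using ext m2c by (simp add: cath_def PiE_def)
  next
    case (5 f x y) then show ?case using m2h[of f x y] by simp
  next
    case (6 x) then show ?case using i12[of x] by (simp add: cath_def)
  next
    case (7 f x y g z) then show ?case using ch'[of f x y g z] by (simp add: cath_def)
  qed unfold_locales
  ultimately show ?thesis
    by (intro two_functor.intro A B)
qed

text \<open>Extensionality makes equality of 2-functors a pointwise condition.\<close>

lemma two_fun_eqI:
  fixes F G :: "'u two_fun"
  assumes "Src F = A" "Src G = A" "Trg F = Trg G"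
    and "map0 F \<in> extensional (cells0 A)" "map0 G \<in> extensional (cells0 A)"
    and "map1 F \<in> extensional (cells1 A)" "map1 G \<in> extensional (cells1 A)"
    and "map2 F \<in> extensional (cells2 A)" "map2 G \<in> extensional (cells2 A)"
    and "\<And>x. x \<in> cells0 A \<Longrightarrow> map0 F x = map0 G x"
    and "\<And>f. f \<in> cells1 A \<Longrightarrow> map1 F f = map1 G f"
    and "\<And>\<sigma>. \<sigma> \<in> cells2 A \<Longrightarrow> map2 F \<sigma> = map2 G \<sigma>"
  shows "F = G"
proof (rule two_fun.equality)
  show "map0 F = map0 G" "map1 F = map1 G" "map2 F = map2 G"
    by (rule extensionalityI; fact)+
qed (use assms in auto)

section \<open>The category of 2-categories\<close>

lemma in_hom_TwoCat: "in_hom TwoCat F A B \<longleftrightarrow> two_functor F \<and> Src F = A \<and> Trg F = B"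
  by (simp add: in_hom_def TwoCat_def)

lemma Comp_TwoCat [simp]: "Comp TwoCat = comp_two_fun"
  by (simp add: TwoCat_def)

lemma Id_TwoCat [simp]: "Id TwoCat = id_two_fun"
  by (simp add: TwoCat_def)

lemma comp_two_fun_sel [simp]:
  "Src (comp_two_fun G F) = Src F" "Trg (comp_two_fun G F) = Trg G"
  "x \<in> cells0 (Src F) \<Longrightarrow> map0 (comp_two_fun G F) x = map0 G (map0 F x)"
  "f \<in> cells1 (Src F) \<Longrightarrow> map1 (comp_two_fun G F) f = map1 G (map1 F f)"
  "\<sigma> \<in> cells2 (Src F) \<Longrightarrow> map2 (comp_two_fun G F) \<sigma> = map2 G (map2 F \<sigma>)"
  by (simp_all add: comp_two_fun_def compose_def)

lemma comp_two_fun_ext: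
  "map0 (comp_two_fun G F) \<in> extensional (cells0 (Src F))"
  "map1 (comp_two_fun G F) \<in> extensional (cells1 (Src F))"
  "map2 (comp_two_fun G F) \<in> extensional (cells2 (Src F))"
  by (simp_all add: comp_two_fun_def)

lemma id_two_fun_sel [simp]:
  "Src (id_two_fun A) = A" "Trg (id_two_fun A) = A"
  "x \<in> cells0 A \<Longrightarrow> map0 (id_two_fun A) x = x"
  "f \<in> cells1 A \<Longrightarrow> map1 (id_two_fun A) f = f"
  "\<sigma> \<in> cells2 A \<Longrightarrow> map2 (id_two_fun A) \<sigma> = \<sigma>"
  by (simp_all add: id_two_fun_def)

lemma id_two_fun_ext:
  "map0 (id_two_fun A) \<in> extensional (cells0 A)"
  "map1 (id_two_fun A) \<in> extensional (cells1 A)"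
  "map2 (id_two_fun A) \<in> extensional (cells2 A)"
  by (simp_all add: id_two_fun_def)

lemma two_functor_id:
  assumes "two_category A"
  shows "two_functor (id_two_fun A)"
proof -
  interpret two_category A by fact
  have c1: "f \<in> cells1 A" if "hom1 A f x y" for f x y
    using that by (simp add: hom1_iff)
  have c2: "\<sigma> \<in> cells2 A" if "hom2 A \<sigma> f g" for \<sigma> f g
    using that by (simp add: hom2_iff)
  show ?thesis
  proof (rule two_functorI, goal_cases)
    case (7 f x y)
    then show ?case using hom1_cells0[of f x y] by (simp add: c1)
  next
    case (8 \<sigma> f g x y)
    then show ?case using hom2_cells1[of \<sigma> f g] by (simp add: c2)
  next
    case (9 x)
    then show ?case using c1[OF id1_hom[of x]] by simp
  next
    case (10 f)
    then show ?case using c2[OF id2_hom[of f]] by simp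
  next
    case (11 f g x y z)
    then have h: "hom1 A f x y" "hom1 A g y z" by auto
    show ?case
      using c1[OF h(1)] c1[OF h(2)] c1[OF comp1_hom[OF h]] by simp
  next
    case (12 \<sigma> \<tau> f g h)
    then have h: "hom2 A \<sigma> f g" "hom2 A \<tau> g h" by auto
    show ?case
      using c2[OF h(1)] c2[OF h(2)] c2[OF vcomp_hom[OF h]] by simp
  next
    case (13 \<sigma> \<tau> f f' g g' x y z)
    then have h: "hom2 A \<sigma> f f'" "hom1 A f x y" "hom2 A \<tau> g g'" "hom1 A g y z" by auto
    show ?case
      using c2[OF h(1)] c2[OF h(3)] c2[OF hcomp_hom[OF h]] by simp
  qed (simp_all add: assms id_two_fun_ext)
qed

lemma two_functor_comp:
  assumes "two_functor F" "two_functor G" "Trg F = Src G"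
  shows "two_functor (comp_two_fun G F)"
proof -
  interpret F: two_functor F by fact
  interpret G: two_functor G by fact
  have c1: "f \<in> cells1 (Src F)" if "hom1 (Src F) f x y" for f x y
    using that by (simp add: hom1_iff)
  have c2: "\<sigma> \<in> cells2 (Src F)" if "hom2 (Src F) \<sigma> f g" for \<sigma> f g
    using that by (simp add: hom2_iff)
  show ?thesis
  proof (rule two_functorI, goal_cases)
    case 1 then show ?case using F.src.two_category_axioms by simp
  next
    case 2 then show ?case using G.trg.two_category_axioms by simp
  next
    case (6 x)
    then show ?case using F.map0_cells G.map0_cells assms(3) by simp
  next
    case (7 f x y)
    then have f: "hom1 (Src F) f x y" by simp
    then show ?case
      using F.map1_hom[OF f] G.map1_hom[of "map1 F f"] c1[OF f] F.src.hom1_cells0[OF f] assms(3)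
      by simp
  next
    case (8 \<sigma> f g x y)
    then have s: "hom2 (Src F) \<sigma> f g" by simp
    then show ?case
      using F.map2_hom[OF s] G.map2_hom[of "map2 F \<sigma>"] c2[OF s] F.src.hom2_cells1[OF s] assms(3)
      by simp
  next
    case (9 x)
    then show ?case
      using F.map1_id1 G.map1_id1 F.map0_cells assms(3) F.src.id1_hom[of x] by (simp add: c1)
  next
    case (10 f)
    then show ?case
      using F.map2_id2 G.map2_id2 F.map1_cells assms(3) F.src.id2_hom[of f] by (simp add: c2)
  next
    case (11 f g x y z)
    then have h: "hom1 (Src F) f x y" "hom1 (Src F) g y z" by auto
    show ?case
      using c1[OF h(1)] c1[OF h(2)] F.map1_hom[OF h(1)] F.map1_hom[OF h(2)] F.map1_comp1[OF h]
        F.src.comp1_hom[OF h, THEN c1] G.map1_comp1[of "map1 F f" _ _ "map1 F g"] assms(3)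
      by simp
  next
    case (12 \<sigma> \<tau> f g h)
    then have h: "hom2 (Src F) \<sigma> f g" "hom2 (Src F) \<tau> g h" by auto
    show ?case
      using c2[OF h(1)] c2[OF h(2)] F.map2_hom[OF h(1)] F.map2_hom[OF h(2)] F.map2_vcomp[OF h]
        F.src.vcomp_hom[OF h, THEN c2] G.map2_vcomp[of "map2 F \<sigma>" _ _ "map2 F \<tau>"] assms(3)
      by simp
  next
    case (13 \<sigma> \<tau> f f' g g' x y z)
    then have v: "hom2 (Src F) \<sigma> f f'" "hom2 (Src F) \<tau> g g'" by auto
    have h: "homh (Src F) \<sigma> x y" "homh (Src F) \<tau> y z"
      using 13 by (auto intro: F.src.hom2_homh)
    have "hcomp (Src F) \<tau> \<sigma> \<in> cells2 (Src F)"
      using F.src.hcomp_homh[OF h] by (simp add: homh_iff)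
    then show ?case
      using c2[OF v(1)] c2[OF v(2)] F.map2_hcomp[OF h] F.map2_homh[OF h(1)] F.map2_homh[OF h(2)]
        G.map2_hcomp[of "map2 F \<sigma>" _ _ "map2 F \<tau>"] assms(3)
      by simp
  qed (simp_all add: comp_two_fun_ext)
qed

lemma comp_two_fun_assoc:
  assumes "two_functor F" "two_functor G" "Trg F = Src G"
  shows "comp_two_fun H (comp_two_fun G F) = comp_two_fun (comp_two_fun H G) F"
proof -
  interpret F: two_functor F by fact
  have e: "map0 (comp_two_fun H (comp_two_fun G F)) \<in> extensional (cells0 (Src F))"
    "map1 (comp_two_fun H (comp_two_fun G F)) \<in> extensional (cells1 (Src F))"
    "map2 (comp_two_fun H (comp_two_fun G F)) \<in> extensional (cells2 (Src F))"
    using comp_two_fun_ext[of H "comp_two_fun G F"] by simp_all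
  show ?thesis
    by (rule two_fun_eqI[of _ "Src F"])
      (use F.map0_cells F.map1_cells F.map2_cells assms(3) in \<open>simp_all add: e comp_two_fun_ext\<close>)
qed

lemma comp_two_fun_id_left:
  assumes "two_functor F"
  shows "comp_two_fun (id_two_fun (Trg F)) F = F"
proof -
  interpret F: two_functor F by fact
  show ?thesis
    by (rule two_fun_eqI[of _ "Src F"])
      (use F.map0_cells F.map1_cells F.map2_cells in \<open>simp_all add: F.map_ext comp_two_fun_ext\<close>)
qed

lemma comp_two_fun_id_right:
  assumes "two_functor F"
  shows "comp_two_fun F (id_two_fun (Src F)) = F"
proof -
  interpret F: two_functor F by fact
  show ?thesis
    by (rule two_fun_eqI[of _ "Src F"])
      (use comp_two_fun_ext[of F "id_two_fun (Src F)"] in \<open>simp_all add: F.map_ext\<close>)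
qed

lemma category_TwoCat: "category TwoCat"
proof (unfold_locales, goal_cases)
  case (1 f) then show ?case using two_functor.axioms(1) by (auto simp: TwoCat_def)
next
  case (2 f) then show ?case using two_functor.axioms(2) by (auto simp: TwoCat_def)
next
  case (3 x)
  then have "two_category x" by (simp add: TwoCat_def)
  then show ?case by (simp add: in_hom_TwoCat two_functor_id)
next
  case (4 f x y g z)
  then show ?case by (simp add: in_hom_TwoCat two_functor_comp)
next
  case (5 f x y)
  then show ?case using comp_two_fun_id_left[of f] by (auto simp: in_hom_TwoCat)
next
  case (6 f x y)
  then show ?case using comp_two_fun_id_right[of f] by (auto simp: in_hom_TwoCat)
next
  case (7 f w x g y h z)
  then show ?case using comp_two_fun_assoc[of f g h] by (simp add: in_hom_TwoCat)
qed

section \<open>Functor categories and span categories\<close>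

lemma in_hom_functor_cat:
  "in_hom (functor_cat C D) \<eta> F G \<longleftrightarrow> natural_transformation C D \<eta> \<and> nt_src \<eta> = F \<and> nt_trg \<eta> = G"
  by (simp add: in_hom_def functor_cat_def)

lemma nt_eqI:
  fixes \<eta> \<theta> :: "('o1, 'a1, 'o2, 'a2) ntrans"
  assumes "nt_src \<eta> = nt_src \<theta>" "nt_trg \<eta> = nt_trg \<theta>"
    and "nt_comp \<eta> \<in> extensional X" "nt_comp \<theta> \<in> extensional X"
    and "\<And>x. x \<in> X \<Longrightarrow> nt_comp \<eta> x = nt_comp \<theta> x"
  shows "\<eta> = \<theta>"
proof (rule ntrans.equality)
  show "nt_comp \<eta> = nt_comp \<theta>"
    by (rule extensionalityI; fact)
qed (use assms in auto)

lemma functor_cat_Comp_sel [simp]: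
  "nt_src (Comp (functor_cat C D) \<theta> \<eta>) = nt_src \<eta>"
  "nt_trg (Comp (functor_cat C D) \<theta> \<eta>) = nt_trg \<theta>"
  "x \<in> Obj C \<Longrightarrow> nt_comp (Comp (functor_cat C D) \<theta> \<eta>) x = Comp D (nt_comp \<theta> x) (nt_comp \<eta> x)"
  "nt_comp (Comp (functor_cat C D) \<theta> \<eta>) \<in> extensional (Obj C)"
  by (simp_all add: functor_cat_def)

lemma functor_cat_Id_sel [simp]:
  "nt_src (Id (functor_cat C D) F) = F"
  "nt_trg (Id (functor_cat C D) F) = F"
  "x \<in> Obj C \<Longrightarrow> nt_comp (Id (functor_cat C D) F) x = Id D (fobj F x)"
  "nt_comp (Id (functor_cat C D) F) \<in> extensional (Obj C)"
  by (simp_all add: functor_cat_def)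

lemma natural_transformation_Id:
  assumes "cat_functor C D F"
  shows "natural_transformation C D (Id (functor_cat C D) F)"
proof -
  interpret F: cat_functor C D F by fact
  show ?thesis
  proof (intro natural_transformation.intro natural_transformation_axioms.intro, goal_cases)
    case (4 x)
    then show ?case using F.D.Id_hom F.fobj_in by (auto simp: Pi_iff)
  next
    case (5 f x y)
    then show ?case
      using F.farr_hom[OF 5] F.C.hom_objs[OF 5] F.D.Id_left F.D.Id_right by simp
  qed (simp_all add: assms)
qed

lemma natural_transformation_Comp:
  assumes "natural_transformation C D \<eta>" "natural_transformation C D \<theta>" "nt_trg \<eta> = nt_src \<theta>"
  shows "natural_transformation C D (Comp (functor_cat C D) \<theta> \<eta>)"
proof -
  interpret \<eta>: natural_transformation C D \<eta> by fact
  interpret \<theta>: natural_transformation C D \<theta> by fact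
  show ?thesis
  proof (intro natural_transformation.intro natural_transformation_axioms.intro, goal_cases)
    case (4 x)
    then show ?case
      using \<eta>.nt_hom \<theta>.nt_hom assms(3) by (auto intro!: \<eta>.S.D.Comp_hom)
  next
    case (5 f x y)
    have x: "x \<in> Obj C" "y \<in> Obj C"
      using \<eta>.S.C.hom_objs[OF 5] by auto
    note hx = \<eta>.nt_hom[OF x(1)] \<eta>.nt_hom[OF x(2)]
      \<theta>.nt_hom[OF x(1), folded assms(3)] \<theta>.nt_hom[OF x(2), folded assms(3)]
    note hf = \<eta>.S.farr_hom[OF 5] \<eta>.T.farr_hom[OF 5] \<theta>.T.farr_hom[OF 5]
    have "Comp D (farr (nt_trg \<theta>) f) (Comp D (nt_comp \<theta> x) (nt_comp \<eta> x))
        = Comp D (Comp D (farr (nt_trg \<theta>) f) (nt_comp \<theta> x)) (nt_comp \<eta> x)"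
      by (rule \<eta>.S.D.Comp_assoc[OF hx(1) hx(3) hf(3)])
    also have "\<dots> = Comp D (Comp D (nt_comp \<theta> y) (farr (nt_trg \<eta>) f)) (nt_comp \<eta> x)"
      using \<theta>.nt_natural[OF 5] assms(3) by simp
    also have "\<dots> = Comp D (nt_comp \<theta> y) (Comp D (farr (nt_trg \<eta>) f) (nt_comp \<eta> x))"
      by (rule \<eta>.S.D.Comp_assoc[symmetric, OF hx(1) hf(2) hx(4)])
    also have "\<dots> = Comp D (nt_comp \<theta> y) (Comp D (nt_comp \<eta> y) (farr (nt_src \<eta>) f))"
      using \<eta>.nt_natural[OF 5] by simp
    also have "\<dots> = Comp D (Comp D (nt_comp \<theta> y) (nt_comp \<eta> y)) (farr (nt_src \<eta>) f)"
      by (rule \<eta>.S.D.Comp_assoc[OF hf(1) hx(2) hx(4)])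
    finally show ?case
      by (simp add: x)
  qed (simp_all add: \<eta>.S.cat_functor_axioms \<theta>.T.cat_functor_axioms)
qed

lemma category_functor_cat: "category (functor_cat C D)"
proof (unfold_locales, goal_cases)
  case (1 f)
  then show ?case
    using natural_transformation.axioms(1)[of C D f] by (simp add: functor_cat_def)
next
  case (2 f)
  then show ?case
    using natural_transformation.axioms(2)[of C D f] by (simp add: functor_cat_def)
next
  case (3 x)
  then have "cat_functor C D x" by (simp add: functor_cat_def)
  then show ?case by (simp add: in_hom_functor_cat natural_transformation_Id)
next
  case (4 f x y g z)
  then show ?case by (simp add: in_hom_functor_cat natural_transformation_Comp)
next
  case (5 f x y)
  then interpret f: natural_transformation C D f by (simp add: in_hom_functor_cat)
  show ?case
    by (rule nt_eqI[of _ _ "Obj C"])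
      (use 5 f.nt_hom f.S.D.Id_left in \<open>auto simp: in_hom_functor_cat f.nt_ext\<close>)
next
  case (6 f x y)
  then interpret f: natural_transformation C D f by (simp add: in_hom_functor_cat)
  show ?case
    by (rule nt_eqI[of _ _ "Obj C"])
      (use 6 f.nt_hom f.S.D.Id_right in \<open>auto simp: in_hom_functor_cat f.nt_ext\<close>)
next
  case (7 f w x g y h z)
  interpret f: natural_transformation C D f using 7 by (simp add: in_hom_functor_cat)
  interpret g: natural_transformation C D g using 7 by (simp add: in_hom_functor_cat)
  interpret h: natural_transformation C D h using 7 by (simp add: in_hom_functor_cat)
  have "Comp D (nt_comp h a) (Comp D (nt_comp g a) (nt_comp f a))
      = Comp D (Comp D (nt_comp h a) (nt_comp g a)) (nt_comp f a)" if "a \<in> Obj C" for a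
    using f.S.D.Comp_assoc[OF f.nt_hom[OF that], of "nt_comp g a" _ "nt_comp h a"]
      g.nt_hom[OF that] h.nt_hom[OF that] 7 by (simp add: in_hom_functor_cat)
  then show ?case
    by (intro nt_eqI[of _ _ "Obj C"]) simp_all
qed

lemma in_hom_D2Cat:
  "in_hom (D2Cat D) \<eta> F G \<longleftrightarrow> natural_transformation D TwoCat \<eta> \<and> nt_src \<eta> = F \<and> nt_trg \<eta> = G"
  by (simp add: D2Cat_def in_hom_functor_cat)

lemma category_D2Cat: "category (D2Cat D)"
  unfolding D2Cat_def by (rule category_functor_cat)

lemma in_hom_span_cat:
  "in_hom (span_cat E) t S T \<longleftrightarrow> is_span_map E t \<and> sm_src t = S \<and> sm_trg t = T"
  by (simp add: in_hom_def span_cat_def)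

context category
begin

lemma square_paste:
  assumes p: "in_hom C p x y" "in_hom C p' x' y'" "in_hom C p'' x'' y''"
    and a: "in_hom C a x x'" "in_hom C a' x' x''" and l: "in_hom C l y y'" "in_hom C l' y' y''"
    and c: "Comp C l p = Comp C p' a" "Comp C l' p' = Comp C p'' a'"
  shows "Comp C (Comp C l' l) p = Comp C p'' (Comp C a' a)"
proof -
  have "Comp C (Comp C l' l) p = Comp C l' (Comp C p' a)"
    using Comp_assoc[OF p(1) l] c(1) by simp
  also have "\<dots> = Comp C (Comp C p'' a') a"
    using Comp_assoc[OF a(1) p(2) l(2)] c(2) by simp
  also have "\<dots> = Comp C p'' (Comp C a' a)"
    using Comp_assoc[OF a p(3)] by simp
  finally show ?thesis .
qed

lemma is_span_map_Id: "is_span C S \<Longrightarrow> is_span_map C (Id (span_cat C) S)"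
  using Id_left[of "lleg S" "apex S" "lobj S"] Id_right[of "lleg S" "apex S" "lobj S"]
    Id_left[of "rleg S" "apex S" "robj S"] Id_right[of "rleg S" "apex S" "robj S"] Id_hom
  by (simp add: is_span_map_def is_span_def span_cat_def)

lemma is_span_map_Comp:
  assumes "is_span_map C t" "is_span_map C u" "sm_trg t = sm_src u"
  shows "is_span_map C (Comp (span_cat C) u t)"
proof -
  obtain S T U where S: "S = sm_src t" "T = sm_trg t" "T = sm_src u" "U = sm_trg u"
    using assms(3) by blast
  have t: "is_span C S" "is_span C T" "in_hom C (lmap t) (lobj S) (lobj T)"
    "in_hom C (amap t) (apex S) (apex T)" "in_hom C (rmap t) (robj S) (robj T)"
    "Comp C (lmap t) (lleg S) = Comp C (lleg T) (amap t)"
    "Comp C (rmap t) (rleg S) = Comp C (rleg T) (amap t)"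
    using assms(1) S by (simp_all add: is_span_map_def Let_def)
  have u: "is_span C U" "in_hom C (lmap u) (lobj T) (lobj U)"
    "in_hom C (amap u) (apex T) (apex U)" "in_hom C (rmap u) (robj T) (robj U)"
    "Comp C (lmap u) (lleg T) = Comp C (lleg U) (amap u)"
    "Comp C (rmap u) (rleg T) = Comp C (rleg U) (amap u)"
    using assms(2) by (simp_all add: is_span_map_def Let_def S(3,4))
  have legs: "in_hom C (lleg V) (apex V) (lobj V)" "in_hom C (rleg V) (apex V) (robj V)"
    if "is_span C V" for V
    using that by (simp_all add: is_span_def)
  have "is_span_map C \<lparr>sm_src = S, sm_trg = U, lmap = Comp C (lmap u) (lmap t),
      amap = Comp C (amap u) (amap t), rmap = Comp C (rmap u) (rmap t)\<rparr>"
    using Comp_hom[OF t(3) u(2)] Comp_hom[OF t(4) u(3)] Comp_hom[OF t(5) u(4)]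
      square_paste[OF legs(1)[OF t(1)] legs(1)[OF t(2)] legs(1)[OF u(1)] t(4) u(3) t(3) u(2) t(6) u(5)]
      square_paste[OF legs(2)[OF t(1)] legs(2)[OF t(2)] legs(2)[OF u(1)] t(4) u(3) t(5) u(4) t(7) u(6)]
      t(1) u(1)
    by (simp add: is_span_map_def)
  then show ?thesis
    by (simp add: span_cat_def S)
qed

lemma category_span_cat: "category (span_cat C)"
proof (unfold_locales, goal_cases)
  case (1 f)
  then show ?case by (simp add: span_cat_def is_span_map_def Let_def)
next
  case (2 f)
  then show ?case by (simp add: span_cat_def is_span_map_def Let_def)
next
  case (3 x)
  then have "is_span C x" by (simp add: span_cat_def)
  then have "is_span_map C (Id (span_cat C) x)" by (rule is_span_map_Id)
  then show ?case by (simp add: in_hom_span_cat) (simp add: span_cat_def)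
next
  case (4 f x y g z)
  then have "is_span_map C (Comp (span_cat C) g f)"
    by (intro is_span_map_Comp) (simp_all add: in_hom_span_cat)
  then show ?case using 4 by (simp add: in_hom_span_cat) (simp add: span_cat_def)
next
  case (5 f x y)
  then show ?case
    by (intro span_map.equality)
      (auto simp: in_hom_span_cat is_span_map_def Let_def, auto simp: span_cat_def intro: Id_left)
next
  case (6 f x y)
  then show ?case
    by (intro span_map.equality)
      (auto simp: in_hom_span_cat is_span_map_def Let_def, auto simp: span_cat_def intro: Id_right)
next
  case (7 f w x g y h z)
  then show ?case
    by (intro span_map.equality)
      (auto simp: in_hom_span_cat is_span_map_def Let_def, auto simp: span_cat_def intro: Comp_assoc)
qed

end

section \<open>The arrow category of lax maps\<close>

lemma D2Cat_Comp_sel [simp]: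
  "nt_src (Comp (D2Cat D) \<theta> \<eta>) = nt_src \<eta>"
  "nt_trg (Comp (D2Cat D) \<theta> \<eta>) = nt_trg \<theta>"
  "m \<in> Obj D \<Longrightarrow> nt_comp (Comp (D2Cat D) \<theta> \<eta>) m = comp_two_fun (nt_comp \<theta> m) (nt_comp \<eta> m)"
  "nt_comp (Comp (D2Cat D) \<theta> \<eta>) \<in> extensional (Obj D)"
  by (simp_all add: D2Cat_def)

lemma D2Cat_Id_sel [simp]:
  "nt_src (Id (D2Cat D) X) = X"
  "nt_trg (Id (D2Cat D) X) = X"
  "m \<in> Obj D \<Longrightarrow> nt_comp (Id (D2Cat D) X) m = id_two_fun (fobj X m)"
  "nt_comp (Id (D2Cat D) X) \<in> extensional (Obj D)"
  by (simp_all add: D2Cat_def)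

lemma push_two_functor:
  assumes "cat_functor D TwoCat X" "in_hom D \<phi> m n"
  shows "two_functor (farr X \<phi>)" "Src (farr X \<phi>) = fobj X m" "Trg (farr X \<phi>) = fobj X n"
  using cat_functor.farr_hom[OF assms] by (simp_all add: in_hom_TwoCat)

lemma strict_map_comp:
  assumes "in_hom (D2Cat D) h X Y"
  shows "m \<in> Obj D \<Longrightarrow> two_functor (nt_comp h m)"
    "m \<in> Obj D \<Longrightarrow> Src (nt_comp h m) = fobj X m"
    "m \<in> Obj D \<Longrightarrow> Trg (nt_comp h m) = fobj Y m"
    "in_hom D \<phi> m n \<Longrightarrow>
      comp_two_fun (farr Y \<phi>) (nt_comp h m) = comp_two_fun (nt_comp h n) (farr X \<phi>)"
    "cat_functor D TwoCat X" "cat_functor D TwoCat Y" "nt_comp h \<in> extensional (Obj D)"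
proof -
  interpret h: natural_transformation D TwoCat h
    using assms by (simp add: in_hom_D2Cat)
  have [simp]: "nt_src h = X" "nt_trg h = Y"
    using assms by (simp_all add: in_hom_D2Cat)
  show "m \<in> Obj D \<Longrightarrow> two_functor (nt_comp h m)"
    "m \<in> Obj D \<Longrightarrow> Src (nt_comp h m) = fobj X m"
    "m \<in> Obj D \<Longrightarrow> Trg (nt_comp h m) = fobj Y m"
    using h.nt_hom[of m] by (simp_all add: in_hom_TwoCat)
  show "in_hom D \<phi> m n \<Longrightarrow>
      comp_two_fun (farr Y \<phi>) (nt_comp h m) = comp_two_fun (nt_comp h n) (farr X \<phi>)"
    using h.nt_natural[of \<phi> m n] by simp
  show "cat_functor D TwoCat X" "cat_functor D TwoCat Y"
    using h.S.cat_functor_axioms h.T.cat_functor_axioms by simp_all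
  show "nt_comp h \<in> extensional (Obj D)"
    by (rule h.nt_ext)
qed

context D_lax_map
begin

lemma lfun_two_functor:
  assumes "m \<in> Obj D"
  shows "two_functor (lfun h m)" "Src (lfun h m) = fobj (lsrc h) m" "Trg (lfun h m) = fobj (ltrg h) m"
  using lfun_hom[OF assms] by (simp_all add: in_hom_TwoCat)

lemmas src_push = push_two_functor[OF X.cat_functor_axioms]
lemmas trg_push = push_two_functor[OF Y.cat_functor_axioms]

lemma lnat_hom:
  assumes "in_hom D \<phi> m n" "x \<in> cells0 (fobj (lsrc h) m)"
  shows "hom1 (fobj (ltrg h) n) (tn_comp (lnat h \<phi>) x)
    (map0 (farr (ltrg h) \<phi>) (map0 (lfun h m) x)) (map0 (lfun h n) (map0 (farr (lsrc h) \<phi>) x))"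
proof -
  have mn: "m \<in> Obj D" "n \<in> Obj D" "\<phi> \<in> Arr D"
    using X.C.hom_objs[OF assms(1)] assms(1) by (auto simp: in_hom_def)
  interpret a: two_natural "lnat h \<phi>"
    by (rule lnat_natural[OF mn(3)])
  show ?thesis
    using a.tn_hom[of x] assms(2) lnat_boundary[OF assms(1)]
      lfun_two_functor[OF mn(1)] lfun_two_functor[OF mn(2)] src_push[OF assms(1)] trg_push[OF assms(1)]
    by simp
qed

end

text \<open>
  For a strict \<open>D\<close>-map all the structure transformations are identities, so the equation
  \<open>k i = j h\<close> of lax maps amounts to \<open>k\<^sub>m i\<^sub>m = j\<^sub>m h\<^sub>m\<close> for every object \<open>m\<close> together with
  \<open>k\<^sub>n (i\<^sub>\<phi> x) = j\<^sub>\<phi> (h\<^sub>m x)\<close> for every \<open>\<phi> : m \<rightarrow> n\<close> and every object \<open>x\<close>.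
\<close>

lemma comp_lax_eq_iff:
  assumes i: "D_lax_map D i" and j: "D_lax_map D j"
    and h: "in_hom (D2Cat D) h (lsrc i) (lsrc j)" and k: "in_hom (D2Cat D) k (ltrg i) (ltrg j)"
  shows "comp_lax D (lax_of_strict D k) i = comp_lax D j (lax_of_strict D h) \<longleftrightarrow>
    (\<forall>m\<in>Obj D. comp_two_fun (nt_comp k m) (lfun i m) = comp_two_fun (lfun j m) (nt_comp h m)) \<and>
    (\<forall>\<phi> m n x. in_hom D \<phi> m n \<longrightarrow> x \<in> cells0 (fobj (lsrc i) m) \<longrightarrow>
      map1 (nt_comp k n) (tn_comp (lnat i \<phi>) x) = tn_comp (lnat j \<phi>) (map0 (nt_comp h m) x))"
    (is "?L = ?R \<longleftrightarrow> ?P \<and> ?Q")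
proof -
  interpret i: D_lax_map D i by (rule i)
  interpret j: D_lax_map D j by (rule j)
  note hc = strict_map_comp[OF h]
  note kc = strict_map_comp[OF k]
  have bnd: "nt_src h = lsrc i" "nt_trg h = lsrc j" "nt_src k = ltrg i" "nt_trg k = ltrg j"
    using h k by (simp_all add: in_hom_D2Cat)
  have fun_eq: "lfun ?L = lfun ?R \<longleftrightarrow> ?P"
    by (auto simp: comp_lax_def lax_of_strict_def restrict_def fun_eq_iff)
  have nat_eq: "lnat ?L \<phi> = lnat ?R \<phi> \<longleftrightarrow> (\<forall>x\<in>cells0 (fobj (lsrc i) m).
      map1 (nt_comp k n) (tn_comp (lnat i \<phi>) x) = tn_comp (lnat j \<phi>) (map0 (nt_comp h m) x))"
    if P: ?P and \<phi>: "in_hom D \<phi> m n" for \<phi> m n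
  proof -
    have \<phi>': "\<phi> \<in> Arr D" "Dom D \<phi> = m" "Cod D \<phi> = n" and mn: "m \<in> Obj D" "n \<in> Obj D"
      using \<phi> i.X.C.hom_objs[OF \<phi>] by (simp_all add: in_hom_def)
    note facts = i.lfun_two_functor[OF mn(1)] i.lfun_two_functor[OF mn(2)]
      j.lfun_two_functor[OF mn(1)] j.lfun_two_functor[OF mn(2)]
      hc(1-3)[OF mn(1)] hc(1-3)[OF mn(2)] kc(1-3)[OF mn(1)] kc(1-3)[OF mn(2)]
      i.src_push[OF \<phi>] i.trg_push[OF \<phi>] j.src_push[OF \<phi>] j.trg_push[OF \<phi>]
      i.lnat_boundary[OF \<phi>] j.lnat_boundary[OF \<phi>]
    define l where "l = lnat ?L \<phi>"
    define r where "r = lnat ?R \<phi>"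
    have l_def': "l = vcomp_two_nat (fun_nat (nt_comp k n) (lnat i \<phi>))
        (nat_fun (id_two_nat (comp_two_fun (nt_comp k n) (farr (ltrg i) \<phi>))) (lfun i m))"
      using \<phi>' by (simp add: l_def comp_lax_def lax_of_strict_def bnd)
    have r_def': "r = vcomp_two_nat
        (fun_nat (lfun j n) (id_two_nat (comp_two_fun (nt_comp h n) (farr (lsrc i) \<phi>))))
        (nat_fun (lnat j \<phi>) (nt_comp h m))"
      using \<phi>' mn by (simp add: r_def comp_lax_def lax_of_strict_def bnd)
    have Pm: "comp_two_fun (nt_comp k m) (lfun i m) = comp_two_fun (lfun j m) (nt_comp h m)"
      and Pn: "comp_two_fun (nt_comp k n) (lfun i n) = comp_two_fun (lfun j n) (nt_comp h n)"
      using P mn by auto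
    (* The boundary 2-functors agree because h and k are natural; only the components carry
       information. *)
    have src: "tn_src l = tn_src r"
    proof -
      have "tn_src l = comp_two_fun (comp_two_fun (nt_comp k n) (farr (ltrg i) \<phi>)) (lfun i m)"
        by (simp add: l_def' vcomp_two_nat_def nat_fun_def id_two_nat_def)
      also have "\<dots> = comp_two_fun (farr (ltrg j) \<phi>) (comp_two_fun (nt_comp k m) (lfun i m))"
        using comp_two_fun_assoc[of "lfun i m" "nt_comp k m" "farr (ltrg j) \<phi>"]
        by (simp add: facts kc(4)[OF \<phi>, symmetric])
      also have "\<dots> = comp_two_fun (comp_two_fun (farr (ltrg j) \<phi>) (lfun j m)) (nt_comp h m)"
        using comp_two_fun_assoc[of "nt_comp h m" "lfun j m" "farr (ltrg j) \<phi>"]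
        by (simp add: facts Pm)
      also have "\<dots> = tn_src r"
        by (simp add: r_def' vcomp_two_nat_def nat_fun_def facts)
      finally show ?thesis .
    qed
    have trg: "tn_trg l = tn_trg r"
    proof -
      have "tn_trg l = comp_two_fun (nt_comp k n) (comp_two_fun (lfun i n) (farr (lsrc i) \<phi>))"
        by (simp add: l_def' vcomp_two_nat_def fun_nat_def facts)
      also have "\<dots> = comp_two_fun (comp_two_fun (lfun j n) (nt_comp h n)) (farr (lsrc i) \<phi>)"
        using comp_two_fun_assoc[of "farr (lsrc i) \<phi>" "lfun i n" "nt_comp k n"]
        by (simp add: facts Pn)
      also have "\<dots> = tn_trg r"
        using comp_two_fun_assoc[of "farr (lsrc i) \<phi>" "nt_comp h n" "lfun j n"]
        by (simp add: r_def' vcomp_two_nat_def fun_nat_def id_two_nat_def facts)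
      finally show ?thesis .
    qed
    have l_comp: "tn_comp l x = map1 (nt_comp k n) (tn_comp (lnat i \<phi>) x)"
      if x: "x \<in> cells0 (fobj (lsrc i) m)" for x
    proof -
      interpret k: two_functor "nt_comp k n" using facts by simp
      have h1: "hom1 (fobj (ltrg j) n) (map1 (nt_comp k n) (tn_comp (lnat i \<phi>) x))
          (map0 (nt_comp k n) (map0 (farr (ltrg i) \<phi>) (map0 (lfun i m) x)))
          (map0 (nt_comp k n) (map0 (lfun i n) (map0 (farr (lsrc i) \<phi>) x)))"
        using k.map1_hom i.lnat_hom[OF \<phi> x] by (simp add: facts)
      have "map0 (lfun i m) x \<in> cells0 (fobj (ltrg i) m)"
        using two_functor.map0_cells[OF facts(1)] x by (simp add: facts)
      then show ?thesis
        using x two_category.comp1_id_right[OF _ h1] k.trg.two_category_axioms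
        by (simp add: l_def' vcomp_two_nat_def fun_nat_def nat_fun_def id_two_nat_def facts)
    qed
    have r_comp: "tn_comp r x = tn_comp (lnat j \<phi>) (map0 (nt_comp h m) x)"
      if x: "x \<in> cells0 (fobj (lsrc i) m)" for x
    proof -
      interpret jn: two_functor "lfun j n" using facts by simp
      have hx: "map0 (nt_comp h m) x \<in> cells0 (fobj (lsrc j) m)"
        using two_functor.map0_cells[of "nt_comp h m"] x by (simp add: facts)
      then have phx: "map0 (farr (lsrc j) \<phi>) (map0 (nt_comp h m) x) \<in> cells0 (fobj (lsrc j) n)"
        using two_functor.map0_cells[of "farr (lsrc j) \<phi>"] by (simp add: facts)
      have "map0 (comp_two_fun (nt_comp h n) (farr (lsrc i) \<phi>)) x
          = map0 (comp_two_fun (farr (lsrc j) \<phi>) (nt_comp h m)) x"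
        by (simp add: hc(4)[OF \<phi>])
      then have nat: "map0 (nt_comp h n) (map0 (farr (lsrc i) \<phi>) x)
          = map0 (farr (lsrc j) \<phi>) (map0 (nt_comp h m) x)"
        using x by (simp add: facts)
      have "map1 (lfun j n) (id1 (fobj (lsrc j) n) (map0 (farr (lsrc j) \<phi>) (map0 (nt_comp h m) x)))
          = id1 (fobj (ltrg j) n) (map0 (lfun j n) (map0 (farr (lsrc j) \<phi>) (map0 (nt_comp h m) x)))"
        using jn.map1_id1 phx by (simp add: facts)
      then show ?thesis
        using x two_category.comp1_id_left[OF _ j.lnat_hom[OF \<phi> hx]] jn.trg.two_category_axioms
        by (simp add: r_def' vcomp_two_nat_def fun_nat_def nat_fun_def id_two_nat_def facts nat)
    qed
    have ext: "tn_comp l \<in> extensional (cells0 (fobj (lsrc i) m))"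
      "tn_comp r \<in> extensional (cells0 (fobj (lsrc i) m))"
      by (simp_all add: l_def' r_def' vcomp_two_nat_def nat_fun_def facts)
    have "l = r \<longleftrightarrow> tn_comp l = tn_comp r"
      using src trg by (auto intro: two_nat.equality)
    also have "\<dots> \<longleftrightarrow> (\<forall>x\<in>cells0 (fobj (lsrc i) m). tn_comp l x = tn_comp r x)"
      using extensionalityI[OF ext] by auto
    finally show ?thesis
      using l_comp r_comp by (simp add: l_def r_def)
  qed
  have lext: "lnat ?L \<in> extensional (Arr D)" "lnat ?R \<in> extensional (Arr D)"
    by (simp_all add: comp_lax_def)
  have "?L = ?R \<longleftrightarrow> ?P \<and> lnat ?L = lnat ?R"
    using fun_eq by (auto intro!: lax_map.equality simp: comp_lax_def lax_of_strict_def bnd)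
  also have "\<dots> \<longleftrightarrow> ?P \<and> (\<forall>\<phi>\<in>Arr D. lnat ?L \<phi> = lnat ?R \<phi>)"
    using extensionalityI[OF lext] by metis
  also have "\<dots> \<longleftrightarrow> ?P \<and> (\<forall>\<phi> m n. in_hom D \<phi> m n \<longrightarrow> lnat ?L \<phi> = lnat ?R \<phi>)"
    by (auto simp: in_hom_def)
  also have "\<dots> \<longleftrightarrow> ?P \<and> ?Q"
    using nat_eq by blast
  finally show ?thesis .
qed

lemma is_lax_square_iff:
  "is_lax_square D q \<longleftrightarrow> D_lax_map D (sq_src q) \<and> D_lax_map D (sq_trg q) \<and>
    in_hom (D2Cat D) (sq_h q) (lsrc (sq_src q)) (lsrc (sq_trg q)) \<and>
    in_hom (D2Cat D) (sq_k q) (ltrg (sq_src q)) (ltrg (sq_trg q)) \<and>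
    (\<forall>m\<in>Obj D. comp_two_fun (nt_comp (sq_k q) m) (lfun (sq_src q) m)
      = comp_two_fun (lfun (sq_trg q) m) (nt_comp (sq_h q) m)) \<and>
    (\<forall>\<phi> m n x. in_hom D \<phi> m n \<longrightarrow> x \<in> cells0 (fobj (lsrc (sq_src q)) m) \<longrightarrow>
      map1 (nt_comp (sq_k q) n) (tn_comp (lnat (sq_src q) \<phi>) x)
        = tn_comp (lnat (sq_trg q) \<phi>) (map0 (nt_comp (sq_h q) m) x))"
  unfolding is_lax_square_def Let_def using comp_lax_eq_iff by blast

lemma is_lax_squareD:
  assumes "is_lax_square D q"
  shows "D_lax_map D (sq_src q)" "D_lax_map D (sq_trg q)"
    "in_hom (D2Cat D) (sq_h q) (lsrc (sq_src q)) (lsrc (sq_trg q))"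
    "in_hom (D2Cat D) (sq_k q) (ltrg (sq_src q)) (ltrg (sq_trg q))"
    "m \<in> Obj D \<Longrightarrow> comp_two_fun (nt_comp (sq_k q) m) (lfun (sq_src q) m)
      = comp_two_fun (lfun (sq_trg q) m) (nt_comp (sq_h q) m)"
    "in_hom D \<phi> m n \<Longrightarrow> x \<in> cells0 (fobj (lsrc (sq_src q)) m) \<Longrightarrow>
      map1 (nt_comp (sq_k q) n) (tn_comp (lnat (sq_src q) \<phi>) x)
        = tn_comp (lnat (sq_trg q) \<phi>) (map0 (nt_comp (sq_h q) m) x)"
  using assms unfolding is_lax_square_iff by auto

lemma in_hom_lax_arrow_cat:
  "in_hom (lax_arrow_cat D) q i j \<longleftrightarrow> is_lax_square D q \<and> sq_src q = i \<and> sq_trg q = j"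
  by (simp add: in_hom_def lax_arrow_cat_def)

lemma lax_arrow_cat_Comp_sel [simp]:
  "sq_src (Comp (lax_arrow_cat D) p q) = sq_src q"
  "sq_trg (Comp (lax_arrow_cat D) p q) = sq_trg p"
  "sq_h (Comp (lax_arrow_cat D) p q) = Comp (D2Cat D) (sq_h p) (sq_h q)"
  "sq_k (Comp (lax_arrow_cat D) p q) = Comp (D2Cat D) (sq_k p) (sq_k q)"
  by (simp_all add: lax_arrow_cat_def)

lemma lax_arrow_cat_Id_sel [simp]:
  "sq_src (Id (lax_arrow_cat D) i) = i"
  "sq_trg (Id (lax_arrow_cat D) i) = i"
  "sq_h (Id (lax_arrow_cat D) i) = Id (D2Cat D) (lsrc i)"
  "sq_k (Id (lax_arrow_cat D) i) = Id (D2Cat D) (ltrg i)"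
  by (simp_all add: lax_arrow_cat_def)

lemma is_lax_square_Id:
  assumes "D_lax_map D i"
  shows "is_lax_square D (Id (lax_arrow_cat D) i)"
proof -
  interpret i: D_lax_map D i by fact
  have h: "in_hom (D2Cat D) (Id (D2Cat D) X) X X" if "cat_functor D TwoCat X" for X
    using category.Id_hom[OF category_D2Cat, of X D] that by (simp add: D2Cat_def functor_cat_def)
  have eq: "comp_two_fun (id_two_fun (fobj (ltrg i) m)) (lfun i m)
      = comp_two_fun (lfun i m) (id_two_fun (fobj (lsrc i) m))" if "m \<in> Obj D" for m
    using comp_two_fun_id_left[of "lfun i m"] comp_two_fun_id_right[of "lfun i m"]
      i.lfun_two_functor[OF that] by simp
  have nat: "map1 (id_two_fun (fobj (ltrg i) n)) (tn_comp (lnat i \<phi>) x) = tn_comp (lnat i \<phi>) x"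
    if "in_hom D \<phi> m n" "x \<in> cells0 (fobj (lsrc i) m)" for \<phi> m n x
    using i.lnat_hom[OF that] by (simp add: hom1_iff)
  show ?thesis
    unfolding is_lax_square_iff
    using h[OF i.X.cat_functor_axioms] h[OF i.Y.cat_functor_axioms] eq nat assms i.X.C.hom_objs
    by simp
qed

lemma is_lax_square_Comp:
  assumes "is_lax_square D q" "is_lax_square D p" "sq_trg q = sq_src p"
  shows "is_lax_square D (Comp (lax_arrow_cat D) p q)"
proof -
  note q = is_lax_squareD[OF assms(1)]
  note p = is_lax_squareD[OF assms(2), folded assms(3)]
  interpret i: D_lax_map D "sq_src q" by (rule q(1))
  interpret j: D_lax_map D "sq_trg q" by (rule q(2))
  interpret l: D_lax_map D "sq_trg p" by (rule p(2))
  note qh = strict_map_comp[OF q(3)]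
  note qk = strict_map_comp[OF q(4)]
  note ph = strict_map_comp[OF p(3)]
  note pk = strict_map_comp[OF p(4)]
  have eq: "comp_two_fun (comp_two_fun (nt_comp (sq_k p) m) (nt_comp (sq_k q) m)) (lfun (sq_src q) m)
      = comp_two_fun (lfun (sq_trg p) m) (comp_two_fun (nt_comp (sq_h p) m) (nt_comp (sq_h q) m))"
    if m: "m \<in> Obj D" for m
  proof -
    note facts = i.lfun_two_functor[OF m] j.lfun_two_functor[OF m] l.lfun_two_functor[OF m]
      qh(1-3)[OF m] qk(1-3)[OF m] ph(1-3)[OF m] pk(1-3)[OF m]
    have "comp_two_fun (comp_two_fun (nt_comp (sq_k p) m) (nt_comp (sq_k q) m)) (lfun (sq_src q) m)
        = comp_two_fun (nt_comp (sq_k p) m) (comp_two_fun (lfun (sq_trg q) m) (nt_comp (sq_h q) m))"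
      using comp_two_fun_assoc[of "lfun (sq_src q) m" "nt_comp (sq_k q) m" "nt_comp (sq_k p) m"]
      by (simp add: facts q(5)[OF m])
    also have "\<dots> = comp_two_fun (comp_two_fun (lfun (sq_trg p) m) (nt_comp (sq_h p) m))
        (nt_comp (sq_h q) m)"
      using comp_two_fun_assoc[of "nt_comp (sq_h q) m" "lfun (sq_trg q) m" "nt_comp (sq_k p) m"]
      by (simp add: facts p(5)[OF m])
    also have "\<dots> = comp_two_fun (lfun (sq_trg p) m)
        (comp_two_fun (nt_comp (sq_h p) m) (nt_comp (sq_h q) m))"
      using comp_two_fun_assoc[of "nt_comp (sq_h q) m" "nt_comp (sq_h p) m" "lfun (sq_trg p) m"]
      by (simp add: facts)
    finally show ?thesis .
  qed
  have nat: "map1 (comp_two_fun (nt_comp (sq_k p) n) (nt_comp (sq_k q) n)) (tn_comp (lnat (sq_src q) \<phi>) x)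
      = tn_comp (lnat (sq_trg p) \<phi>) (map0 (comp_two_fun (nt_comp (sq_h p) m) (nt_comp (sq_h q) m)) x)"
    if \<phi>: "in_hom D \<phi> m n" and x: "x \<in> cells0 (fobj (lsrc (sq_src q)) m)" for \<phi> m n x
  proof -
    have mn: "m \<in> Obj D" "n \<in> Obj D"
      using i.X.C.hom_objs[OF \<phi>] by auto
    have hx: "map0 (nt_comp (sq_h q) m) x \<in> cells0 (fobj (lsrc (sq_trg q)) m)"
      using two_functor.map0_cells[OF qh(1)[OF mn(1)]] x by (simp add: qh mn)
    show ?thesis
      using i.lnat_hom[OF \<phi> x] q(6)[OF \<phi> x] p(6)[OF \<phi> hx] x
      by (simp add: hom1_iff qh(2)[OF mn(1)] qk(2)[OF mn(2)])
  qed
  show ?thesis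
    unfolding is_lax_square_iff
    using q(1) p(2) eq nat category.Comp_hom[OF category_D2Cat q(3) p(3)]
      category.Comp_hom[OF category_D2Cat q(4) p(4)] i.X.C.hom_objs by simp
qed

lemma category_lax_arrow_cat: "category (lax_arrow_cat D)"
proof -
  interpret E: category "D2Cat D" by (rule category_D2Cat)
  show ?thesis
  proof (unfold_locales, goal_cases)
    case (1 f) then show ?case using is_lax_squareD(1)[of D f] by (simp add: lax_arrow_cat_def)
  next
    case (2 f) then show ?case using is_lax_squareD(2)[of D f] by (simp add: lax_arrow_cat_def)
  next
    case (3 x)
    then have "D_lax_map D x" by (simp add: lax_arrow_cat_def)
    then show ?case by (simp add: in_hom_lax_arrow_cat is_lax_square_Id)
  next
    case (4 f x y g z)
    then show ?case by (simp add: in_hom_lax_arrow_cat is_lax_square_Comp)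
  next
    case (5 f x y)
    then show ?case
      using is_lax_squareD(3,4)[of D f] by (auto simp: in_hom_lax_arrow_cat intro!: lax_square.equality E.Id_left)
  next
    case (6 f x y)
    then show ?case
      using is_lax_squareD(3,4)[of D f] by (auto simp: in_hom_lax_arrow_cat intro!: lax_square.equality E.Id_right)
  next
    case (7 f w x g y h z)
    have sq: "is_lax_square D f" "is_lax_square D g" "is_lax_square D h"
      and b: "sq_trg f = sq_src g" "sq_trg g = sq_src h"
      using 7 by (simp_all add: in_hom_lax_arrow_cat)
    show ?case
      using is_lax_squareD(3,4)[OF sq(1)] is_lax_squareD(3,4)[OF sq(2)] is_lax_squareD(3,4)[OF sq(3)]
      by (intro lax_square.equality) (simp_all add: b E.Comp_assoc)
  qed
qed

section \<open>The 2-category of the construction\<close>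

text \<open>
  A cell is handled through its coordinates: membership of an explicit tuple is characterised
  by conditions on the entries, and every cell is such a tuple.
\<close>

lemma E0_Tuple_iff: "Tuple [x, f, a] \<in> E0 F \<longleftrightarrow>
    x \<in> cells0 (Src F) \<and> a \<in> cells0 (Trg F) \<and> hom1 (Trg F) f a (map0 F x)"
  by (simp add: E0_def)

lemma E0E:
  assumes "P \<in> E0 F"
  obtains x f a where "P = Tuple [x, f, a]"
  using assms unfolding E0_def by blast

lemma E0_comp:
  assumes "P \<in> E0 F"
  shows "coord P 0 \<in> cells0 (Src F)" "coord P 2 \<in> cells0 (Trg F)"
    "hom1 (Trg F) (coord P 1) (coord P 2) (map0 F (coord P 0))"
  using assms by (cases rule: E0E[OF assms]; simp add: E0_Tuple_iff)+

lemma E1_Tuple_iff: "Tuple [P, s, r, Q] \<in> E1 F \<longleftrightarrow> P \<in> E0 F \<and> Q \<in> E0 F \<and>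
    hom1 (Src F) s (coord P 0) (coord Q 0) \<and> hom1 (Trg F) r (coord P 2) (coord Q 2) \<and>
    comp1 (Trg F) (coord Q 1) r = comp1 (Trg F) (map1 F s) (coord P 1)"
proof
  assume R: "P \<in> E0 F \<and> Q \<in> E0 F \<and>
    hom1 (Src F) s (coord P 0) (coord Q 0) \<and> hom1 (Trg F) r (coord P 2) (coord Q 2) \<and>
    comp1 (Trg F) (coord Q 1) r = comp1 (Trg F) (map1 F s) (coord P 1)"
  obtain x f a y g b where "P = Tuple [x, f, a]" "Q = Tuple [y, g, b]"
    using R E0E by metis
  then show "Tuple [P, s, r, Q] \<in> E1 F"
    unfolding E1_def using R by simp
qed (auto simp: E1_def)

lemma E1E:
  assumes "S \<in> E1 F"
  obtains P s r Q where "S = Tuple [P, s, r, Q]"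
  using assms unfolding E1_def by blast

lemma E2_Tuple_iff: "Tuple [S, \<beta>, \<alpha>, T] \<in> E2 F \<longleftrightarrow> S \<in> E1 F \<and> T \<in> E1 F \<and>
    coord S 0 = coord T 0 \<and> coord S 3 = coord T 3 \<and>
    hom2 (Src F) \<beta> (coord S 1) (coord T 1) \<and> hom2 (Trg F) \<alpha> (coord S 2) (coord T 2) \<and>
    lwhisker (Trg F) (coord (coord S 3) 1) \<alpha> = rwhisker (Trg F) (map2 F \<beta>) (coord (coord S 0) 1)"
    (is "_ \<longleftrightarrow> ?R")
proof
  assume R: ?R
  obtain P s r Q where S: "S = Tuple [P, s, r, Q]"
    using R E1E by blast
  obtain s' r' where T: "T = Tuple [P, s', r', Q]"
    using R S by (auto elim: E1E)
  obtain x f a y g b where "P = Tuple [x, f, a]" "Q = Tuple [y, g, b]"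
    using R S E0E E1_Tuple_iff by metis
  then show "Tuple [S, \<beta>, \<alpha>, T] \<in> E2 F"
    unfolding E2_def using R S T by simp
qed (auto simp: E2_def)

lemma E2E:
  assumes "\<sigma> \<in> E2 F"
  obtains S \<beta> \<alpha> T where "\<sigma> = Tuple [S, \<beta>, \<alpha>, T]"
  using assms unfolding E2_def by blast

lemma E1_comp:
  assumes "S \<in> E1 F"
  shows "coord S 0 \<in> E0 F" "coord S 3 \<in> E0 F"
  using assms by (cases rule: E1E[OF assms]; simp add: E1_Tuple_iff)+

lemma E2_comp:
  assumes "\<sigma> \<in> E2 F"
  shows "coord \<sigma> 0 \<in> E1 F" "coord \<sigma> 3 \<in> E1 F"
    "coord (coord \<sigma> 0) 0 = coord (coord \<sigma> 3) 0" "coord (coord \<sigma> 0) 3 = coord (coord \<sigma> 3) 3"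
  using assms by (cases rule: E2E[OF assms]; simp add: E2_Tuple_iff)+

text \<open>
  Typing in \<open>E_two_cat F\<close>: a 1-cell or 2-cell with given boundary is the same as a pair of cells of
  the source and the target of \<open>F\<close> satisfying the compatibility equation.
\<close>

lemma E_hom1_iff: "hom1 (E_two_cat F) S P Q \<longleftrightarrow> S \<in> E1 F \<and> coord S 0 = P \<and> coord S 3 = Q"
  by (auto simp: hom1_iff E_two_cat_def)

lemma E_hom2_iff: "hom2 (E_two_cat F) \<sigma> S T \<longleftrightarrow> \<sigma> \<in> E2 F \<and> coord \<sigma> 0 = S \<and> coord \<sigma> 3 = T"
  by (auto simp: hom2_iff E_two_cat_def)

lemma E_hom1E:
  assumes "hom1 (E_two_cat F) S P Q"
  obtains s r where "S = Tuple [P, s, r, Q]" "P \<in> E0 F" "Q \<in> E0 F" "S \<in> E1 F"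
    "hom1 (Src F) s (coord P 0) (coord Q 0)" "hom1 (Trg F) r (coord P 2) (coord Q 2)"
    "comp1 (Trg F) (coord Q 1) r = comp1 (Trg F) (map1 F s) (coord P 1)"
proof -
  have S: "S \<in> E1 F" "coord S 0 = P" "coord S 3 = Q"
    using assms by (simp_all add: E_hom1_iff)
  then obtain s r where s: "S = Tuple [P, s, r, Q]"
    by (auto elim: E1E)
  show thesis
    by (rule that[OF s]) (use S(1) in \<open>simp_all add: s E1_Tuple_iff\<close>)
qed

lemma E_hom1_comp:
  assumes "hom1 (E_two_cat F) S P Q"
  shows "P \<in> E0 F" "Q \<in> E0 F" "hom1 (Src F) (coord S 1) (coord P 0) (coord Q 0)"
    "hom1 (Trg F) (coord S 2) (coord P 2) (coord Q 2)"
  by (rule E_hom1E[OF assms]; simp)+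

lemma E_hom1I:
  assumes "P \<in> E0 F" "Q \<in> E0 F"
    "hom1 (Src F) s (coord P 0) (coord Q 0)" "hom1 (Trg F) r (coord P 2) (coord Q 2)"
    "comp1 (Trg F) (coord Q 1) r = comp1 (Trg F) (map1 F s) (coord P 1)"
  shows "hom1 (E_two_cat F) (Tuple [P, s, r, Q]) P Q"
  using assms E1_Tuple_iff[of P s r Q F] by (simp add: E_hom1_iff)

lemma E_hom2_parallel:
  assumes "hom2 (E_two_cat F) \<sigma> S T"
  shows "hom1 (E_two_cat F) S P Q \<longleftrightarrow> hom1 (E_two_cat F) T P Q"
    "hom1 (E_two_cat F) S (coord S 0) (coord S 3)"
  using assms E2_comp[of \<sigma> F] by (auto simp: E_hom1_iff E_hom2_iff)

lemma E_hom2E: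
  assumes "hom2 (E_two_cat F) \<sigma> S T" "hom1 (E_two_cat F) S P Q"
  obtains \<beta> \<alpha> where "\<sigma> = Tuple [S, \<beta>, \<alpha>, T]" "hom1 (E_two_cat F) T P Q"
    "hom2 (Src F) \<beta> (coord S 1) (coord T 1)" "hom2 (Trg F) \<alpha> (coord S 2) (coord T 2)"
    "lwhisker (Trg F) (coord Q 1) \<alpha> = rwhisker (Trg F) (map2 F \<beta>) (coord P 1)"
proof -
  have \<sigma>: "\<sigma> \<in> E2 F" "coord \<sigma> 0 = S" "coord \<sigma> 3 = T"
    using assms by (simp_all add: E_hom2_iff)
  then obtain \<beta> \<alpha> where b: "\<sigma> = Tuple [S, \<beta>, \<alpha>, T]"
    by (auto elim: E2E)
  have S: "coord S 0 = P" "coord S 3 = Q"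
    using assms(2) by (simp_all add: E_hom1_iff)
  show thesis
    by (rule that[OF b]) (use \<sigma>(1)[unfolded b E2_Tuple_iff] S in \<open>auto simp: E_hom1_iff\<close>)
qed

lemma E_hom2I:
  assumes "hom1 (E_two_cat F) S P Q" "hom1 (E_two_cat F) T P Q"
    "hom2 (Src F) \<beta> (coord S 1) (coord T 1)" "hom2 (Trg F) \<alpha> (coord S 2) (coord T 2)"
    "lwhisker (Trg F) (coord Q 1) \<alpha> = rwhisker (Trg F) (map2 F \<beta>) (coord P 1)"
  shows "hom2 (E_two_cat F) (Tuple [S, \<beta>, \<alpha>, T]) S T"
  using assms by (simp add: E_hom2_iff E_hom1_iff E2_Tuple_iff)

lemma E_hom2_compE:
  assumes "hom2 (E_two_cat F) \<sigma> S T"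
  obtains \<beta> \<alpha> where "\<sigma> = Tuple [S, \<beta>, \<alpha>, T]" "S \<in> E1 F" "T \<in> E1 F"
    "hom2 (Src F) \<beta> (coord S 1) (coord T 1)" "hom2 (Trg F) \<alpha> (coord S 2) (coord T 2)"
proof (rule E_hom2E[OF assms E_hom2_parallel(2)[OF assms]], goal_cases)
  case (1 \<beta> \<alpha>)
  then show ?case
    using that[of \<beta> \<alpha>] E_hom2_parallel(2)[OF assms] by (simp add: E_hom1_iff)
qed

lemma E_cells [simp]: "cells0 (E_two_cat F) = E0 F" "cells1 (E_two_cat F) = E1 F"
  "cells2 (E_two_cat F) = E2 F"
  by (simp_all add: E_two_cat_def)

lemma E_id1: "P \<in> E0 F \<Longrightarrow> id1 (E_two_cat F) P
    = Tuple [P, id1 (Src F) (coord P 0), id1 (Trg F) (coord P 2), P]"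
  by (simp add: E_two_cat_def)

lemma E_id2: "S \<in> E1 F \<Longrightarrow> id2 (E_two_cat F) S
    = Tuple [S, id2 (Src F) (coord S 1), id2 (Trg F) (coord S 2), S]"
  by (simp add: E_two_cat_def)

lemma E_comp1:
  assumes "hom1 (E_two_cat F) (Tuple [P, s, r, Q]) P Q" "hom1 (E_two_cat F) (Tuple [Q, s', r', R]) Q R"
  shows "comp1 (E_two_cat F) (Tuple [Q, s', r', R]) (Tuple [P, s, r, Q])
    = Tuple [P, comp1 (Src F) s' s, comp1 (Trg F) r' r, R]"
  using assms[unfolded E_hom1_iff] by (simp add: E_two_cat_def E_comp1_def)

lemma E_comp1_comp:
  assumes "hom1 (E_two_cat F) S P Q" "hom1 (E_two_cat F) T Q R"
  shows "coord (comp1 (E_two_cat F) T S) 1 = comp1 (Src F) (coord T 1) (coord S 1)"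
    "coord (comp1 (E_two_cat F) T S) 2 = comp1 (Trg F) (coord T 2) (coord S 2)"
  using assms[unfolded E_hom1_iff] by (simp_all add: E_two_cat_def E_comp1_def)

lemma E_vcomp:
  assumes "hom2 (E_two_cat F) (Tuple [S, \<beta>, \<alpha>, T]) S T" "hom2 (E_two_cat F) (Tuple [T, \<beta>', \<alpha>', U]) T U"
  shows "vcomp (E_two_cat F) (Tuple [T, \<beta>', \<alpha>', U]) (Tuple [S, \<beta>, \<alpha>, T])
    = Tuple [S, vcomp (Src F) \<beta>' \<beta>, vcomp (Trg F) \<alpha>' \<alpha>, U]"
  using assms[unfolded E_hom2_iff] by (simp add: E_two_cat_def)

lemma E_hcomp:
  assumes "hom2 (E_two_cat F) (Tuple [S, \<beta>, \<alpha>, T]) S T" "hom2 (E_two_cat F) (Tuple [S', \<beta>', \<alpha>', T']) S' T'"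
    and "hom1 (E_two_cat F) T P Q" "hom1 (E_two_cat F) S' Q R"
  shows "hcomp (E_two_cat F) (Tuple [S', \<beta>', \<alpha>', T']) (Tuple [S, \<beta>, \<alpha>, T])
    = Tuple [comp1 (E_two_cat F) S' S, hcomp (Src F) \<beta>' \<beta>, hcomp (Trg F) \<alpha>' \<alpha>, comp1 (E_two_cat F) T' T]"
  using assms[unfolded E_hom1_iff E_hom2_iff] by (simp add: E_two_cat_def)

context
  fixes F :: "'a cell two_fun"
  assumes F: "two_functor F"
begin

interpretation F: two_functor F by (rule F)

lemma E_id1_hom:
  assumes "P \<in> E0 F"
  shows "hom1 (E_two_cat F) (id1 (E_two_cat F) P) P P"
proof -
  have P: "coord P 0 \<in> cells0 (Src F)" "coord P 2 \<in> cells0 (Trg F)"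
    and f: "hom1 (Trg F) (coord P 1) (coord P 2) (map0 F (coord P 0))"
    using E0_comp[OF assms] by auto
  show ?thesis
    unfolding E_id1[OF assms]
    by (rule E_hom1I)
      (use assms F.src.id1_hom F.trg.id1_hom F.map1_id1 F.trg.comp1_id_left[OF f]
        F.trg.comp1_id_right[OF f] P in auto)
qed

lemma E_comp1_hom:
  assumes S: "hom1 (E_two_cat F) S P Q" and T: "hom1 (E_two_cat F) T Q R"
  shows "hom1 (E_two_cat F) (comp1 (E_two_cat F) T S) P R"
proof -
  obtain s r where s: "S = Tuple [P, s, r, Q]" "P \<in> E0 F" "Q \<in> E0 F"
    "hom1 (Src F) s (coord P 0) (coord Q 0)" "hom1 (Trg F) r (coord P 2) (coord Q 2)"
    "comp1 (Trg F) (coord Q 1) r = comp1 (Trg F) (map1 F s) (coord P 1)"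
    by (rule E_hom1E[OF S]) (rule that; assumption)
  obtain s' r' where s': "T = Tuple [Q, s', r', R]" "R \<in> E0 F"
    "hom1 (Src F) s' (coord Q 0) (coord R 0)" "hom1 (Trg F) r' (coord Q 2) (coord R 2)"
    "comp1 (Trg F) (coord R 1) r' = comp1 (Trg F) (map1 F s') (coord Q 1)"
    by (rule E_hom1E[OF T]) (rule that; assumption)
  have f: "hom1 (Trg F) (coord P 1) (coord P 2) (map0 F (coord P 0))"
    "hom1 (Trg F) (coord Q 1) (coord Q 2) (map0 F (coord Q 0))"
    "hom1 (Trg F) (coord R 1) (coord R 2) (map0 F (coord R 0))"
    using E0_comp(3)[OF s(2)] E0_comp(3)[OF s(3)] E0_comp(3)[OF s'(2)] by auto
  note Fs = F.map1_hom[OF s(4)] F.map1_hom[OF s'(3)]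
  have "comp1 (Trg F) (coord R 1) (comp1 (Trg F) r' r)
      = comp1 (Trg F) (comp1 (Trg F) (map1 F s') (coord Q 1)) r"
    using F.trg.comp1_assoc[OF s(5) s'(4) f(3)] s'(5) by simp
  also have "\<dots> = comp1 (Trg F) (map1 F s') (comp1 (Trg F) (map1 F s) (coord P 1))"
    using F.trg.comp1_assoc[OF s(5) f(2) Fs(2)] s(6) by simp
  also have "\<dots> = comp1 (Trg F) (map1 F (comp1 (Src F) s' s)) (coord P 1)"
    using F.trg.comp1_assoc[OF f(1) Fs] F.map1_comp1[OF s(4) s'(3)] by simp
  finally show ?thesis
    unfolding s(1) s'(1) E_comp1[OF S[unfolded s(1)] T[unfolded s'(1)]]
    by (intro E_hom1I s s' F.src.comp1_hom[OF s(4) s'(3)] F.trg.comp1_hom[OF s(5) s'(4)])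
qed

lemma category_E1: "category (cat1 (E_two_cat F))"
proof (unfold_locales, goal_cases)
  case (1 f)
  then show ?case using E1_comp[of f F] by (simp add: cat1_def E_two_cat_def)
next
  case (2 f)
  then show ?case using E1_comp[of f F] by (simp add: cat1_def E_two_cat_def)
next
  case (3 x)
  then show ?case using E_id1_hom[of x] by (simp add: cat1_def)
next
  case (4 f x y g z)
  then show ?case using E_comp1_hom[OF 4] by (simp add: cat1_def)
next
  case (5 S P Q)
  then obtain s r where s: "S = Tuple [P, s, r, Q]" "P \<in> E0 F" "Q \<in> E0 F"
    "hom1 (Src F) s (coord P 0) (coord Q 0)" "hom1 (Trg F) r (coord P 2) (coord Q 2)"
    by (elim E_hom1E) (rule that; assumption)
  have "comp1 (E_two_cat F) (id1 (E_two_cat F) Q) S = S"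
    using E_comp1[OF 5[unfolded s(1)] E_id1_hom[OF s(3), unfolded E_id1[OF s(3)]]]
      F.src.comp1_id_left[OF s(4)] F.trg.comp1_id_left[OF s(5)]
    by (simp add: E_id1[OF s(3)] s(1))
  then show ?case by (simp add: cat1_def)
next
  case (6 S P Q)
  then obtain s r where s: "S = Tuple [P, s, r, Q]" "P \<in> E0 F" "Q \<in> E0 F"
    "hom1 (Src F) s (coord P 0) (coord Q 0)" "hom1 (Trg F) r (coord P 2) (coord Q 2)"
    by (elim E_hom1E) (rule that; assumption)
  have "comp1 (E_two_cat F) S (id1 (E_two_cat F) P) = S"
    using E_comp1[OF E_id1_hom[OF s(2), unfolded E_id1[OF s(2)]] 6[unfolded s(1)]]
      F.src.comp1_id_right[OF s(4)] F.trg.comp1_id_right[OF s(5)]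
    by (simp add: E_id1[OF s(2)] s(1))
  then show ?case by (simp add: cat1_def)
next
  case (7 S P Q T R U V)
  obtain s r where s: "S = Tuple [P, s, r, Q]"
    "hom1 (Src F) s (coord P 0) (coord Q 0)" "hom1 (Trg F) r (coord P 2) (coord Q 2)"
    by (rule E_hom1E[OF 7(1)]) (rule that; assumption)
  obtain t q where t: "T = Tuple [Q, t, q, R]"
    "hom1 (Src F) t (coord Q 0) (coord R 0)" "hom1 (Trg F) q (coord Q 2) (coord R 2)"
    by (rule E_hom1E[OF 7(2)]) (rule that; assumption)
  obtain u p where u: "U = Tuple [R, u, p, V]"
    "hom1 (Src F) u (coord R 0) (coord V 0)" "hom1 (Trg F) p (coord R 2) (coord V 2)"
    by (rule E_hom1E[OF 7(3)]) (rule that; assumption)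
  note st = E_comp1[OF 7(1)[unfolded s(1)] 7(2)[unfolded t(1)]]
  note tu = E_comp1[OF 7(2)[unfolded t(1)] 7(3)[unfolded u(1)]]
  note st_hom = E_comp1_hom[OF 7(1,2), unfolded s(1) t(1) st]
  note tu_hom = E_comp1_hom[OF 7(2,3), unfolded t(1) u(1) tu]
  have "comp1 (E_two_cat F) U (comp1 (E_two_cat F) T S) = comp1 (E_two_cat F) (comp1 (E_two_cat F) U T) S"
    using E_comp1[OF st_hom 7(3)[unfolded u(1)]] E_comp1[OF 7(1)[unfolded s(1)] tu_hom]
      F.src.comp1_assoc[OF s(2) t(2) u(2)] F.trg.comp1_assoc[OF s(3) t(3) u(3)]
    by (simp add: s(1) t(1) u(1) st tu)
  then show ?case by (simp add: cat1_def)
qed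

interpretation E1: category "cat1 (E_two_cat F)" by (rule category_E1)

lemma E_id2_hom:
  assumes "S \<in> E1 F"
  shows "hom2 (E_two_cat F) (id2 (E_two_cat F) S) S S"
proof -
  obtain P Q where S: "hom1 (E_two_cat F) S P Q"
    using assms by (simp add: E_hom1_iff)
  obtain s r where s: "S = Tuple [P, s, r, Q]" "P \<in> E0 F" "Q \<in> E0 F"
    "hom1 (Src F) s (coord P 0) (coord Q 0)" "hom1 (Trg F) r (coord P 2) (coord Q 2)"
    "comp1 (Trg F) (coord Q 1) r = comp1 (Trg F) (map1 F s) (coord P 1)"
    by (rule E_hom1E[OF S]) (rule that; assumption)
  have c: "s \<in> cells1 (Src F)" "r \<in> cells1 (Trg F)"
    using s(4,5) by (simp_all add: hom1_iff)
  have "lwhisker (Trg F) (coord Q 1) (id2 (Trg F) r)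
      = rwhisker (Trg F) (map2 F (id2 (Src F) s)) (coord P 1)"
    using F.trg.lwhisker_id2[OF s(5) E0_comp(3)[OF s(3)]]
      F.trg.rwhisker_id2[OF E0_comp(3)[OF s(2)] F.map1_hom[OF s(4)]] F.map2_id2[OF c(1)] s(6)
    by simp
  then show ?thesis
    unfolding E_id2[OF assms]
    by (intro E_hom2I[OF S S]) (simp_all add: s(1) F.src.id2_hom F.trg.id2_hom c)
qed

lemma E_vcomp_hom:
  assumes \<sigma>: "hom2 (E_two_cat F) \<sigma> S T" and \<tau>: "hom2 (E_two_cat F) \<tau> T U"
  shows "hom2 (E_two_cat F) (vcomp (E_two_cat F) \<tau> \<sigma>) S U"
proof -
  obtain P Q where S: "hom1 (E_two_cat F) S P Q"
    using E_hom2_parallel(2)[OF \<sigma>] by blast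
  obtain \<beta> \<alpha> where a: "\<sigma> = Tuple [S, \<beta>, \<alpha>, T]" "hom1 (E_two_cat F) T P Q"
    "hom2 (Src F) \<beta> (coord S 1) (coord T 1)" "hom2 (Trg F) \<alpha> (coord S 2) (coord T 2)"
    "lwhisker (Trg F) (coord Q 1) \<alpha> = rwhisker (Trg F) (map2 F \<beta>) (coord P 1)"
    by (rule E_hom2E[OF \<sigma> S]) (rule that; assumption)
  obtain \<beta>' \<alpha>' where b: "\<tau> = Tuple [T, \<beta>', \<alpha>', U]" "hom1 (E_two_cat F) U P Q"
    "hom2 (Src F) \<beta>' (coord T 1) (coord U 1)" "hom2 (Trg F) \<alpha>' (coord T 2) (coord U 2)"
    "lwhisker (Trg F) (coord Q 1) \<alpha>' = rwhisker (Trg F) (map2 F \<beta>') (coord P 1)"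
    by (rule E_hom2E[OF \<tau> a(2)]) (rule that; assumption)
  note h = E_hom1_comp[OF S]
  have "lwhisker (Trg F) (coord Q 1) (vcomp (Trg F) \<alpha>' \<alpha>)
      = vcomp (Trg F) (lwhisker (Trg F) (coord Q 1) \<alpha>') (lwhisker (Trg F) (coord Q 1) \<alpha>)"
    by (rule F.trg.lwhisker_vcomp[OF a(4) b(4) h(4) E0_comp(3)[OF h(2)]])
  also have "\<dots> = vcomp (Trg F) (rwhisker (Trg F) (map2 F \<beta>') (coord P 1))
      (rwhisker (Trg F) (map2 F \<beta>) (coord P 1))"
    using a(5) b(5) by simp
  also have "\<dots> = rwhisker (Trg F) (vcomp (Trg F) (map2 F \<beta>') (map2 F \<beta>)) (coord P 1)"
    by (rule F.trg.rwhisker_vcomp[symmetric, OF F.map2_hom[OF a(3)] F.map2_hom[OF b(3)]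
          E0_comp(3)[OF h(1)] F.map1_hom[OF h(3)]])
  also have "\<dots> = rwhisker (Trg F) (map2 F (vcomp (Src F) \<beta>' \<beta>)) (coord P 1)"
    using F.map2_vcomp[OF a(3) b(3)] by simp
  finally have "hom2 (E_two_cat F) (Tuple [S, vcomp (Src F) \<beta>' \<beta>, vcomp (Trg F) \<alpha>' \<alpha>, U]) S U"
    by (intro E_hom2I[OF S b(2)] F.src.vcomp_hom[OF a(3) b(3)] F.trg.vcomp_hom[OF a(4) b(4)])
  then show ?thesis
    using E_vcomp[OF \<sigma>[unfolded a(1)] \<tau>[unfolded b(1)]] by (simp add: a(1) b(1))
qed

lemma category_E2: "category (catv (E_two_cat F))"
proof (unfold_locales, goal_cases)
  case (1 f)
  then show ?case using E2_comp[of f F] by (simp add: catv_def E_two_cat_def)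
next
  case (2 f)
  then show ?case using E2_comp[of f F] by (simp add: catv_def E_two_cat_def)
next
  case (3 x)
  then show ?case using E_id2_hom[of x] by (simp add: catv_def)
next
  case (4 f x y g z)
  then show ?case using E_vcomp_hom[OF 4] by (simp add: catv_def)
next
  case (5 \<sigma> S T)
  then obtain \<beta> \<alpha> where s: "\<sigma> = Tuple [S, \<beta>, \<alpha>, T]" "S \<in> E1 F" "T \<in> E1 F"
    "hom2 (Src F) \<beta> (coord S 1) (coord T 1)" "hom2 (Trg F) \<alpha> (coord S 2) (coord T 2)"
    by (elim E_hom2_compE) (rule that; assumption)
  have "vcomp (E_two_cat F) (id2 (E_two_cat F) T) \<sigma> = \<sigma>"
    using E_vcomp[OF 5[unfolded s(1)] E_id2_hom[OF s(3), unfolded E_id2[OF s(3)]]]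
      F.src.vcomp_id_left[OF s(4)] F.trg.vcomp_id_left[OF s(5)]
    by (simp add: E_id2[OF s(3)] s(1))
  then show ?case by (simp add: catv_def)
next
  case (6 \<sigma> S T)
  then obtain \<beta> \<alpha> where s: "\<sigma> = Tuple [S, \<beta>, \<alpha>, T]" "S \<in> E1 F" "T \<in> E1 F"
    "hom2 (Src F) \<beta> (coord S 1) (coord T 1)" "hom2 (Trg F) \<alpha> (coord S 2) (coord T 2)"
    by (elim E_hom2_compE) (rule that; assumption)
  have "vcomp (E_two_cat F) \<sigma> (id2 (E_two_cat F) S) = \<sigma>"
    using E_vcomp[OF E_id2_hom[OF s(2), unfolded E_id2[OF s(2)]] 6[unfolded s(1)]]
      F.src.vcomp_id_right[OF s(4)] F.trg.vcomp_id_right[OF s(5)]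
    by (simp add: E_id2[OF s(2)] s(1))
  then show ?case by (simp add: catv_def)
next
  case (7 \<rho> R S \<sigma> T \<tau> U)
  obtain \<beta> \<alpha> where s: "\<rho> = Tuple [R, \<beta>, \<alpha>, S]"
    "hom2 (Src F) \<beta> (coord R 1) (coord S 1)" "hom2 (Trg F) \<alpha> (coord R 2) (coord S 2)"
    by (rule E_hom2_compE[OF 7(1)]) (rule that; assumption)
  obtain \<beta>' \<alpha>' where t: "\<sigma> = Tuple [S, \<beta>', \<alpha>', T]"
    "hom2 (Src F) \<beta>' (coord S 1) (coord T 1)" "hom2 (Trg F) \<alpha>' (coord S 2) (coord T 2)"
    by (rule E_hom2_compE[OF 7(2)]) (rule that; assumption)
  obtain \<beta>'' \<alpha>'' where u: "\<tau> = Tuple [T, \<beta>'', \<alpha>'', U]"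
    "hom2 (Src F) \<beta>'' (coord T 1) (coord U 1)" "hom2 (Trg F) \<alpha>'' (coord T 2) (coord U 2)"
    by (rule E_hom2_compE[OF 7(3)]) (rule that; assumption)
  note st = E_vcomp[OF 7(1)[unfolded s(1)] 7(2)[unfolded t(1)]]
  note tu = E_vcomp[OF 7(2)[unfolded t(1)] 7(3)[unfolded u(1)]]
  note st_hom = E_vcomp_hom[OF 7(1,2), unfolded s(1) t(1) st]
  note tu_hom = E_vcomp_hom[OF 7(2,3), unfolded t(1) u(1) tu]
  have "vcomp (E_two_cat F) \<tau> (vcomp (E_two_cat F) \<sigma> \<rho>) = vcomp (E_two_cat F) (vcomp (E_two_cat F) \<tau> \<sigma>) \<rho>"
    using E_vcomp[OF st_hom 7(3)[unfolded u(1)]] E_vcomp[OF 7(1)[unfolded s(1)] tu_hom]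
      F.src.vcomp_assoc[OF s(2) t(2) u(2)] F.trg.vcomp_assoc[OF s(3) t(3) u(3)]
    by (simp add: s(1) t(1) u(1) st tu)
  then show ?case by (simp add: catv_def)
qed

lemma E_hcomp_hom:
  assumes \<sigma>: "hom2 (E_two_cat F) \<sigma> S T" "hom1 (E_two_cat F) S P Q" "hom1 (E_two_cat F) T P Q"
    and \<tau>: "hom2 (E_two_cat F) \<tau> S' T'" "hom1 (E_two_cat F) S' Q R" "hom1 (E_two_cat F) T' Q R"
  shows "hom2 (E_two_cat F) (hcomp (E_two_cat F) \<tau> \<sigma>)
    (comp1 (E_two_cat F) S' S) (comp1 (E_two_cat F) T' T)"
proof -
  obtain \<beta> \<alpha> where a: "\<sigma> = Tuple [S, \<beta>, \<alpha>, T]"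
    "hom2 (Src F) \<beta> (coord S 1) (coord T 1)" "hom2 (Trg F) \<alpha> (coord S 2) (coord T 2)"
    "lwhisker (Trg F) (coord Q 1) \<alpha> = rwhisker (Trg F) (map2 F \<beta>) (coord P 1)"
    by (rule E_hom2E[OF \<sigma>(1,2)]) (rule that; assumption)
  obtain \<beta>' \<alpha>' where b: "\<tau> = Tuple [S', \<beta>', \<alpha>', T']"
    "hom2 (Src F) \<beta>' (coord S' 1) (coord T' 1)" "hom2 (Trg F) \<alpha>' (coord S' 2) (coord T' 2)"
    "lwhisker (Trg F) (coord R 1) \<alpha>' = rwhisker (Trg F) (map2 F \<beta>') (coord Q 1)"
    by (rule E_hom2E[OF \<tau>(1,2)]) (rule that; assumption)
  note h = E_hom1_comp[OF \<sigma>(2)] and h' = E_hom1_comp[OF \<tau>(2)]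
  note f = E0_comp(3)[OF h(1)] E0_comp(3)[OF h(2)] E0_comp(3)[OF h'(2)]
  have \<alpha>: "homh (Trg F) \<alpha> (coord P 2) (coord Q 2)" and \<alpha>': "homh (Trg F) \<alpha>' (coord Q 2) (coord R 2)"
    using F.trg.hom2_homh[OF a(3) h(4)] F.trg.hom2_homh[OF b(3) h'(4)] by auto
  have \<beta>: "homh (Src F) \<beta> (coord P 0) (coord Q 0)" and \<beta>': "homh (Src F) \<beta>' (coord Q 0) (coord R 0)"
    using F.src.hom2_homh[OF a(2) h(3)] F.src.hom2_homh[OF b(2) h'(3)] by auto
  have "lwhisker (Trg F) (coord R 1) (hcomp (Trg F) \<alpha>' \<alpha>)
      = hcomp (Trg F) (rwhisker (Trg F) (map2 F \<beta>') (coord Q 1)) \<alpha>"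
    using F.trg.lwhisker_hcomp[OF \<alpha> \<alpha>' f(3)] b(4) by simp
  also have "\<dots> = hcomp (Trg F) (map2 F \<beta>') (rwhisker (Trg F) (map2 F \<beta>) (coord P 1))"
    using F.trg.hcomp_rwhisker[OF \<alpha> f(2) F.map2_homh[OF \<beta>']] a(4) by simp
  also have "\<dots> = rwhisker (Trg F) (map2 F (hcomp (Src F) \<beta>' \<beta>)) (coord P 1)"
    using F.trg.rwhisker_hcomp[OF f(1) F.map2_homh[OF \<beta>] F.map2_homh[OF \<beta>']] F.map2_hcomp[OF \<beta> \<beta>']
    by simp
  (* The two compatibility equations meet at the whisker in the middle. *)
  finally have w: "lwhisker (Trg F) (coord R 1) (hcomp (Trg F) \<alpha>' \<alpha>)
      = rwhisker (Trg F) (map2 F (hcomp (Src F) \<beta>' \<beta>)) (coord P 1)" .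
  have "hom2 (E_two_cat F) (Tuple [comp1 (E_two_cat F) S' S, hcomp (Src F) \<beta>' \<beta>, hcomp (Trg F) \<alpha>' \<alpha>,
      comp1 (E_two_cat F) T' T]) (comp1 (E_two_cat F) S' S) (comp1 (E_two_cat F) T' T)"
    by (rule E_hom2I[OF E_comp1_hom[OF \<sigma>(2) \<tau>(2)] E_comp1_hom[OF \<sigma>(3) \<tau>(3)] _ _ w])
      (use F.src.hcomp_hom[OF a(2) h(3) b(2) h'(3)] F.trg.hcomp_hom[OF a(3) h(4) b(3) h'(4)] in
        \<open>simp_all add: E_comp1_comp[OF \<sigma>(2) \<tau>(2)] E_comp1_comp[OF \<sigma>(3) \<tau>(3)] del: One_nat_def\<close>)
  then show ?thesis
    using E_hcomp[OF \<sigma>(1)[unfolded a(1)] \<tau>(1)[unfolded b(1)] \<sigma>(3) \<tau>(2)] by (simp add: a(1) b(1))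
qed

lemma two_category_E: "two_category (E_two_cat F)"
proof (rule two_categoryI, goal_cases)
  case 1
  show ?case by (rule category_E1)
next
  case 2
  show ?case by (rule category_E2)
next
  case (3 \<sigma> S T)
  show ?case using E_hom2_parallel[OF 3] by (auto simp: hom1_iff)
next
  case (4 \<sigma> \<tau> f f' g g' x y z)
  then show ?case by (rule E_hcomp_hom)
next
  case (5 \<sigma> S T P Q)
  obtain \<beta> \<alpha> where s: "\<sigma> = Tuple [S, \<beta>, \<alpha>, T]"
    "hom2 (Src F) \<beta> (coord S 1) (coord T 1)" "hom2 (Trg F) \<alpha> (coord S 2) (coord T 2)"
    by (rule E_hom2_compE[OF 5(1)]) (rule that; assumption)
  note S = E_hom1_comp[OF 5(2)]
  note i = E_id1_hom[OF S(2)]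
  have i1: "id1 (E_two_cat F) Q \<in> E1 F" using i by (simp add: hom1_iff)
  have "hcomp (E_two_cat F) (id2 (E_two_cat F) (id1 (E_two_cat F) Q)) \<sigma>
      = Tuple [comp1 (E_two_cat F) (id1 (E_two_cat F) Q) S, hcomp (Src F) (id2 (Src F) (id1 (Src F) (coord Q 0))) \<beta>,
          hcomp (Trg F) (id2 (Trg F) (id1 (Trg F) (coord Q 2))) \<alpha>, comp1 (E_two_cat F) (id1 (E_two_cat F) Q) T]"
    using E_hcomp[OF 5(1)[unfolded s(1)] E_id2_hom[OF i1, unfolded E_id2[OF i1]] 5(3) i]
    by (simp add: s(1) E_id2[OF i1]) (simp add: E_id1[OF S(2)])
  moreover have "comp1 (E_two_cat F) (id1 (E_two_cat F) Q) S = S"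
    "comp1 (E_two_cat F) (id1 (E_two_cat F) Q) T = T"
    using E1.Id_left[OF 5(2)] E1.Id_left[OF 5(3)] by (simp_all add: cat1_def)
  ultimately show ?case
    using F.src.hcomp_id_left[OF F.src.hom2_homh[OF s(2) S(3)]]
      F.trg.hcomp_id_left[OF F.trg.hom2_homh[OF s(3) S(4)]] by (simp add: s(1))
next
  case (6 \<sigma> S T P Q)
  obtain \<beta> \<alpha> where s: "\<sigma> = Tuple [S, \<beta>, \<alpha>, T]"
    "hom2 (Src F) \<beta> (coord S 1) (coord T 1)" "hom2 (Trg F) \<alpha> (coord S 2) (coord T 2)"
    by (rule E_hom2_compE[OF 6(1)]) (rule that; assumption)
  note S = E_hom1_comp[OF 6(2)]
  note i = E_id1_hom[OF S(1)]
  have i1: "id1 (E_two_cat F) P \<in> E1 F" using i by (simp add: hom1_iff)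
  have "hcomp (E_two_cat F) \<sigma> (id2 (E_two_cat F) (id1 (E_two_cat F) P))
      = Tuple [comp1 (E_two_cat F) S (id1 (E_two_cat F) P), hcomp (Src F) \<beta> (id2 (Src F) (id1 (Src F) (coord P 0))),
          hcomp (Trg F) \<alpha> (id2 (Trg F) (id1 (Trg F) (coord P 2))), comp1 (E_two_cat F) T (id1 (E_two_cat F) P)]"
    using E_hcomp[OF E_id2_hom[OF i1, unfolded E_id2[OF i1]] 6(1)[unfolded s(1)] i 6(2)]
    by (simp add: s(1) E_id2[OF i1]) (simp add: E_id1[OF S(1)])
  moreover have "comp1 (E_two_cat F) S (id1 (E_two_cat F) P) = S"
    "comp1 (E_two_cat F) T (id1 (E_two_cat F) P) = T"
    using E1.Id_right[OF 6(2)] E1.Id_right[OF 6(3)] by (simp_all add: cat1_def)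
  ultimately show ?case
    using F.src.hcomp_id_right[OF F.src.hom2_homh[OF s(2) S(3)]]
      F.trg.hcomp_id_right[OF F.trg.hom2_homh[OF s(3) S(4)]] by (simp add: s(1))
next
  case (7 \<rho> \<sigma> \<tau> R R' S S' T T' w x y z)
  obtain \<beta> \<alpha> where r: "\<rho> = Tuple [R, \<beta>, \<alpha>, R']"
    "hom2 (Src F) \<beta> (coord R 1) (coord R' 1)" "hom2 (Trg F) \<alpha> (coord R 2) (coord R' 2)"
    by (rule E_hom2_compE[OF 7(1)]) (rule that; assumption)
  obtain \<beta>' \<alpha>' where s: "\<sigma> = Tuple [S, \<beta>', \<alpha>', S']"
    "hom2 (Src F) \<beta>' (coord S 1) (coord S' 1)" "hom2 (Trg F) \<alpha>' (coord S 2) (coord S' 2)"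
    by (rule E_hom2_compE[OF 7(4)]) (rule that; assumption)
  obtain \<beta>'' \<alpha>'' where t: "\<tau> = Tuple [T, \<beta>'', \<alpha>'', T']"
    "hom2 (Src F) \<beta>'' (coord T 1) (coord T' 1)" "hom2 (Trg F) \<alpha>'' (coord T 2) (coord T' 2)"
    by (rule E_hom2_compE[OF 7(7)]) (rule that; assumption)
  note R = E_hom1_comp[OF 7(2)] and S = E_hom1_comp[OF 7(5)] and T = E_hom1_comp[OF 7(8)]
  note rs = E_hcomp[OF 7(1)[unfolded r(1)] 7(4)[unfolded s(1)] 7(3,5)]
  note st = E_hcomp[OF 7(4)[unfolded s(1)] 7(7)[unfolded t(1)] 7(6,8)]
  note rs_hom = E_hcomp_hom[OF 7(1-6), unfolded r(1) s(1) rs]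
  note st_hom = E_hcomp_hom[OF 7(4-9), unfolded s(1) t(1) st]
  have assoc1: "comp1 (E_two_cat F) T (comp1 (E_two_cat F) S R) = comp1 (E_two_cat F) (comp1 (E_two_cat F) T S) R"
    "comp1 (E_two_cat F) T' (comp1 (E_two_cat F) S' R') = comp1 (E_two_cat F) (comp1 (E_two_cat F) T' S') R'"
    using E1.Comp_assoc[OF 7(2,5,8)] E1.Comp_assoc[OF 7(3,6,9)] by (simp_all add: cat1_def)
  show ?case
    using E_hcomp[OF rs_hom 7(7)[unfolded t(1)] E_comp1_hom[OF 7(3,6)] 7(8)]
      E_hcomp[OF 7(1)[unfolded r(1)] st_hom 7(3) E_comp1_hom[OF 7(5,8)]]
      F.src.hcomp_assoc[OF F.src.hom2_homh[OF r(2) R(3)] F.src.hom2_homh[OF s(2) S(3)]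
        F.src.hom2_homh[OF t(2) T(3)]]
      F.trg.hcomp_assoc[OF F.trg.hom2_homh[OF r(3) R(4)] F.trg.hom2_homh[OF s(3) S(4)]
        F.trg.hom2_homh[OF t(3) T(4)]] assoc1
    by (simp add: r(1) s(1) t(1) rs st)
next
  case (8 S T x y z)
  note S = E_hom1_comp[OF 8(1)] and T = E_hom1_comp[OF 8(2)]
  have c: "S \<in> E1 F" "T \<in> E1 F" "comp1 (E_two_cat F) T S \<in> E1 F"
    using 8 E_comp1_hom[OF 8] by (simp_all add: hom1_iff)
  show ?case
    using E_hcomp[OF E_id2_hom[OF c(1), unfolded E_id2[OF c(1)]]
        E_id2_hom[OF c(2), unfolded E_id2[OF c(2)]] 8]
      F.src.hcomp_id2[OF S(3) T(3)] F.trg.hcomp_id2[OF S(4) T(4)] E_comp1_comp[OF 8]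
    by (simp add: E_id2[OF c(1)] E_id2[OF c(2)] E_id2[OF c(3)] del: One_nat_def)
next
  case (9 \<sigma> \<sigma>' \<tau> \<tau>' S S' S'' T T' T'' x y z)
  obtain \<beta> \<alpha> where s: "\<sigma> = Tuple [S, \<beta>, \<alpha>, S']"
    "hom2 (Src F) \<beta> (coord S 1) (coord S' 1)" "hom2 (Trg F) \<alpha> (coord S 2) (coord S' 2)"
    by (rule E_hom2_compE[OF 9(1)]) (rule that; assumption)
  obtain \<beta>' \<alpha>' where s': "\<sigma>' = Tuple [S', \<beta>', \<alpha>', S'']"
    "hom2 (Src F) \<beta>' (coord S' 1) (coord S'' 1)" "hom2 (Trg F) \<alpha>' (coord S' 2) (coord S'' 2)"
    by (rule E_hom2_compE[OF 9(2)]) (rule that; assumption)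
  obtain \<gamma> \<delta> where t: "\<tau> = Tuple [T, \<gamma>, \<delta>, T']"
    "hom2 (Src F) \<gamma> (coord T 1) (coord T' 1)" "hom2 (Trg F) \<delta> (coord T 2) (coord T' 2)"
    by (rule E_hom2_compE[OF 9(6)]) (rule that; assumption)
  obtain \<gamma>' \<delta>' where t': "\<tau>' = Tuple [T', \<gamma>', \<delta>', T'']"
    "hom2 (Src F) \<gamma>' (coord T' 1) (coord T'' 1)" "hom2 (Trg F) \<delta>' (coord T' 2) (coord T'' 2)"
    by (rule E_hom2_compE[OF 9(7)]) (rule that; assumption)
  note S = E_hom1_comp[OF 9(3)] and T = E_hom1_comp[OF 9(8)]
  note vs = E_vcomp[OF 9(1)[unfolded s(1)] 9(2)[unfolded s'(1)]]
  note vt = E_vcomp[OF 9(6)[unfolded t(1)] 9(7)[unfolded t'(1)]]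
  note vs_hom = E_vcomp_hom[OF 9(1,2), unfolded s(1) s'(1) vs]
  note vt_hom = E_vcomp_hom[OF 9(6,7), unfolded t(1) t'(1) vt]
  note h = E_hcomp[OF 9(1)[unfolded s(1)] 9(6)[unfolded t(1)] 9(4) 9(8)]
  note h' = E_hcomp[OF 9(2)[unfolded s'(1)] 9(7)[unfolded t'(1)] 9(5) 9(9)]
  note h_hom = E_hcomp_hom[OF 9(1,3,4,6,8,9), unfolded s(1) t(1) h]
  note h_hom' = E_hcomp_hom[OF 9(2,4,5,7,9,10), unfolded s'(1) t'(1) h']
  show ?case
    using E_hcomp[OF vs_hom vt_hom 9(5,8)] E_vcomp[OF h_hom h_hom']
      F.src.interchange'[OF s(2) s'(2) t(2) t'(2) S(3) T(3)]
      F.trg.interchange'[OF s(3) s'(3) t(3) t'(3) S(4) T(4)]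
    by (simp add: s(1) s'(1) t(1) t'(1) vs vt h h')
next
  case (16 f g)
  then show ?case by (auto simp: E_two_cat_def E_comp1_def)
next
  case (17 \<sigma> \<tau>)
  then show ?case by (auto simp: E_two_cat_def)
next
  case (18 \<sigma> \<tau>)
  then show ?case using E2_comp[of \<sigma> F] E2_comp[of \<tau> F] by (auto simp: E_two_cat_def)
qed (simp_all add: E_two_cat_def)

end

section \<open>Functoriality in lax squares of 2-functors\<close>

text \<open>
  A square of 2-functors \<open>F\<close>, \<open>G\<close> (vertical) and \<open>H\<close>, \<open>K\<close> (horizontal) filled by a 2-natural
  transformation \<open>\<alpha> : K F \<Rightarrow> G H\<close>, which is given by its components on objects. The structure
  2-cell of a lax map at an arrow is of this form, and so is, with identity filler, each component
  of a commutative square between lax maps.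
\<close>

locale lax_cell =
  F: two_functor F + G: two_functor G + H: two_functor H + K: two_functor K
  for F G H K :: "'a cell two_fun" and \<alpha> :: "'a cell \<Rightarrow> 'a cell" +
  assumes bnd: "Src H = Src F" "Trg H = Src G" "Src K = Trg F" "Trg K = Trg G"
    and hom: "x \<in> cells0 (Src F) \<Longrightarrow>
      hom1 (Trg G) (\<alpha> x) (map0 K (map0 F x)) (map0 G (map0 H x))"
    and nat1: "hom1 (Src F) f x y \<Longrightarrow>
      comp1 (Trg G) (map1 G (map1 H f)) (\<alpha> x) = comp1 (Trg G) (\<alpha> y) (map1 K (map1 F f))"
    and nat2: "homh (Src F) \<sigma> x y \<Longrightarrow>
      rwhisker (Trg G) (map2 G (map2 H \<sigma>)) (\<alpha> x) = lwhisker (Trg G) (\<alpha> y) (map2 K (map2 F \<sigma>))"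

text \<open>A commutative square is filled by identities.\<close>

lemma lax_cell_strict:
  assumes "two_functor F" "two_functor G" "two_functor H" "two_functor K"
    and bnd: "Src H = Src F" "Trg H = Src G" "Src K = Trg F" "Trg K = Trg G"
    and eq: "comp_two_fun K F = comp_two_fun G H"
  shows "lax_cell F G H K (\<lambda>x. id1 (Trg G) (map0 K (map0 F x)))"
proof -
  interpret F: two_functor F by fact
  interpret G: two_functor G by fact
  interpret H: two_functor H by fact
  interpret K: two_functor K by fact
  have "map0 (comp_two_fun K F) x = map0 (comp_two_fun G H) x"
    "map1 (comp_two_fun K F) x = map1 (comp_two_fun G H) x"
    "map2 (comp_two_fun K F) x = map2 (comp_two_fun G H) x" for x
    by (simp_all add: eq)
  then have e: "x \<in> cells0 (Src F) \<Longrightarrow> map0 K (map0 F x) = map0 G (map0 H x)"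
    "x \<in> cells1 (Src F) \<Longrightarrow> map1 K (map1 F x) = map1 G (map1 H x)"
    "x \<in> cells2 (Src F) \<Longrightarrow> map2 K (map2 F x) = map2 G (map2 H x)" for x
    using bnd comp_two_fun_sel(3)[of x F K] comp_two_fun_sel(3)[of x H G]
      comp_two_fun_sel(4)[of x F K] comp_two_fun_sel(4)[of x H G]
      comp_two_fun_sel(5)[of x F K] comp_two_fun_sel(5)[of x H G] by simp_all
  show ?thesis
  proof (unfold_locales, goal_cases)
    case (5 x)
    then show ?case
      using G.trg.id1_hom[of "map0 K (map0 F x)"] F.map0_cells[of x] K.map0_cells[of "map0 F x"] bnd e(1)[of x]
      by simp
  next
    case (6 f x y)
    have f: "f \<in> cells1 (Src F)" "x \<in> cells0 (Src F)" "y \<in> cells0 (Src F)"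
      using 6 F.src.hom1_cells0[OF 6] by (simp_all add: hom1_iff)
    have "hom1 (Trg G) (map1 K (map1 F f)) (map0 K (map0 F x)) (map0 K (map0 F y))"
      using K.map1_hom F.map1_hom[OF 6] bnd by simp
    then show ?case
      using G.trg.comp1_id_left G.trg.comp1_id_right e(2)[OF f(1)] by metis
  next
    case (7 \<sigma> x y)
    have f: "\<sigma> \<in> cells2 (Src F)"
      using 7 by (simp add: homh_iff)
    have "homh (Trg G) (map2 K (map2 F \<sigma>)) (map0 K (map0 F x)) (map0 K (map0 F y))"
      using K.map2_homh F.map2_homh[OF 7] bnd by simp
    then show ?case
      unfolding lwhisker_def rwhisker_def
      using G.trg.hcomp_id_left G.trg.hcomp_id_right e(3)[OF f] by metis
  qed (use bnd in auto)
qed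

text \<open>
  The action on objects of the 2-functor induced by such a square: it sends \<open>f : a \<rightarrow> F x\<close> to the
  composite of \<open>K f : K a \<rightarrow> K (F x)\<close> with the component \<open>\<alpha> x : K (F x) \<rightarrow> G (H x)\<close>.
\<close>

definition E_obj :: "'a cell two_fun \<Rightarrow> 'a cell two_fun \<Rightarrow> 'a cell two_fun \<Rightarrow> ('a cell \<Rightarrow> 'a cell) \<Rightarrow>
    'a cell \<Rightarrow> 'a cell" where
  "E_obj G H K \<alpha> P = Tuple [map0 H (coord P 0),
     comp1 (Trg G) (\<alpha> (coord P 0)) (map1 K (coord P 1)), map0 K (coord P 2)]"

text \<open>
  The 2-functor induced by a square. It uses only the values of \<open>\<alpha>\<close> on objects of the source of
  \<open>F\<close>, so \<open>\<alpha>\<close> need not be extensional.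
\<close>

definition E_square :: "'a cell two_fun \<Rightarrow> 'a cell two_fun \<Rightarrow> 'a cell two_fun \<Rightarrow> 'a cell two_fun \<Rightarrow>
    ('a cell \<Rightarrow> 'a cell) \<Rightarrow> 'a cell two_fun" where
  "E_square F G H K \<alpha> = E_two_fun F G (E_obj G H K \<alpha>) H K"

lemma E_obj_coord [simp]:
  "coord (E_obj G H K \<alpha> P) 0 = map0 H (coord P 0)"
  "coord (E_obj G H K \<alpha> P) 1 = comp1 (Trg G) (\<alpha> (coord P 0)) (map1 K (coord P 1))"
  "coord (E_obj G H K \<alpha> P) (Suc 0) = comp1 (Trg G) (\<alpha> (coord P 0)) (map1 K (coord P 1))"
  "coord (E_obj G H K \<alpha> P) 2 = map0 K (coord P 2)"
  by (simp_all add: E_obj_def)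

lemma E_two_fun_sel [simp]:
  "Src (E_two_fun F G u H K) = E_two_cat F" "Trg (E_two_fun F G u H K) = E_two_cat G"
  "map0 (E_two_fun F G u H K) \<in> extensional (E0 F)"
  "map1 (E_two_fun F G u H K) \<in> extensional (E1 F)"
  "map2 (E_two_fun F G u H K) \<in> extensional (E2 F)"
  by (simp_all add: E_two_fun_def Let_def)

lemma E_two_fun_maps:
  "P \<in> E0 F \<Longrightarrow> map0 (E_two_fun F G u H K) P = u P"
  "Tuple [P, s, r, Q] \<in> E1 F \<Longrightarrow>
    map1 (E_two_fun F G u H K) (Tuple [P, s, r, Q]) = Tuple [u P, map1 H s, map1 K r, u Q]"
  "Tuple [S, \<beta>, \<alpha>, T] \<in> E2 F \<Longrightarrow> map2 (E_two_fun F G u H K) (Tuple [S, \<beta>, \<alpha>, T])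
    = Tuple [map1 (E_two_fun F G u H K) S, map2 H \<beta>, map2 K \<alpha>, map1 (E_two_fun F G u H K) T]"
  using E2_comp[of "Tuple [S, \<beta>, \<alpha>, T]" F] by (simp_all add: E_two_fun_def Let_def)

lemma E_two_fun_cong:
  assumes "\<And>P. P \<in> E0 F \<Longrightarrow> u P = u' P"
  shows "E_two_fun F G u H K = E_two_fun F G u' H K"
proof -
  have m1: "map1 (E_two_fun F G u H K) S = map1 (E_two_fun F G u' H K) S" if "S \<in> E1 F" for S
    using that assms E1_comp[OF that] by (cases rule: E1E[OF that]) (simp add: E_two_fun_maps)
  have m2: "map2 (E_two_fun F G u H K) \<sigma> = map2 (E_two_fun F G u' H K) \<sigma>" if "\<sigma> \<in> E2 F" for \<sigma>
    using that m1 E2_comp[OF that] by (cases rule: E2E[OF that]) (simp add: E_two_fun_maps)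
  show ?thesis
    by (rule two_fun_eqI[of _ "E_two_cat F"]) (simp_all add: E_two_fun_maps(1) assms m1 m2)
qed

lemma E_square_sel [simp]:
  "Src (E_square F G H K \<alpha>) = E_two_cat F" "Trg (E_square F G H K \<alpha>) = E_two_cat G"
  "map0 (E_square F G H K \<alpha>) \<in> extensional (E0 F)"
  "map1 (E_square F G H K \<alpha>) \<in> extensional (E1 F)"
  "map2 (E_square F G H K \<alpha>) \<in> extensional (E2 F)"
  by (simp_all add: E_square_def)

lemma E_square_maps:
  "P \<in> E0 F \<Longrightarrow> map0 (E_square F G H K \<alpha>) P = E_obj G H K \<alpha> P"
  "Tuple [P, s, r, Q] \<in> E1 F \<Longrightarrow> map1 (E_square F G H K \<alpha>) (Tuple [P, s, r, Q])
    = Tuple [E_obj G H K \<alpha> P, map1 H s, map1 K r, E_obj G H K \<alpha> Q]"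
  "Tuple [S, \<beta>, \<gamma>, T] \<in> E2 F \<Longrightarrow> map2 (E_square F G H K \<alpha>) (Tuple [S, \<beta>, \<gamma>, T])
    = Tuple [map1 (E_square F G H K \<alpha>) S, map2 H \<beta>, map2 K \<gamma>, map1 (E_square F G H K \<alpha>) T]"
  by (simp_all add: E_square_def E_two_fun_maps)

lemma E_square_map1_coord:
  assumes "S \<in> E1 F"
  shows "coord (map1 (E_square F G H K \<alpha>) S) 0 = E_obj G H K \<alpha> (coord S 0)"
    "coord (map1 (E_square F G H K \<alpha>) S) 1 = map1 H (coord S 1)"
    "coord (map1 (E_square F G H K \<alpha>) S) 2 = map1 K (coord S 2)"
    "coord (map1 (E_square F G H K \<alpha>) S) 3 = E_obj G H K \<alpha> (coord S 3)"
  using assms by (cases rule: E1E[OF assms]; simp add: E_square_maps)+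

lemma E_hom1_mem: "hom1 (E_two_cat F) S P Q \<Longrightarrow> S \<in> E1 F"
  by (simp add: E_hom1_iff)

lemma E_hom2_mem: "hom2 (E_two_cat F) \<sigma> S T \<Longrightarrow> \<sigma> \<in> E2 F"
  by (simp add: E_hom2_iff)

context lax_cell
begin

lemma obj_E0:
  assumes "P \<in> E0 F"
  shows "E_obj G H K \<alpha> P \<in> E0 G"
proof -
  note P = E0_comp[OF assms]
  have "hom1 (Trg G) (map1 K (coord P 1)) (map0 K (coord P 2)) (map0 K (map0 F (coord P 0)))"
    using K.map1_hom P(3) bnd by simp
  then have "hom1 (Trg G) (comp1 (Trg G) (\<alpha> (coord P 0)) (map1 K (coord P 1))) (map0 K (coord P 2))
      (map0 G (map0 H (coord P 0)))"
    using G.trg.comp1_hom hom[OF P(1)] by blast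
  then show ?thesis
    using H.map0_cells K.map0_cells P bnd unfolding E_obj_def E0_Tuple_iff by auto
qed

lemma square_map1_hom:
  assumes S: "hom1 (E_two_cat F) S P Q"
  shows "hom1 (E_two_cat G) (map1 (E_square F G H K \<alpha>) S) (E_obj G H K \<alpha> P) (E_obj G H K \<alpha> Q)"
proof -
  obtain s r where s: "S = Tuple [P, s, r, Q]" "P \<in> E0 F" "Q \<in> E0 F"
    "hom1 (Src F) s (coord P 0) (coord Q 0)" "hom1 (Trg F) r (coord P 2) (coord Q 2)"
    "comp1 (Trg F) (coord Q 1) r = comp1 (Trg F) (map1 F s) (coord P 1)"
    by (rule E_hom1E[OF S]) (rule that; assumption)
  note P = E0_comp[OF s(2)] and Q = E0_comp[OF s(3)]
  have Kf: "hom1 (Trg G) (map1 K (coord P 1)) (map0 K (coord P 2)) (map0 K (map0 F (coord P 0)))"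
    and Kg: "hom1 (Trg G) (map1 K (coord Q 1)) (map0 K (coord Q 2)) (map0 K (map0 F (coord Q 0)))"
    and Kr: "hom1 (Trg G) (map1 K r) (map0 K (coord P 2)) (map0 K (coord Q 2))"
    using K.map1_hom P(3) Q(3) s(5) bnd by simp_all
  have Hs: "hom1 (Src G) (map1 H s) (map0 H (coord P 0)) (map0 H (coord Q 0))"
    using H.map1_hom s(4) bnd by simp
  have KFs: "hom1 (Trg G) (map1 K (map1 F s)) (map0 K (map0 F (coord P 0))) (map0 K (map0 F (coord Q 0)))"
    using K.map1_hom F.map1_hom[OF s(4)] bnd by simp
  have "comp1 (Trg G) (comp1 (Trg G) (\<alpha> (coord Q 0)) (map1 K (coord Q 1))) (map1 K r)
      = comp1 (Trg G) (\<alpha> (coord Q 0)) (comp1 (Trg G) (map1 K (coord Q 1)) (map1 K r))"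
    by (rule G.trg.comp1_assoc[symmetric, OF Kr Kg hom[OF Q(1)]])
  also have "comp1 (Trg G) (map1 K (coord Q 1)) (map1 K r) = map1 K (comp1 (Trg F) (coord Q 1) r)"
    using K.map1_comp1[of r _ _ "coord Q 1"] s(5) Q(3) bnd by simp
  also have "\<dots> = comp1 (Trg G) (map1 K (map1 F s)) (map1 K (coord P 1))"
    unfolding s(6) using K.map1_comp1[of "coord P 1" _ _ "map1 F s"] P(3) F.map1_hom[OF s(4)] bnd by simp
  also have "comp1 (Trg G) (\<alpha> (coord Q 0)) (comp1 (Trg G) (map1 K (map1 F s)) (map1 K (coord P 1)))
      = comp1 (Trg G) (comp1 (Trg G) (map1 G (map1 H s)) (\<alpha> (coord P 0))) (map1 K (coord P 1))"
    using G.trg.comp1_assoc[OF Kf KFs hom[OF Q(1)]] nat1[OF s(4)] by simp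
  also have "\<dots> = comp1 (Trg G) (map1 G (map1 H s)) (comp1 (Trg G) (\<alpha> (coord P 0)) (map1 K (coord P 1)))"
    by (rule G.trg.comp1_assoc[symmetric, OF Kf hom[OF P(1)] G.map1_hom[OF Hs]])
  finally have eq: "comp1 (Trg G) (comp1 (Trg G) (\<alpha> (coord Q 0)) (map1 K (coord Q 1))) (map1 K r)
      = comp1 (Trg G) (map1 G (map1 H s)) (comp1 (Trg G) (\<alpha> (coord P 0)) (map1 K (coord P 1)))" .
  show ?thesis
    unfolding s(1) E_square_maps(2)[OF E_hom1_mem[OF S, unfolded s(1)]]
    by (rule E_hom1I[OF obj_E0[OF s(2)] obj_E0[OF s(3)]]) (simp_all add: Hs Kr eq del: One_nat_def)
qed

lemma square_map2_hom:
  assumes \<sigma>: "hom2 (E_two_cat F) \<sigma> S T"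
  shows "hom2 (E_two_cat G) (map2 (E_square F G H K \<alpha>) \<sigma>)
    (map1 (E_square F G H K \<alpha>) S) (map1 (E_square F G H K \<alpha>) T)"
proof -
  obtain P Q where S: "hom1 (E_two_cat F) S P Q"
    using E_hom2_parallel(2)[OF \<sigma>] by blast
  obtain \<beta> \<gamma> where a: "\<sigma> = Tuple [S, \<beta>, \<gamma>, T]" "hom1 (E_two_cat F) T P Q"
    "hom2 (Src F) \<beta> (coord S 1) (coord T 1)" "hom2 (Trg F) \<gamma> (coord S 2) (coord T 2)"
    "lwhisker (Trg F) (coord Q 1) \<gamma> = rwhisker (Trg F) (map2 F \<beta>) (coord P 1)"
    by (rule E_hom2E[OF \<sigma> S]) (rule that; assumption)
  note h = E_hom1_comp[OF S]
  note P = E0_comp[OF h(1)] and Q = E0_comp[OF h(2)]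
  have Kf: "hom1 (Trg G) (map1 K (coord P 1)) (map0 K (coord P 2)) (map0 K (map0 F (coord P 0)))"
    and Kg: "hom1 (Trg G) (map1 K (coord Q 1)) (map0 K (coord Q 2)) (map0 K (map0 F (coord Q 0)))"
    using K.map1_hom P(3) Q(3) bnd by simp_all
  have \<gamma>: "homh (Trg F) \<gamma> (coord P 2) (coord Q 2)"
    by (rule F.trg.hom2_homh[OF a(4) h(4)])
  have \<beta>: "homh (Src F) \<beta> (coord P 0) (coord Q 0)"
    by (rule F.src.hom2_homh[OF a(3) h(3)])
  have K\<gamma>: "homh (Trg G) (map2 K \<gamma>) (map0 K (coord P 2)) (map0 K (coord Q 2))"
    using K.map2_homh \<gamma> bnd by simp
  have KF\<beta>: "homh (Trg G) (map2 K (map2 F \<beta>)) (map0 K (map0 F (coord P 0))) (map0 K (map0 F (coord Q 0)))"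
    using K.map2_homh F.map2_homh[OF \<beta>] bnd by simp
  have GH\<beta>: "homh (Trg G) (map2 G (map2 H \<beta>)) (map0 G (map0 H (coord P 0))) (map0 G (map0 H (coord Q 0)))"
    using G.map2_homh H.map2_homh \<beta> bnd by simp
  have "lwhisker (Trg G) (comp1 (Trg G) (\<alpha> (coord Q 0)) (map1 K (coord Q 1))) (map2 K \<gamma>)
      = lwhisker (Trg G) (\<alpha> (coord Q 0)) (lwhisker (Trg G) (map1 K (coord Q 1)) (map2 K \<gamma>))"
    by (rule G.trg.lwhisker_comp1[OF K\<gamma> Kg hom[OF Q(1)]])
  also have "lwhisker (Trg G) (map1 K (coord Q 1)) (map2 K \<gamma>) = map2 K (lwhisker (Trg F) (coord Q 1) \<gamma>)"
    using K.map2_lwhisker[of \<gamma>] \<gamma> Q(3) bnd by simp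
  also have "\<dots> = rwhisker (Trg G) (map2 K (map2 F \<beta>)) (map1 K (coord P 1))"
    unfolding a(5) using K.map2_rwhisker[of "coord P 1" _ _ "map2 F \<beta>"] P(3) F.map2_homh[OF \<beta>] bnd by simp
  also have "lwhisker (Trg G) (\<alpha> (coord Q 0)) (rwhisker (Trg G) (map2 K (map2 F \<beta>)) (map1 K (coord P 1)))
      = rwhisker (Trg G) (rwhisker (Trg G) (map2 G (map2 H \<beta>)) (\<alpha> (coord P 0))) (map1 K (coord P 1))"
    using G.trg.rwhisker_lwhisker[OF Kf KF\<beta> hom[OF Q(1)]] nat2[OF \<beta>] by simp
  also have "\<dots> = rwhisker (Trg G) (map2 G (map2 H \<beta>))
      (comp1 (Trg G) (\<alpha> (coord P 0)) (map1 K (coord P 1)))"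
    by (rule G.trg.rwhisker_comp1[symmetric, OF Kf hom[OF P(1)] GH\<beta>])
  finally have eq: "lwhisker (Trg G) (comp1 (Trg G) (\<alpha> (coord Q 0)) (map1 K (coord Q 1))) (map2 K \<gamma>)
      = rwhisker (Trg G) (map2 G (map2 H \<beta>)) (comp1 (Trg G) (\<alpha> (coord P 0)) (map1 K (coord P 1)))" .
  have "hom2 (Src G) (map2 H \<beta>) (map1 H (coord S 1)) (map1 H (coord T 1))"
    "hom2 (Trg G) (map2 K \<gamma>) (map1 K (coord S 2)) (map1 K (coord T 2))"
    using H.map2_hom[of \<beta>] K.map2_hom[of \<gamma>] a(3,4) bnd by simp_all
  then show ?thesis
    unfolding a(1) E_square_maps(3)[OF E_hom2_mem[OF \<sigma>, unfolded a(1)]]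
    by (intro E_hom2I[OF square_map1_hom[OF S] square_map1_hom[OF a(2)]])
      (simp_all only: E_square_map1_coord[OF E_hom1_mem[OF S]] E_square_map1_coord[OF E_hom1_mem[OF a(2)]]
        E_obj_coord eq)
qed

lemma square_map1_comp1:
  assumes S: "hom1 (E_two_cat F) S P Q" and T: "hom1 (E_two_cat F) T Q R"
  shows "map1 (E_square F G H K \<alpha>) (comp1 (E_two_cat F) T S)
    = comp1 (E_two_cat G) (map1 (E_square F G H K \<alpha>) T) (map1 (E_square F G H K \<alpha>) S)"
proof -
  obtain s r where s: "S = Tuple [P, s, r, Q]"
    "hom1 (Src F) s (coord P 0) (coord Q 0)" "hom1 (Trg F) r (coord P 2) (coord Q 2)"
    by (rule E_hom1E[OF S]) (rule that; assumption)
  obtain t q where t: "T = Tuple [Q, t, q, R]"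
    "hom1 (Src F) t (coord Q 0) (coord R 0)" "hom1 (Trg F) q (coord Q 2) (coord R 2)"
    by (rule E_hom1E[OF T]) (rule that; assumption)
  note ST = S[unfolded s(1)] T[unfolded t(1)]
  note c = E_comp1[OF ST]
  note mS = E_square_maps(2)[OF E_hom1_mem[OF ST(1)], of G H K \<alpha>]
  note mT = E_square_maps(2)[OF E_hom1_mem[OF ST(2)], of G H K \<alpha>]
  have "hom1 (E_two_cat F) (comp1 (E_two_cat F) T S) P R"
    by (rule E_comp1_hom[OF F.two_functor_axioms S T])
  then have m: "Tuple [P, comp1 (Src F) t s, comp1 (Trg F) q r, R] \<in> E1 F"
    unfolding s(1) t(1) c by (rule E_hom1_mem)
  have "comp1 (E_two_cat G) (map1 (E_square F G H K \<alpha>) T) (map1 (E_square F G H K \<alpha>) S)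
     = Tuple [E_obj G H K \<alpha> P, comp1 (Src G) (map1 H t) (map1 H s),
         comp1 (Trg G) (map1 K q) (map1 K r), E_obj G H K \<alpha> R]"
    using E_comp1[OF square_map1_hom[OF ST(1), unfolded mS] square_map1_hom[OF ST(2), unfolded mT]]
    by (simp add: s(1) t(1) mS mT)
  then show ?thesis
    using H.map1_comp1[of s _ _ t] K.map1_comp1[of r _ _ q] s(2,3) t(2,3) bnd E_square_maps(2)[OF m]
    by (simp add: s(1) t(1) c)
qed

lemma two_functor_E_square: "two_functor (E_square F G H K \<alpha>)"
proof (rule two_functorI, goal_cases)
  case 1
  show ?case using two_category_E F.two_functor_axioms by simp
next
  case 2
  show ?case using two_category_E G.two_functor_axioms by simp
next
  case (6 x)
  then show ?case using obj_E0 by (simp add: E_square_maps)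
next
  case (7 S P Q)
  then have S: "hom1 (E_two_cat F) S P Q" by simp
  then show ?case using square_map1_hom[OF S] E_hom1_comp[OF S] by (simp add: E_square_maps(1))
next
  case (8 \<sigma> S T P Q)
  then show ?case using square_map2_hom by simp
next
  case (9 P)
  then have P: "P \<in> E0 F" by simp
  have "hom1 (E_two_cat F) (id1 (E_two_cat F) P) P P"
    by (rule E_id1_hom[OF F.two_functor_axioms P])
  from E_hom1_mem[OF this] show ?case
    using H.map1_id1[of "coord P 0"] K.map1_id1[of "coord P 2"] E0_comp[OF P] bnd
      E_id1[OF P] E_id1[OF obj_E0[OF P]]
    by (simp add: E_square_maps P)
next
  case (10 S)
  then have S: "S \<in> E1 F" by simp
  have "hom2 (E_two_cat F) (id2 (E_two_cat F) S) S S"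
    by (rule E_id2_hom[OF F.two_functor_axioms S])
  note m = E_hom2_mem[OF this, unfolded E_id2[OF S]]
  have S': "hom1 (E_two_cat F) S (coord S 0) (coord S 3)"
    using S by (simp add: E_hom1_iff)
  note mS = E_hom1_mem[OF square_map1_hom[OF S']]
  have c: "coord S 1 \<in> cells1 (Src H)" "coord S 2 \<in> cells1 (Src K)"
    using E_hom1_comp[OF S'] bnd by (simp_all add: hom1_iff)
  show ?case
    using E_square_maps(3)[OF m, of G H K \<alpha>] H.map2_id2[OF c(1)] K.map2_id2[OF c(2)] bnd
      E_square_map1_coord[OF S, of G H K \<alpha>]
    by (simp add: E_id2[OF S] E_id2[OF mS])
next
  case (11 S T P Q R)
  then show ?case using square_map1_comp1 by simp
next
  case (12 \<sigma> \<tau> S T U)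
  then have v: "hom2 (E_two_cat F) \<sigma> S T" "hom2 (E_two_cat F) \<tau> T U" by auto
  obtain \<beta> \<gamma> where s: "\<sigma> = Tuple [S, \<beta>, \<gamma>, T]"
    "hom2 (Src F) \<beta> (coord S 1) (coord T 1)" "hom2 (Trg F) \<gamma> (coord S 2) (coord T 2)"
    by (rule E_hom2_compE[OF v(1)]) (rule that; assumption)
  obtain \<beta>' \<gamma>' where t: "\<tau> = Tuple [T, \<beta>', \<gamma>', U]"
    "hom2 (Src F) \<beta>' (coord T 1) (coord U 1)" "hom2 (Trg F) \<gamma>' (coord T 2) (coord U 2)"
    by (rule E_hom2_compE[OF v(2)]) (rule that; assumption)
  note ST = v(1)[unfolded s(1)] v(2)[unfolded t(1)]
  note c = E_vcomp[OF ST]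
  note mS = E_square_maps(3)[OF E_hom2_mem[OF ST(1)], of G H K \<alpha>]
  note mT = E_square_maps(3)[OF E_hom2_mem[OF ST(2)], of G H K \<alpha>]
  have "hom2 (E_two_cat F) (vcomp (E_two_cat F) \<tau> \<sigma>) S U"
    by (rule E_vcomp_hom[OF F.two_functor_axioms v])
  note m = E_hom2_mem[OF this, unfolded s(1) t(1) c]
  show ?case
    using H.map2_vcomp[of \<beta> _ _ \<beta>'] K.map2_vcomp[of \<gamma> _ _ \<gamma>'] s(2,3) t(2,3) bnd
      E_square_maps(3)[OF m, of G H K \<alpha>]
      E_vcomp[OF square_map2_hom[OF ST(1), unfolded mS] square_map2_hom[OF ST(2), unfolded mT]]
    by (simp add: s(1) t(1) c mS mT)
next
  case (13 \<sigma> \<tau> S T S' T' P Q R)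
  then have v: "hom2 (E_two_cat F) \<sigma> S T" "hom1 (E_two_cat F) S P Q" "hom1 (E_two_cat F) T P Q"
    "hom2 (E_two_cat F) \<tau> S' T'" "hom1 (E_two_cat F) S' Q R" "hom1 (E_two_cat F) T' Q R" by auto
  obtain \<beta> \<gamma> where s: "\<sigma> = Tuple [S, \<beta>, \<gamma>, T]"
    "hom2 (Src F) \<beta> (coord S 1) (coord T 1)" "hom2 (Trg F) \<gamma> (coord S 2) (coord T 2)"
    by (rule E_hom2_compE[OF v(1)]) (rule that; assumption)
  obtain \<beta>' \<gamma>' where t: "\<tau> = Tuple [S', \<beta>', \<gamma>', T']"
    "hom2 (Src F) \<beta>' (coord S' 1) (coord T' 1)" "hom2 (Trg F) \<gamma>' (coord S' 2) (coord T' 2)"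
    by (rule E_hom2_compE[OF v(4)]) (rule that; assumption)
  note ST = v(1)[unfolded s(1)] v(4)[unfolded t(1)]
  note c = E_hcomp[OF ST v(3,5)]
  note mS = E_square_maps(3)[OF E_hom2_mem[OF ST(1)], of G H K \<alpha>]
  note mT = E_square_maps(3)[OF E_hom2_mem[OF ST(2)], of G H K \<alpha>]
  have "hom2 (E_two_cat F) (hcomp (E_two_cat F) \<tau> \<sigma>) (comp1 (E_two_cat F) S' S) (comp1 (E_two_cat F) T' T)"
    by (rule E_hcomp_hom[OF F.two_functor_axioms v])
  note m = E_hom2_mem[OF this, unfolded s(1) t(1) c]
  note S = E_hom1_comp[OF v(2)] and S' = E_hom1_comp[OF v(5)]
  have "map2 H (hcomp (Src F) \<beta>' \<beta>) = hcomp (Src G) (map2 H \<beta>') (map2 H \<beta>)"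
    using H.map2_hcomp[of \<beta> _ _ \<beta>'] F.src.hom2_homh[OF s(2) S(3)] F.src.hom2_homh[OF t(2) S'(3)] bnd
    by simp
  moreover have "map2 K (hcomp (Trg F) \<gamma>' \<gamma>) = hcomp (Trg G) (map2 K \<gamma>') (map2 K \<gamma>)"
    using K.map2_hcomp[of \<gamma> _ _ \<gamma>'] F.trg.hom2_homh[OF s(3) S(4)] F.trg.hom2_homh[OF t(3) S'(4)] bnd
    by simp
  ultimately show ?case
    using E_square_maps(3)[OF m, of G H K \<alpha>]
      E_hcomp[OF square_map2_hom[OF ST(1), unfolded mS] square_map2_hom[OF ST(2), unfolded mT]
        square_map1_hom[OF v(3)] square_map1_hom[OF v(5)]]
      square_map1_comp1[OF v(2,5)] square_map1_comp1[OF v(3,6)]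
    by (simp add: s(1) t(1) c mS mT)
qed simp_all

end

text \<open>
  Horizontal pasting of squares becomes composition of 2-functors. Applied to two arrows of \<open>D\<close> it
  gives functoriality of the diagram \<open>Ek\<close>; applied to an arrow of \<open>D\<close> and a component of a square
  of lax maps, in both orders, it gives naturality of the induced strict map; applied to two
  components, it gives preservation of composition.
\<close>

lemma E_square_comp:
  assumes "lax_cell F G H K \<alpha>" "lax_cell G L H' K' \<alpha>'"
  shows "comp_two_fun (E_square G L H' K' \<alpha>') (E_square F G H K \<alpha>)
    = E_square F L (comp_two_fun H' H) (comp_two_fun K' K)
        (\<lambda>x. comp1 (Trg L) (\<alpha>' (map0 H x)) (map1 K' (\<alpha> x)))"
    (is "comp_two_fun ?B ?A = ?C")
proof -
  interpret A: lax_cell F G H K \<alpha> by fact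
  interpret B: lax_cell G L H' K' \<alpha>' by fact
  have c: "map0 ?B (map0 ?A P) = map0 ?C P" if P: "P \<in> E0 F" for P
  proof -
    note p = E0_comp[OF P]
    have Kf: "hom1 (Trg G) (map1 K (coord P 1)) (map0 K (coord P 2)) (map0 K (map0 F (coord P 0)))"
      using A.K.map1_hom p(3) A.bnd by simp
    have K\<alpha>: "hom1 (Trg L) (map1 K' (\<alpha> (coord P 0))) (map0 K' (map0 K (map0 F (coord P 0))))
        (map0 K' (map0 G (map0 H (coord P 0))))"
      using B.K.map1_hom A.hom[OF p(1)] B.bnd by simp
    have KKf: "hom1 (Trg L) (map1 K' (map1 K (coord P 1))) (map0 K' (map0 K (coord P 2)))
        (map0 K' (map0 K (map0 F (coord P 0))))"
      using B.K.map1_hom Kf B.bnd by simp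
    have Hx: "map0 H (coord P 0) \<in> cells0 (Src G)"
      using A.H.map0_cells p(1) A.bnd by simp
    have "comp1 (Trg L) (\<alpha>' (map0 H (coord P 0)))
        (map1 K' (comp1 (Trg G) (\<alpha> (coord P 0)) (map1 K (coord P 1))))
      = comp1 (Trg L) (comp1 (Trg L) (\<alpha>' (map0 H (coord P 0))) (map1 K' (\<alpha> (coord P 0))))
        (map1 K' (map1 K (coord P 1)))"
      using B.K.map1_comp1[of "map1 K (coord P 1)" _ _ "\<alpha> (coord P 0)"] Kf A.hom[OF p(1)] B.bnd
        B.G.trg.comp1_assoc[OF KKf K\<alpha> B.hom[OF Hx]] by simp
    moreover have "coord P 1 \<in> cells1 (Src K)"
      using p(3) A.bnd by (simp add: hom1_iff)
    ultimately show ?thesis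
      using p A.bnd by (simp add: E_square_maps P A.obj_E0) (simp add: E_obj_def)
  qed
  have c1: "map1 ?B (map1 ?A S) = map1 ?C S" if S: "S \<in> E1 F" for S
  proof -
    have S': "hom1 (E_two_cat F) S (coord S 0) (coord S 3)"
      using S by (simp add: E_hom1_iff)
    obtain s r where s: "S = Tuple [coord S 0, s, r, coord S 3]"
      "hom1 (Src F) s (coord (coord S 0) 0) (coord (coord S 3) 0)"
      "hom1 (Trg F) r (coord (coord S 0) 2) (coord (coord S 3) 2)"
      by (rule E_hom1E[OF S']) (rule that; assumption)
    define P Q where PQ: "P = coord S 0" "Q = coord S 3"
    have S2: "S = Tuple [P, s, r, Q]" "P \<in> E0 F" "Q \<in> E0 F" "Tuple [P, s, r, Q] \<in> E1 F"
      using s(1) E1_comp[OF S] S by (auto simp: PQ)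
    have sr: "s \<in> cells1 (Src H)" "r \<in> cells1 (Src K)"
      using s(2,3) A.bnd by (simp_all add: hom1_iff)
    have m: "Tuple [E_obj G H K \<alpha> P, map1 H s, map1 K r, E_obj G H K \<alpha> Q] \<in> E1 G"
      using E_hom1_mem[OF A.square_map1_hom[OF S']] by (simp add: S2(1) E_square_maps(2)[OF S2(4)])
    show ?thesis
      using c[OF S2(2)] c[OF S2(3)] sr A.bnd
      by (simp add: S2(1) E_square_maps(2)[OF S2(4)] E_square_maps(2)[OF m] E_square_maps(1) S2(2,3) A.obj_E0)
  qed
  have c2: "map2 ?B (map2 ?A \<sigma>) = map2 ?C \<sigma>" if \<sigma>: "\<sigma> \<in> E2 F" for \<sigma>
  proof -
    obtain S T where \<sigma>': "hom2 (E_two_cat F) \<sigma> S T"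
      using \<sigma> by (simp add: E_hom2_iff)
    obtain \<beta> \<gamma> where s: "\<sigma> = Tuple [S, \<beta>, \<gamma>, T]" "S \<in> E1 F" "T \<in> E1 F"
      "hom2 (Src F) \<beta> (coord S 1) (coord T 1)" "hom2 (Trg F) \<gamma> (coord S 2) (coord T 2)"
      by (rule E_hom2_compE[OF \<sigma>']) (rule that; assumption)
    have m: "Tuple [S, \<beta>, \<gamma>, T] \<in> E2 F"
      using \<sigma> s(1) by simp
    have m': "Tuple [map1 ?A S, map2 H \<beta>, map2 K \<gamma>, map1 ?A T] \<in> E2 G"
      using E_hom2_mem[OF A.square_map2_hom[OF \<sigma>']] by (simp add: s(1) E_square_maps(3)[OF m])
    have "\<beta> \<in> cells2 (Src H)" "\<gamma> \<in> cells2 (Src K)"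
      using s(4,5) A.bnd by (simp_all add: hom2_iff)
    then show ?thesis
      using c1[OF s(2)] c1[OF s(3)] A.bnd
      by (simp add: s(1) E_square_maps(3)[OF m] E_square_maps(3)[OF m'])
  qed
  have e: "map0 (comp_two_fun ?B ?A) \<in> extensional (E0 F)"
    "map1 (comp_two_fun ?B ?A) \<in> extensional (E1 F)"
    "map2 (comp_two_fun ?B ?A) \<in> extensional (E2 F)"
    using comp_two_fun_ext[of ?B ?A] by simp_all
  show ?thesis
    by (rule two_fun_eqI[of _ "E_two_cat F"]) (simp_all add: e c c1 c2)
qed

lemma E_square_cong:
  assumes "\<And>x. x \<in> cells0 (Src F) \<Longrightarrow> \<alpha> x = \<alpha>' x"
  shows "E_square F G H K \<alpha> = E_square F G H K \<alpha>'"
  unfolding E_square_def by (rule E_two_fun_cong) (simp add: E_obj_def assms E0_comp)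

lemma E_square_id:
  assumes "two_functor F"
  shows "E_square F F (id_two_fun (Src F)) (id_two_fun (Trg F)) (\<lambda>x. id1 (Trg F) (map0 F x))
    = id_two_fun (E_two_cat F)" (is "?A = _")
proof -
  interpret F: two_functor F by fact
  have c0: "map0 ?A P = P" if P: "P \<in> E0 F" for P
  proof (cases rule: E0E[OF P])
    case (1 x f a)
    have x: "x \<in> cells0 (Src F)" "a \<in> cells0 (Trg F)" and f: "hom1 (Trg F) f a (map0 F x)"
      using P by (simp_all add: 1 E0_Tuple_iff)
    have "f \<in> cells1 (Trg F)"
      using f by (simp add: hom1_iff)
    then show ?thesis
      using x F.trg.comp1_id_left[OF f] by (simp add: E_square_maps(1)[OF P]) (simp add: 1 E_obj_def)
  qed
  have o: "E_obj F (id_two_fun (Src F)) (id_two_fun (Trg F)) (\<lambda>x. id1 (Trg F) (map0 F x)) P = P"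
    if P: "P \<in> E0 F" for P
    using c0[OF P] by (simp add: E_square_maps(1)[OF P])
  have c1: "map1 ?A S = S" if S: "S \<in> E1 F" for S
  proof (cases rule: E1E[OF S])
    case (1 P s r Q)
    have m: "Tuple [P, s, r, Q] \<in> E1 F"
      using S 1 by simp
    then have "P \<in> E0 F" "Q \<in> E0 F" "s \<in> cells1 (Src F)" "r \<in> cells1 (Trg F)"
      by (simp_all add: E1_Tuple_iff hom1_iff)
    then show ?thesis
      by (simp add: 1 E_square_maps(2)[OF m] o)
  qed
  have c2: "map2 ?A \<sigma> = \<sigma>" if S: "\<sigma> \<in> E2 F" for \<sigma>
  proof (cases rule: E2E[OF S])
    case (1 S \<beta> \<gamma> T)
    have m: "Tuple [S, \<beta>, \<gamma>, T] \<in> E2 F"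
      using S 1 by simp
    then have "S \<in> E1 F" "T \<in> E1 F" "\<beta> \<in> cells2 (Src F)" "\<gamma> \<in> cells2 (Trg F)"
      by (simp_all add: E2_Tuple_iff hom2_iff)
    then show ?thesis
      by (simp add: 1 E_square_maps(3)[OF m] c1)
  qed
  show ?thesis
    by (rule two_fun_eqI[of _ "E_two_cat F"])
      (use id_two_fun_ext[of "E_two_cat F"] in \<open>simp_all add: c0 c1 c2\<close>)
qed

text \<open>
  The 2-functors sending \<open>(x, f, a)\<close> to \<open>x\<close> and to \<open>a\<close>. They are the components of \<open>\<omega>\<close> and \<open>\<nu>\<close>,
  and their compatibility with squares yields both the naturality of \<open>\<omega>\<close> and \<open>\<nu>\<close> and the two
  equations of a morphism of spans.
\<close>

definition E_proj_src :: "'a cell two_fun \<Rightarrow> 'a cell two_fun" where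
  "E_proj_src F = \<lparr>Src = E_two_cat F, Trg = Src F,
     map0 = (\<lambda>P\<in>E0 F. coord P 0), map1 = (\<lambda>S\<in>E1 F. coord S 1), map2 = (\<lambda>\<sigma>\<in>E2 F. coord \<sigma> 1)\<rparr>"

definition E_proj_trg :: "'a cell two_fun \<Rightarrow> 'a cell two_fun" where
  "E_proj_trg F = \<lparr>Src = E_two_cat F, Trg = Trg F,
     map0 = (\<lambda>P\<in>E0 F. coord P 2), map1 = (\<lambda>S\<in>E1 F. coord S 2), map2 = (\<lambda>\<sigma>\<in>E2 F. coord \<sigma> 2)\<rparr>"

lemma E_proj_sel [simp]:
  "Src (E_proj_src F) = E_two_cat F" "Trg (E_proj_src F) = Src F"
  "Src (E_proj_trg F) = E_two_cat F" "Trg (E_proj_trg F) = Trg F"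
  "map0 (E_proj_src F) \<in> extensional (E0 F)" "map1 (E_proj_src F) \<in> extensional (E1 F)"
  "map2 (E_proj_src F) \<in> extensional (E2 F)"
  "map0 (E_proj_trg F) \<in> extensional (E0 F)" "map1 (E_proj_trg F) \<in> extensional (E1 F)"
  "map2 (E_proj_trg F) \<in> extensional (E2 F)"
  by (simp_all add: E_proj_src_def E_proj_trg_def)

lemma E_proj_maps:
  "P \<in> E0 F \<Longrightarrow> map0 (E_proj_src F) P = coord P 0" "S \<in> E1 F \<Longrightarrow> map1 (E_proj_src F) S = coord S 1"
  "\<sigma> \<in> E2 F \<Longrightarrow> map2 (E_proj_src F) \<sigma> = coord \<sigma> 1"
  "P \<in> E0 F \<Longrightarrow> map0 (E_proj_trg F) P = coord P 2" "S \<in> E1 F \<Longrightarrow> map1 (E_proj_trg F) S = coord S 2"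
  "\<sigma> \<in> E2 F \<Longrightarrow> map2 (E_proj_trg F) \<sigma> = coord \<sigma> 2"
  by (simp_all add: E_proj_src_def E_proj_trg_def)

lemma E_hom2_comp:
  assumes "hom2 (E_two_cat F) \<sigma> S T"
  shows "S \<in> E1 F" "T \<in> E1 F"
    "hom2 (Src F) (coord \<sigma> 1) (coord S 1) (coord T 1)" "hom2 (Trg F) (coord \<sigma> 2) (coord S 2) (coord T 2)"
  by (rule E_hom2_compE[OF assms]; simp)+

lemma E_vcomp_comp:
  assumes "hom2 (E_two_cat F) \<sigma> S T" "hom2 (E_two_cat F) \<tau> T U"
  shows "coord (vcomp (E_two_cat F) \<tau> \<sigma>) 1 = vcomp (Src F) (coord \<tau> 1) (coord \<sigma> 1)"
    "coord (vcomp (E_two_cat F) \<tau> \<sigma>) 2 = vcomp (Trg F) (coord \<tau> 2) (coord \<sigma> 2)"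
  using assms[unfolded E_hom2_iff] by (simp_all add: E_two_cat_def)

lemma E_hcomp_comp:
  assumes "hom2 (E_two_cat F) \<sigma> S T" "hom2 (E_two_cat F) \<tau> S' T'"
    and "hom1 (E_two_cat F) T P Q" "hom1 (E_two_cat F) S' Q R"
  shows "coord (hcomp (E_two_cat F) \<tau> \<sigma>) 1 = hcomp (Src F) (coord \<tau> 1) (coord \<sigma> 1)"
    "coord (hcomp (E_two_cat F) \<tau> \<sigma>) 2 = hcomp (Trg F) (coord \<tau> 2) (coord \<sigma> 2)"
  using assms[unfolded E_hom1_iff E_hom2_iff] by (simp_all add: E_two_cat_def)

lemma two_functor_E_proj:
  assumes F: "two_functor F"
  shows "two_functor (E_proj_src F)" "two_functor (E_proj_trg F)"
proof -
  interpret F: two_functor F by fact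
  interpret E: two_category "E_two_cat F" by (rule two_category_E[OF F])
  have m1: "S \<in> E1 F" if "hom1 (E_two_cat F) S P Q" for S P Q
    using that by (rule E_hom1_mem)
  have m2: "\<sigma> \<in> E2 F" if "hom2 (E_two_cat F) \<sigma> S T" for \<sigma> S T
    using that by (rule E_hom2_mem)
  show "two_functor (E_proj_src F)"
  proof (rule two_functorI, goal_cases)
    case (6 x)
    then show ?case by (simp add: E_proj_maps E0_comp)
  next
    case (7 S P Q)
    then have "hom1 (E_two_cat F) S P Q" by simp
    then show ?case using E_hom1_comp[of F S P Q] m1 by (simp add: E_proj_maps)
  next
    case (8 \<sigma> S T P Q)
    then have "hom2 (E_two_cat F) \<sigma> S T" by simp
    then show ?case using E_hom2_comp[of F \<sigma> S T] m2 by (simp add: E_proj_maps)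
  next
    case (9 P)
    then show ?case using m1[OF E.id1_hom[of P]] by (simp add: E_proj_maps E_id1)
  next
    case (10 S)
    then show ?case using m2[OF E.id2_hom[of S]] by (simp add: E_proj_maps E_id2)
  next
    case (11 S T P Q R)
    then have h: "hom1 (E_two_cat F) S P Q" "hom1 (E_two_cat F) T Q R" by auto
    show ?case
      using m1[OF E.comp1_hom[OF h]] m1[OF h(1)] m1[OF h(2)] E_comp1_comp[OF h] by (simp add: E_proj_maps)
  next
    case (12 \<sigma> \<tau> S T U)
    then have h: "hom2 (E_two_cat F) \<sigma> S T" "hom2 (E_two_cat F) \<tau> T U" by auto
    show ?case
      using m2[OF E.vcomp_hom[OF h]] m2[OF h(1)] m2[OF h(2)] E_vcomp_comp[OF h] by (simp add: E_proj_maps)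
  next
    case (13 \<sigma> \<tau> S T S' T' P Q R)
    then have h: "hom2 (E_two_cat F) \<sigma> S T" "hom1 (E_two_cat F) S P Q" "hom2 (E_two_cat F) \<tau> S' T'"
      "hom1 (E_two_cat F) S' Q R" "hom1 (E_two_cat F) T P Q" by auto
    show ?case
      using m2[OF E.hcomp_hom[OF h(1-4)]] m2[OF h(1)] m2[OF h(3)] E_hcomp_comp[OF h(1,3,5,4)]
      by (simp add: E_proj_maps)
  qed (simp_all add: F.src.two_category_axioms E.two_category_axioms)
  show "two_functor (E_proj_trg F)"
  proof (rule two_functorI, goal_cases)
    case (6 x)
    then show ?case by (simp add: E_proj_maps E0_comp)
  next
    case (7 S P Q)
    then have "hom1 (E_two_cat F) S P Q" by simp
    then show ?case using E_hom1_comp[of F S P Q] m1 by (simp add: E_proj_maps)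
  next
    case (8 \<sigma> S T P Q)
    then have "hom2 (E_two_cat F) \<sigma> S T" by simp
    then show ?case using E_hom2_comp[of F \<sigma> S T] m2 by (simp add: E_proj_maps)
  next
    case (9 P)
    then show ?case using m1[OF E.id1_hom[of P]] by (simp add: E_proj_maps E_id1)
  next
    case (10 S)
    then show ?case using m2[OF E.id2_hom[of S]] by (simp add: E_proj_maps E_id2)
  next
    case (11 S T P Q R)
    then have h: "hom1 (E_two_cat F) S P Q" "hom1 (E_two_cat F) T Q R" by auto
    show ?case
      using m1[OF E.comp1_hom[OF h]] m1[OF h(1)] m1[OF h(2)] E_comp1_comp[OF h] by (simp add: E_proj_maps)
  next
    case (12 \<sigma> \<tau> S T U)
    then have h: "hom2 (E_two_cat F) \<sigma> S T" "hom2 (E_two_cat F) \<tau> T U" by auto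
    show ?case
      using m2[OF E.vcomp_hom[OF h]] m2[OF h(1)] m2[OF h(2)] E_vcomp_comp[OF h] by (simp add: E_proj_maps)
  next
    case (13 \<sigma> \<tau> S T S' T' P Q R)
    then have h: "hom2 (E_two_cat F) \<sigma> S T" "hom1 (E_two_cat F) S P Q" "hom2 (E_two_cat F) \<tau> S' T'"
      "hom1 (E_two_cat F) S' Q R" "hom1 (E_two_cat F) T P Q" by auto
    show ?case
      using m2[OF E.hcomp_hom[OF h(1-4)]] m2[OF h(1)] m2[OF h(3)] E_hcomp_comp[OF h(1,3,5,4)]
      by (simp add: E_proj_maps)
  qed (simp_all add: F.trg.two_category_axioms E.two_category_axioms)
qed

lemma E_proj_natural:
  assumes "lax_cell F G H K \<alpha>"
  shows "comp_two_fun H (E_proj_src F) = comp_two_fun (E_proj_src G) (E_square F G H K \<alpha>)"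
    "comp_two_fun K (E_proj_trg F) = comp_two_fun (E_proj_trg G) (E_square F G H K \<alpha>)"
proof -
  interpret A: lax_cell F G H K \<alpha> by fact
  interpret S: two_functor "E_square F G H K \<alpha>" by (rule A.two_functor_E_square)
  have m: "map0 (E_square F G H K \<alpha>) P \<in> E0 G" if "P \<in> E0 F" for P
    using S.map0_cells that by simp
  have m1: "map1 (E_square F G H K \<alpha>) S \<in> E1 G" if "S \<in> E1 F" for S
    using S.map1_cells that by simp
  have m2: "map2 (E_square F G H K \<alpha>) \<sigma> \<in> E2 G" if "\<sigma> \<in> E2 F" for \<sigma>
    using S.map2_cells that by simp
  have c2: "coord (map2 (E_square F G H K \<alpha>) \<sigma>) 1 = map2 H (coord \<sigma> 1)"
    "coord (map2 (E_square F G H K \<alpha>) \<sigma>) 2 = map2 K (coord \<sigma> 2)" if "\<sigma> \<in> E2 F" for \<sigma>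
    using that by (cases rule: E2E[OF that]; simp add: E_square_maps(3))+
  have e: "map0 (comp_two_fun X Y) \<in> extensional (E0 F)"
    "map1 (comp_two_fun X Y) \<in> extensional (E1 F)"
    "map2 (comp_two_fun X Y) \<in> extensional (E2 F)" if "Src Y = E_two_cat F" for X Y
    using comp_two_fun_ext[of X Y] that by simp_all
  show "comp_two_fun H (E_proj_src F) = comp_two_fun (E_proj_src G) (E_square F G H K \<alpha>)"
    by (rule two_fun_eqI[of _ "E_two_cat F"])
      (use A.bnd in \<open>simp_all add: e E_proj_maps m m1 m2 c2 E_square_map1_coord E_square_maps(1)
        A.obj_E0 del: One_nat_def\<close>)
  show "comp_two_fun K (E_proj_trg F) = comp_two_fun (E_proj_trg G) (E_square F G H K \<alpha>)"
    by (rule two_fun_eqI[of _ "E_two_cat F"])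
      (use A.bnd in \<open>simp_all add: e E_proj_maps m m1 m2 c2 E_square_map1_coord E_square_maps(1)
        A.obj_E0 del: One_nat_def\<close>)
qed

section \<open>The span of a lax map\<close>

lemma lax_map_cell:
  fixes k :: "('d, 'e, 'a cell) lax_map"
  assumes k: "D_lax_map D k" and \<phi>: "in_hom D \<phi> m n"
  shows "lax_cell (lfun k m) (lfun k n) (farr (lsrc k) \<phi>) (farr (ltrg k) \<phi>) (tn_comp (lnat k \<phi>))"
proof -
  interpret k: D_lax_map D k by (rule k)
  have mn: "m \<in> Obj D" "n \<in> Obj D" and \<phi>': "\<phi> \<in> Arr D"
    using k.X.C.hom_objs[OF \<phi>] \<phi> by (auto simp: in_hom_def)
  note facts = k.lfun_two_functor[OF mn(1)] k.lfun_two_functor[OF mn(2)] k.src_push[OF \<phi>] k.trg_push[OF \<phi>]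
  interpret F: two_functor "lfun k m" by (rule facts)
  interpret G: two_functor "lfun k n" by (rule facts)
  interpret H: two_functor "farr (lsrc k) \<phi>" by (rule facts)
  interpret K: two_functor "farr (ltrg k) \<phi>" by (rule facts)
  interpret a: two_natural "lnat k \<phi>" by (rule k.lnat_natural[OF \<phi>'])
  have ab: "Src (tn_src (lnat k \<phi>)) = fobj (lsrc k) m" "Trg (tn_src (lnat k \<phi>)) = fobj (ltrg k) n"
    by (simp_all add: k.lnat_boundary[OF \<phi>] facts)
  show ?thesis
  proof (unfold_locales, goal_cases)
    case (5 x)
    then show ?case using k.lnat_hom[OF \<phi>, of x] by (simp add: facts)
  next
    case (6 f x y)
    then have f: "hom1 (fobj (lsrc k) m) f x y" by (simp add: facts)
    then have "f \<in> cells1 (fobj (lsrc k) m)" by (simp add: hom1_iff)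
    then show ?case
      using a.tn_natural1[of f x y] f by (simp add: ab facts k.lnat_boundary[OF \<phi>])
  next
    case (7 \<sigma> x y)
    then have f: "homh (fobj (lsrc k) m) \<sigma> x y" by (simp add: facts)
    then have "\<sigma> \<in> cells2 (fobj (lsrc k) m)" by (simp add: homh_iff)
    then show ?case
      using a.tn_natural2[of \<sigma> x y] f by (simp add: ab facts k.lnat_boundary[OF \<phi>])
  qed (simp_all add: facts)
qed

lemma E_push_eq:
  assumes k: "D_lax_map D k" and \<phi>: "in_hom D \<phi> m n"
  shows "E_push D k \<phi> = E_square (lfun k m) (lfun k n) (farr (lsrc k) \<phi>) (farr (ltrg k) \<phi>) (tn_comp (lnat k \<phi>))"
proof -
  interpret c: lax_cell "lfun k m" "lfun k n" "farr (lsrc k) \<phi>" "farr (ltrg k) \<phi>" "tn_comp (lnat k \<phi>)"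
    by (rule lax_map_cell[OF k \<phi>])
  show ?thesis
    using \<phi> c.bnd by (simp add: E_push_def E_square_def E_obj_def[abs_def] in_hom_def Let_def)
qed

lemma E_d2cat_sel [simp]:
  "m \<in> Obj D \<Longrightarrow> fobj (E_d2cat D k) m = E_two_cat (lfun k m)"
  "\<phi> \<in> Arr D \<Longrightarrow> farr (E_d2cat D k) \<phi> = E_push D k \<phi>"
  by (simp_all add: E_d2cat_def)

lemma cat_functor_E_d2cat:
  fixes k :: "('d, 'e, 'a cell) lax_map"
  assumes k: "D_lax_map D k"
  shows "cat_functor D TwoCat (E_d2cat D k)"
proof -
  interpret k: D_lax_map D k by (rule k)
  interpret T: category TwoCat by (rule category_TwoCat)
  have push: "in_hom TwoCat (E_push D k \<phi>) (E_two_cat (lfun k m)) (E_two_cat (lfun k n))"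
    if "in_hom D \<phi> m n" for \<phi> m n
    using lax_cell.two_functor_E_square[OF lax_map_cell[OF k that]]
    by (simp add: E_push_eq[OF k that] in_hom_TwoCat)
  have mem: "\<phi> \<in> Arr D \<and> m \<in> Obj D \<and> n \<in> Obj D" if "in_hom D \<phi> m n" for \<phi> m n
    using k.X.C.hom_objs[OF that] that by (auto simp: in_hom_def)
  show ?thesis
  proof (unfold_locales, goal_cases)
    case 1
    show ?case
      using two_category_E[OF k.lfun_two_functor(1)] by (auto simp: E_d2cat_def TwoCat_def)
  next
    case 2
    have "E_push D k \<phi> \<in> Arr TwoCat" if "\<phi> \<in> Arr D" for \<phi>
      using push[of \<phi> "Dom D \<phi>" "Cod D \<phi>"] that by (simp add: in_hom_def)
    then show ?case
      by (auto simp: E_d2cat_def)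
  next
    case (3 \<phi> m n)
    then show ?case using push[OF 3] mem[OF 3] by simp
  next
    case (4 m)
    note i = k.X.C.Id_hom[OF 4]
    note f = k.lfun_two_functor[OF 4]
    have e: "farr (lsrc k) (Id D m) = id_two_fun (Src (lfun k m))"
      "farr (ltrg k) (Id D m) = id_two_fun (Trg (lfun k m))"
      using k.X.farr_Id[OF 4] k.Y.farr_Id[OF 4] by (simp_all add: f)
    have "E_push D k (Id D m) = E_square (lfun k m) (lfun k m) (id_two_fun (Src (lfun k m)))
        (id_two_fun (Trg (lfun k m))) (\<lambda>x. id1 (Trg (lfun k m)) (map0 (lfun k m) x))"
      unfolding E_push_eq[OF k i] e
      by (rule E_square_cong) (simp add: k.lnat_Id[OF 4] id_two_nat_def)
    then show ?case
      using mem[OF i] by (simp add: E_square_id[OF f(1)])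
  next
    case (5 \<phi> m n \<psi> p)
    note c = k.X.C.Comp_hom[OF 5]
    note facts = k.lfun_two_functor[of m] k.lfun_two_functor[of n] k.lfun_two_functor[of p]
      k.src_push[OF 5(1)] k.trg_push[OF 5(1)] k.src_push[OF 5(2)] k.trg_push[OF 5(2)]
    have mn: "m \<in> Obj D" "n \<in> Obj D" "p \<in> Obj D" "\<phi> \<in> Arr D" "\<psi> \<in> Arr D"
      using mem[OF 5(1)] mem[OF 5(2)] by auto
    have e: "farr (lsrc k) (Comp D \<psi> \<phi>) = comp_two_fun (farr (lsrc k) \<psi>) (farr (lsrc k) \<phi>)"
      "farr (ltrg k) (Comp D \<psi> \<phi>) = comp_two_fun (farr (ltrg k) \<psi>) (farr (ltrg k) \<phi>)"
      using k.X.farr_Comp[OF 5] k.Y.farr_Comp[OF 5] by simp_all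
    have "E_push D k (Comp D \<psi> \<phi>) = E_square (lfun k m) (lfun k p)
        (comp_two_fun (farr (lsrc k) \<psi>) (farr (lsrc k) \<phi>)) (comp_two_fun (farr (ltrg k) \<psi>) (farr (ltrg k) \<phi>))
        (\<lambda>x. comp1 (Trg (lfun k p)) (tn_comp (lnat k \<psi>) (map0 (farr (lsrc k) \<phi>) x))
          (map1 (farr (ltrg k) \<psi>) (tn_comp (lnat k \<phi>) x)))"
      unfolding E_push_eq[OF k c] e
      by (rule E_square_cong)
        (simp add: k.lnat_Comp[OF 5] vcomp_two_nat_def nat_fun_def fun_nat_def facts mn
          k.lnat_boundary[OF 5(1)] k.lnat_boundary[OF 5(2)])
    also have "\<dots> = comp_two_fun (E_push D k \<psi>) (E_push D k \<phi>)"
      unfolding E_push_eq[OF k 5(1)] E_push_eq[OF k 5(2)]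
      by (rule E_square_comp[symmetric]) (rule lax_map_cell[OF k 5(1)] lax_map_cell[OF k 5(2)])+
    finally show ?case
      using mem[OF c] mn by simp
  qed
qed

lemma E_omega_sel [simp]:
  "nt_src (E_omega D k) = E_d2cat D k" "nt_trg (E_omega D k) = lsrc k"
  "m \<in> Obj D \<Longrightarrow> nt_comp (E_omega D k) m = E_proj_src (lfun k m)"
  "nt_comp (E_omega D k) \<in> extensional (Obj D)"
  by (simp_all add: E_omega_def E_proj_src_def Let_def)

lemma E_nu_sel [simp]:
  "nt_src (E_nu D k) = E_d2cat D k" "nt_trg (E_nu D k) = ltrg k"
  "m \<in> Obj D \<Longrightarrow> nt_comp (E_nu D k) m = E_proj_trg (lfun k m)"
  "nt_comp (E_nu D k) \<in> extensional (Obj D)"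
  by (simp_all add: E_nu_def E_proj_trg_def Let_def)

lemma E_omega_nu_hom:
  fixes k :: "('d, 'e, 'a cell) lax_map"
  assumes k: "D_lax_map D k"
  shows "in_hom (D2Cat D) (E_omega D k) (E_d2cat D k) (lsrc k)"
    "in_hom (D2Cat D) (E_nu D k) (E_d2cat D k) (ltrg k)"
proof -
  interpret k: D_lax_map D k by (rule k)
  interpret E: cat_functor D TwoCat "E_d2cat D k" by (rule cat_functor_E_d2cat[OF k])
  have nat: "comp_two_fun (farr (lsrc k) \<phi>) (E_proj_src (lfun k m))
      = comp_two_fun (E_proj_src (lfun k n)) (E_push D k \<phi>)"
    "comp_two_fun (farr (ltrg k) \<phi>) (E_proj_trg (lfun k m))
      = comp_two_fun (E_proj_trg (lfun k n)) (E_push D k \<phi>)"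
    if "in_hom D \<phi> m n" for \<phi> m n
    using E_proj_natural[OF lax_map_cell[OF k that]] by (simp_all add: E_push_eq[OF k that])
  have mem: "\<phi> \<in> Arr D \<and> m \<in> Obj D \<and> n \<in> Obj D" if "in_hom D \<phi> m n" for \<phi> m n
    using k.X.C.hom_objs[OF that] that by (auto simp: in_hom_def)
  have "natural_transformation D TwoCat (E_omega D k)"
  proof (intro natural_transformation.intro natural_transformation_axioms.intro, goal_cases)
    case (4 m)
    then show ?case
      using two_functor_E_proj(1)[OF k.lfun_two_functor(1)[OF 4]] k.lfun_two_functor[OF 4]
      by (simp add: in_hom_TwoCat)
  next
    case (5 \<phi> m n)
    then show ?case using nat(1)[OF 5] mem[OF 5] by simp
  qed (simp_all add: E.cat_functor_axioms k.X.cat_functor_axioms)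
  then show "in_hom (D2Cat D) (E_omega D k) (E_d2cat D k) (lsrc k)"
    by (simp add: in_hom_D2Cat)
  have "natural_transformation D TwoCat (E_nu D k)"
  proof (intro natural_transformation.intro natural_transformation_axioms.intro, goal_cases)
    case (4 m)
    then show ?case
      using two_functor_E_proj(2)[OF k.lfun_two_functor(1)[OF 4]] k.lfun_two_functor[OF 4]
      by (simp add: in_hom_TwoCat)
  next
    case (5 \<phi> m n)
    then show ?case using nat(2)[OF 5] mem[OF 5] by simp
  qed (simp_all add: E.cat_functor_axioms k.Y.cat_functor_axioms)
  then show "in_hom (D2Cat D) (E_nu D k) (E_d2cat D k) (ltrg k)"
    by (simp add: in_hom_D2Cat)
qed

lemma is_span_E_span:
  fixes k :: "('d, 'e, 'a cell) lax_map"
  assumes k: "D_lax_map D k"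
  shows "is_span (D2Cat D) (E_span D k)"
  using E_omega_nu_hom[OF k] category.hom_objs[OF category_D2Cat]
  by (simp add: is_span_def E_span_def) blast

section \<open>The span map of a square\<close>

text \<open>
  The formula for \<open>E\<close> on a morphism applies \<open>k\<close> to \<open>f\<close> without composing; it is the square
  construction with identity filler by the unit law.
\<close>

lemma lax_square_cell:
  fixes q :: "('d, 'e, 'a cell) lax_square"
  assumes q: "is_lax_square D q" and m: "m \<in> Obj D"
  defines "F \<equiv> lfun (sq_src q) m" and "G \<equiv> lfun (sq_trg q) m"
    and "H \<equiv> nt_comp (sq_h q) m" and "K \<equiv> nt_comp (sq_k q) m"
  shows "lax_cell F G H K (\<lambda>x. id1 (Trg G) (map0 K (map0 F x)))"
    "nt_comp (E_strict D q) m = E_square F G H K (\<lambda>x. id1 (Trg G) (map0 K (map0 F x)))"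
proof -
  note sq = is_lax_squareD[OF q]
  interpret i: D_lax_map D "sq_src q" by (rule sq(1))
  interpret j: D_lax_map D "sq_trg q" by (rule sq(2))
  note facts = i.lfun_two_functor[OF m] j.lfun_two_functor[OF m] strict_map_comp(1-3)[OF sq(3) m]
    strict_map_comp(1-3)[OF sq(4) m]
  have "lax_cell F G H K (\<lambda>x. id1 (Trg G) (map0 K (map0 F x)))"
    unfolding F_def G_def H_def K_def
    by (rule lax_cell_strict) (simp_all add: facts sq(5)[OF m])
  then show c: "lax_cell F G H K (\<lambda>x. id1 (Trg G) (map0 K (map0 F x)))" .
  interpret c: lax_cell F G H K "\<lambda>x. id1 (Trg G) (map0 K (map0 F x))" by (rule c)
  have u: "Tuple [map0 H (coord P 0), map1 K (coord P 1), map0 K (coord P 2)]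
      = E_obj G H K (\<lambda>x. id1 (Trg G) (map0 K (map0 F x))) P" if P: "P \<in> E0 F" for P
  proof -
    have "hom1 (Trg G) (map1 K (coord P 1)) (map0 K (coord P 2)) (map0 K (map0 F (coord P 0)))"
      using c.K.map1_hom[of "coord P 1"] E0_comp(3)[OF P] c.bnd by simp
    then show ?thesis
      using c.G.trg.comp1_id_left by (simp add: E_obj_def)
  qed
  have "nt_comp (E_strict D q) m
      = E_two_fun F G (\<lambda>P. Tuple [map0 H (coord P 0), map1 K (coord P 1), map0 K (coord P 2)]) H K"
    using m by (simp add: E_strict_def Let_def F_def G_def H_def K_def)
  also have "\<dots> = E_square F G H K (\<lambda>x. id1 (Trg G) (map0 K (map0 F x)))"
    unfolding E_square_def by (rule E_two_fun_cong) (rule u)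
  finally show "nt_comp (E_strict D q) m = E_square F G H K (\<lambda>x. id1 (Trg G) (map0 K (map0 F x)))" .
qed

lemma E_strict_sel [simp]:
  "nt_src (E_strict D q) = E_d2cat D (sq_src q)" "nt_trg (E_strict D q) = E_d2cat D (sq_trg q)"
  "nt_comp (E_strict D q) \<in> extensional (Obj D)"
  by (simp_all add: E_strict_def)

lemma E_strict_hom:
  fixes q :: "('d, 'e, 'a cell) lax_square"
  assumes q: "is_lax_square D q"
  shows "in_hom (D2Cat D) (E_strict D q) (E_d2cat D (sq_src q)) (E_d2cat D (sq_trg q))"
proof -
  note sq = is_lax_squareD[OF q]
  interpret i: D_lax_map D "sq_src q" by (rule sq(1))
  interpret j: D_lax_map D "sq_trg q" by (rule sq(2))
  have "natural_transformation D TwoCat (E_strict D q)"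
  proof (intro natural_transformation.intro natural_transformation_axioms.intro, goal_cases)
    case (4 m)
    then show ?case
      using lax_cell.two_functor_E_square[OF lax_square_cell(1)[OF q 4]]
      by (simp add: in_hom_TwoCat lax_square_cell(2)[OF q 4])
  next
    case (5 \<phi> m n)
    have mn: "m \<in> Obj D" "n \<in> Obj D" "\<phi> \<in> Arr D"
      using i.X.C.hom_objs[OF 5] 5 by (auto simp: in_hom_def)
    note facts = i.lfun_two_functor[OF mn(1)] i.lfun_two_functor[OF mn(2)]
      j.lfun_two_functor[OF mn(1)] j.lfun_two_functor[OF mn(2)]
      strict_map_comp(1-3)[OF sq(3) mn(1)] strict_map_comp(1-3)[OF sq(3) mn(2)]
      strict_map_comp(1-3)[OF sq(4) mn(1)] strict_map_comp(1-3)[OF sq(4) mn(2)]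
      i.src_push[OF 5] i.trg_push[OF 5] j.src_push[OF 5] j.trg_push[OF 5]
    define F where "F = lfun (sq_src q) m"
    define F' where "F' = lfun (sq_src q) n"
    define G where "G = lfun (sq_trg q) m"
    define G' where "G' = lfun (sq_trg q) n"
    define H where "H = nt_comp (sq_h q) m"
    define H' where "H' = nt_comp (sq_h q) n"
    define K where "K = nt_comp (sq_k q) m"
    define K' where "K' = nt_comp (sq_k q) n"
    define X where "X = farr (lsrc (sq_src q)) \<phi>"
    define Z where "Z = farr (ltrg (sq_src q)) \<phi>"
    define Y where "Y = farr (lsrc (sq_trg q)) \<phi>"
    define W where "W = farr (ltrg (sq_trg q)) \<phi>"
    define a where "a = tn_comp (lnat (sq_src q) \<phi>)"
    define b where "b = tn_comp (lnat (sq_trg q) \<phi>)"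
    note defs = F_def F'_def G_def G'_def H_def H'_def K_def K'_def X_def Z_def Y_def W_def a_def b_def
    note cells = lax_square_cell[OF q mn(1), folded defs] lax_square_cell[OF q mn(2), folded defs]
      lax_map_cell[OF sq(1) 5, folded defs] lax_map_cell[OF sq(2) 5, folded defs]
    interpret M: lax_cell F G H K "\<lambda>x. id1 (Trg G) (map0 K (map0 F x))" by (rule cells)
    interpret N: lax_cell F' G' H' K' "\<lambda>x. id1 (Trg G') (map0 K' (map0 F' x))" by (rule cells)
    interpret A: lax_cell F F' X Z a by (rule cells)
    interpret B: lax_cell G G' Y W b by (rule cells)
    have HX: "comp_two_fun Y H = comp_two_fun H' X"
      using strict_map_comp(4)[OF sq(3) 5] by (simp add: defs)
    have KZ: "comp_two_fun W K = comp_two_fun K' Z"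
      using strict_map_comp(4)[OF sq(4) 5] by (simp add: defs)
    have "comp_two_fun (E_push D (sq_trg q) \<phi>) (nt_comp (E_strict D q) m)
        = E_square F G' (comp_two_fun Y H) (comp_two_fun W K)
          (\<lambda>x. comp1 (Trg G') (b (map0 H x)) (map1 W (id1 (Trg G) (map0 K (map0 F x)))))"
      unfolding E_push_eq[OF sq(2) 5, folded defs] cells(2)
      by (rule E_square_comp[OF cells(1) cells(6)])
    also have "\<dots> = E_square F G' (comp_two_fun H' X) (comp_two_fun K' Z)
          (\<lambda>x. comp1 (Trg G') (id1 (Trg G') (map0 K' (map0 F' (map0 X x)))) (map1 K' (a x)))"
      unfolding HX KZ
    proof (rule E_square_cong)
      (* The fillers of the two pastings agree by k (i x) = j (h x), up to identity 1-cells. *)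
      fix x assume x: "x \<in> cells0 (Src F)"
      have GHKF: "map0 G (map0 H x) = map0 K (map0 F x)"
        using M.hom[OF x] M.G.trg.id1_hom[of "map0 K (map0 F x)"] M.K.map0_cells[of "map0 F x"]
          M.F.map0_cells[OF x] M.bnd by (simp add: hom1_iff)
      have c: "map0 K (map0 F x) \<in> cells0 (Src W)"
        using M.K.map0_cells M.F.map0_cells[OF x] M.bnd B.bnd by simp
      have Hx: "map0 H x \<in> cells0 (Src G)"
        using M.H.map0_cells x M.bnd by simp
      have "comp1 (Trg G') (b (map0 H x)) (map1 W (id1 (Trg G) (map0 K (map0 F x)))) = b (map0 H x)"
        using B.hom[OF Hx] B.K.map1_id1[OF c] N.G.trg.comp1_id_right B.bnd by (simp add: GHKF)
      moreover have "b (map0 H x) = map1 K' (a x)"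
        using sq(6)[OF 5] x by (simp add: defs facts)
      moreover have "comp1 (Trg G') (id1 (Trg G') (map0 K' (map0 F' (map0 X x)))) (map1 K' (a x))
          = map1 K' (a x)"
      proof (rule N.G.trg.comp1_id_left)
        show "hom1 (Trg G') (map1 K' (a x)) (map0 K' (map0 Z (map0 F x))) (map0 K' (map0 F' (map0 X x)))"
          using N.K.map1_hom A.hom[OF x] N.bnd by simp
      qed
      ultimately show "comp1 (Trg G') (b (map0 H x)) (map1 W (id1 (Trg G) (map0 K (map0 F x))))
          = comp1 (Trg G') (id1 (Trg G') (map0 K' (map0 F' (map0 X x)))) (map1 K' (a x))"
        by simp
    qed
    also have "\<dots> = comp_two_fun (nt_comp (E_strict D q) n) (E_push D (sq_src q) \<phi>)"
      unfolding E_push_eq[OF sq(1) 5, folded defs] cells(4)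
      by (rule E_square_comp[OF cells(5) cells(3), symmetric])
    finally show ?case
      by (simp add: mn)
  qed (simp_all add: cat_functor_E_d2cat sq(1,2))
  then show ?thesis
    by (simp add: in_hom_D2Cat)
qed

lemma E_strict_legs:
  fixes q :: "('d, 'e, 'a cell) lax_square"
  assumes q: "is_lax_square D q"
  shows "Comp (D2Cat D) (sq_h q) (E_omega D (sq_src q)) = Comp (D2Cat D) (E_omega D (sq_trg q)) (E_strict D q)"
    "Comp (D2Cat D) (sq_k q) (E_nu D (sq_src q)) = Comp (D2Cat D) (E_nu D (sq_trg q)) (E_strict D q)"
proof -
  note sq = is_lax_squareD[OF q]
  have b: "nt_trg (sq_h q) = lsrc (sq_trg q)" "nt_trg (sq_k q) = ltrg (sq_trg q)"
    using sq(3,4) by (simp_all add: in_hom_D2Cat)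
  have "comp_two_fun (nt_comp (sq_h q) m) (E_proj_src (lfun (sq_src q) m))
      = comp_two_fun (E_proj_src (lfun (sq_trg q) m)) (nt_comp (E_strict D q) m)"
    "comp_two_fun (nt_comp (sq_k q) m) (E_proj_trg (lfun (sq_src q) m))
      = comp_two_fun (E_proj_trg (lfun (sq_trg q) m)) (nt_comp (E_strict D q) m)"
    if "m \<in> Obj D" for m
    unfolding lax_square_cell(2)[OF q that]
    by (rule E_proj_natural[OF lax_square_cell(1)[OF q that]])+
  then show
    "Comp (D2Cat D) (sq_h q) (E_omega D (sq_src q)) = Comp (D2Cat D) (E_omega D (sq_trg q)) (E_strict D q)"
    "Comp (D2Cat D) (sq_k q) (E_nu D (sq_src q)) = Comp (D2Cat D) (E_nu D (sq_trg q)) (E_strict D q)"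
    by (auto intro!: nt_eqI[of _ _ "Obj D"] simp: b)
qed

lemma E_strict_Id:
  fixes i :: "('d, 'e, 'a cell) lax_map"
  assumes i: "D_lax_map D i"
  shows "E_strict D (Id (lax_arrow_cat D) i) = Id (D2Cat D) (E_d2cat D i)"
proof -
  interpret i: D_lax_map D i by (rule i)
  have "nt_comp (E_strict D (Id (lax_arrow_cat D) i)) m = id_two_fun (E_two_cat (lfun i m))"
    if m: "m \<in> Obj D" for m
  proof -
    note f = i.lfun_two_functor[OF m]
    have "nt_comp (E_strict D (Id (lax_arrow_cat D) i)) m
        = E_square (lfun i m) (lfun i m) (id_two_fun (Src (lfun i m))) (id_two_fun (Trg (lfun i m)))
          (\<lambda>x. id1 (Trg (lfun i m)) (map0 (id_two_fun (Trg (lfun i m))) (map0 (lfun i m) x)))"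
      using lax_square_cell(2)[OF is_lax_square_Id[OF i] m] by (simp add: f m)
    also have "\<dots> = E_square (lfun i m) (lfun i m) (id_two_fun (Src (lfun i m))) (id_two_fun (Trg (lfun i m)))
          (\<lambda>x. id1 (Trg (lfun i m)) (map0 (lfun i m) x))"
      by (rule E_square_cong) (simp add: two_functor.map0_cells[OF f(1)])
    also have "\<dots> = id_two_fun (E_two_cat (lfun i m))"
      by (rule E_square_id[OF f(1)])
    finally show ?thesis .
  qed
  then show ?thesis
    by (intro nt_eqI[of _ _ "Obj D"]) simp_all
qed

lemma E_strict_Comp:
  fixes p q :: "('d, 'e, 'a cell) lax_square"
  assumes q: "is_lax_square D q" and p: "is_lax_square D p" and pq: "sq_trg q = sq_src p"
  shows "E_strict D (Comp (lax_arrow_cat D) p q) = Comp (D2Cat D) (E_strict D p) (E_strict D q)"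
proof -
  have "nt_comp (E_strict D (Comp (lax_arrow_cat D) p q)) m
      = comp_two_fun (nt_comp (E_strict D p) m) (nt_comp (E_strict D q) m)" if m: "m \<in> Obj D" for m
  proof -
    define F where "F = lfun (sq_src q) m"
    define G where "G = lfun (sq_trg q) m"
    define L where "L = lfun (sq_trg p) m"
    define H where "H = nt_comp (sq_h q) m"
    define K where "K = nt_comp (sq_k q) m"
    define H' where "H' = nt_comp (sq_h p) m"
    define K' where "K' = nt_comp (sq_k p) m"
    note defs = F_def G_def L_def H_def K_def H'_def K'_def
    note cells = lax_square_cell[OF q m, folded defs] lax_square_cell[OF p m, folded pq, folded defs]
    interpret A: lax_cell F G H K "\<lambda>x. id1 (Trg G) (map0 K (map0 F x))" by (rule cells)
    interpret B: lax_cell G L H' K' "\<lambda>x. id1 (Trg L) (map0 K' (map0 G x))" by (rule cells)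
    have "nt_comp (E_strict D (Comp (lax_arrow_cat D) p q)) m
        = E_square F L (comp_two_fun H' H) (comp_two_fun K' K)
          (\<lambda>x. id1 (Trg L) (map0 (comp_two_fun K' K) (map0 F x)))"
      using lax_square_cell(2)[OF is_lax_square_Comp[OF q p pq] m] by (simp add: m defs)
    also have "\<dots> = E_square F L (comp_two_fun H' H) (comp_two_fun K' K)
        (\<lambda>x. comp1 (Trg L) (id1 (Trg L) (map0 K' (map0 G (map0 H x))))
          (map1 K' (id1 (Trg G) (map0 K (map0 F x)))))"
    proof (rule E_square_cong)
      fix x assume x: "x \<in> cells0 (Src F)"
      have KF: "map0 F x \<in> cells0 (Src K)" "map0 K (map0 F x) \<in> cells0 (Trg G)"
        using A.K.map0_cells A.F.map0_cells[OF x] A.bnd by simp_all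
      then have c: "map0 K' (map0 K (map0 F x)) \<in> cells0 (Trg L)"
        using B.K.map0_cells B.bnd by simp
      have GH: "map0 G (map0 H x) = map0 K (map0 F x)"
        using A.hom[OF x] A.G.trg.id1_hom[OF KF(2)] by (simp add: hom1_iff)
      have "map1 K' (id1 (Trg G) (map0 K (map0 F x))) = id1 (Trg L) (map0 K' (map0 K (map0 F x)))"
        using B.K.map1_id1[of "map0 K (map0 F x)"] KF(2) B.bnd by simp
      then show "id1 (Trg L) (map0 (comp_two_fun K' K) (map0 F x))
          = comp1 (Trg L) (id1 (Trg L) (map0 K' (map0 G (map0 H x))))
            (map1 K' (id1 (Trg G) (map0 K (map0 F x))))"
        using B.G.trg.comp1_id_left[OF B.G.trg.id1_hom[OF c]] KF(1) by (simp add: GH)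
    qed
    also have "\<dots> = comp_two_fun (nt_comp (E_strict D p) m) (nt_comp (E_strict D q) m)"
      unfolding cells(2,4) by (rule E_square_comp[OF cells(1,3), symmetric])
    finally show ?thesis .
  qed
  then show ?thesis
    by (intro nt_eqI[of _ _ "Obj D"]) simp_all
qed

section \<open>The functor to spans\<close>

theorem corollary4p45:
  fixes D :: "('d, 'e) cat"
  assumes "category D"
  shows "cat_functor
      (lax_arrow_cat D :: (('d, 'e, 'a cell) lax_map, ('d, 'e, 'a cell) lax_square) cat)
      (span_cat (D2Cat D)) (E_functor D)
    \<and> (\<forall>i :: ('d, 'e, 'a cell) lax_map. D_lax_map D i \<longrightarrow>
      fobj (E_functor D) i =
        \<lparr>lobj = lsrc i, apex = E_d2cat D i, robj = ltrg i, lleg = E_omega D i, rleg = E_nu D i\<rparr>)"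
proof (intro conjI allI impI)
  let ?C = "lax_arrow_cat D :: (('d, 'e, 'a cell) lax_map, ('d, 'e, 'a cell) lax_square) cat"
  interpret C: category ?C by (rule category_lax_arrow_cat)
  have ob: "i \<in> Obj ?C \<longleftrightarrow> D_lax_map D i" and ar: "q \<in> Arr ?C \<longleftrightarrow> is_lax_square D q" for i q
    by (simp_all add: lax_arrow_cat_def)
  have fo: "fobj (E_functor D) i = E_span D i" if "D_lax_map D i" for i :: "('d, 'e, 'a cell) lax_map"
    using that by (simp add: E_functor_def ob)
  have fa: "farr (E_functor D) q = \<lparr>sm_src = E_span D (sq_src q), sm_trg = E_span D (sq_trg q),
      lmap = sq_h q, amap = E_strict D q, rmap = sq_k q\<rparr>"
    if "is_lax_square D q" for q :: "('d, 'e, 'a cell) lax_square"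
    using that by (simp add: E_functor_def ar)
  have map: "is_span_map (D2Cat D) (farr (E_functor D) q)"
    if "is_lax_square D q" for q :: "('d, 'e, 'a cell) lax_square"
    using is_lax_squareD(1-4)[OF that] E_strict_hom[OF that] E_strict_legs[OF that]
      is_span_E_span[of D "sq_src q"] is_span_E_span[of D "sq_trg q"]
    by (simp add: fa[OF that] is_span_map_def) (simp add: E_span_def)
  show "cat_functor ?C (span_cat (D2Cat D)) (E_functor D)"
  proof (intro cat_functor.intro cat_functor_axioms.intro, goal_cases)
    case 1
    show ?case by (rule category_lax_arrow_cat)
  next
    case 2
    show ?case by (rule category.category_span_cat[OF category_D2Cat])
  next
    case 3
    have "fobj (E_functor D) i \<in> Obj (span_cat (D2Cat D))" if "i \<in> Obj ?C" for i
      using is_span_E_span[of D i] that by (simp add: fo ob) (simp add: span_cat_def)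
    then show ?case by (auto simp: E_functor_def)
  next
    case 4
    have "farr (E_functor D) q \<in> Arr (span_cat (D2Cat D))" if "q \<in> Arr ?C" for q
      using map[of q] that by (simp add: ar) (simp add: span_cat_def)
    then show ?case by (auto simp: E_functor_def)
  next
    case (5 q i j)
    then have q: "is_lax_square D q" "sq_src q = i" "sq_trg q = j"
      by (simp_all add: in_hom_lax_arrow_cat)
    show ?case
      using map[OF q(1)] fo[OF is_lax_squareD(1)[OF q(1)]] fo[OF is_lax_squareD(2)[OF q(1)]] q(2,3)
      by (simp add: in_hom_span_cat) (simp add: fa[OF q(1)])
  next
    case (6 i)
    then have i: "D_lax_map D i" by (simp add: ob)
    show ?case
      unfolding fo[OF i] fa[OF is_lax_square_Id[OF i]]
      by (simp add: span_cat_def E_strict_Id[OF i]) (simp add: E_span_def)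
  next
    case (7 q i j p l)
    then have q: "is_lax_square D q" "is_lax_square D p" "sq_trg q = sq_src p"
      by (simp_all add: in_hom_lax_arrow_cat)
    show ?case
      unfolding fa[OF is_lax_square_Comp[OF q]] fa[OF q(1)] fa[OF q(2)]
      by (simp add: span_cat_def E_strict_Comp[OF q])
  qed
  show "fobj (E_functor D) i =
      \<lparr>lobj = lsrc i, apex = E_d2cat D i, robj = ltrg i, lleg = E_omega D i, rleg = E_nu D i\<rparr>"
    if "D_lax_map D i" for i :: "('d, 'e, 'a cell) lax_map"
    using fo[OF that] by (simp add: E_span_def)
qed

end
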